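(* Let $S_{(R_1,R_2,t)}(l,j)$ denote the Taylor series invariant of the coupled angular momenta with parameters $R_1,R_2,t$ (at the focus-focus point $m=(0,0,1,0,0,-1)$, with the linear coefficient in $l$ understood modulo $\pi$), and let $R_1<R_2$ and $t^-<t<t^+$. Then $$S_{(R_1,R_2,t)}(l,j)=S_{(R_2,R_1,t')}(-l,j),\qquad t':=\frac{R_1t}{R_2+R_1t-R_2t}.$$
   Context: Coupled angular momenta with parameters $(R_1,R_2,t)$, $R_1,R_2>0$: $M=\mathbb{S}^2\times\mathbb{S}^2$, $\omega=-(R_1\omega_{\mathbb{S}^2}\oplus R_2\omega_{\mathbb{S}^2})$ with $\omega_{\mathbb{S}^2}$ the standard area form ($d\theta\wedge dz$), Cartesian coordinates $(x_i,y_i,z_i)$ on the $i$-th unit sphere, and $F=(L,H)$ with $$L=R_1(z_1-1)+R_2(z_2+1),\qquad H=(1-t)z_1+t(x_1x_2+y_1y_2+z_1z_2)+2t-1 .$$ It is called standard if $R_1<R_2$ and reverse if $R_1>R_2$. $t^\pm=\frac{R_2}{2R_2+R_1\mp2\sqrt{R_1R_2}}$; for $t^-<t<t^+$ the point $m$ is the unique focus-focus singularity, and $F(m)=(0,0)$. Hamiltonian vector fields satisfy $\omega(\mathcal{X}_f,\cdot)=-df$. Taylor series invariant. On $(\mathbb{R}^4,dx_1\wedge dy_1+dx_2\wedge dy_2)$ let $Q_1=x_1y_2-x_2y_1$, $Q_2=x_1y_1+x_2y_2$. Choose a symplectomorphism $\varphi:U\to V$ from a neighbourhood of $m$ to a neighbourhood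 of $0$ and a diffeomorphism $g:F(U)\to Q(V)$ with $g\circ F=Q\circ\varphi$, $L|_U=Q_1\circ\varphi$, $\partial g^{(2)}/\partial h>0$; put $\Phi=g\circ F$ on $F^{-1}(F(U))$. For regular $w=w_1+iw_2$ near $0$ and $a\in\Phi^{-1}(w)$, $\tau_2(w)>0$ is the first return time along $\mathcal{X}_{\Phi_2}$ to the $\Phi_1$-orbit of $a$, and $\tau_1(w)\in\mathbb{R}/2\pi\mathbb{Z}$ the time then needed along $\mathcal{X}_{\Phi_1}$ to return to $a$. With a determination of $\ln$, $\sigma_1=\tau_1-\mathrm{Im}(\ln w)$ and $\sigma_2=\tau_2+\mathrm{Re}(\ln w)$ extend smoothly to $w=0$; $S$ is the function with $dS=\sigma_1dw_1+\sigma_2dw_2$, $S(0)=0$, and the Taylor series invariant is its Taylor series at $0$, in the variables $(w_1,w_2)=(l,j)$, where $l$ is the value of $L$ and $j$ the value of $Q_2$.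
   Formalization: As printed, σ₁=τ₁−Im(ln w) with w=l+ij cannot extend to w=0, since τ₁ behaves like −arg w; the formal statement takes σ₁=τ₁±Im(ln w) for both signs, the plus sign being the one for which the invariant exists. *)

theory Defs
  imports "HOL-Analysis.Analysis"
begin

section \<open>Smooth maps on subsets of Euclidean spaces\<close>

text \<open>\<open>Ck_on k f W\<close> is meant for open \<open>W\<close>: \<open>f\<close> is of class \<open>C^k\<close> on \<open>W\<close>.\<close>

primrec Ck_on :: "nat \<Rightarrow> ('a::euclidean_space \<Rightarrow> 'b::euclidean_space) \<Rightarrow> 'a set \<Rightarrow> bool" where
  "Ck_on 0 f W \<longleftrightarrow> continuous_on W f"
| "Ck_on (Suc k) f W \<longleftrightarrow>
     (\<forall>x\<in>W. f differentiable (at x)) \<and>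
     (\<forall>v. Ck_on k (\<lambda>x. frechet_derivative f (at x) v) W)"

text \<open>Smoothness on an arbitrary subset means local extendability to a smooth map on an open set
  of the ambient space. On a submanifold (or an open part of one) this is smoothness in the
  manifold sense.\<close>

definition smooth_map_on :: "'a::euclidean_space set \<Rightarrow> ('a \<Rightarrow> 'b::euclidean_space) \<Rightarrow> bool" where
  "smooth_map_on A f \<longleftrightarrow>
     (\<forall>x\<in>A. \<exists>W f'. open W \<and> x \<in> W \<and> (\<forall>k. Ck_on k f' W) \<and> (\<forall>y\<in>A \<inter> W. f y = f' y))"

definition diffeomorphism_on ::
  "'a::euclidean_space set \<Rightarrow> 'b::euclidean_space set \<Rightarrow> ('a \<Rightarrow> 'b) \<Rightarrow> bool" where
  "diffeomorphism_on A B f \<longleftrightarrow>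
     bij_betw f A B \<and> smooth_map_on A f \<and> smooth_map_on B (inv_into A f)"


section \<open>The phase space and its Hamiltonian dynamics\<close>

type_synonym point = "(real^3) \<times> (real^3)"

definition M :: "point set" where
  "M = sphere 0 1 \<times> sphere 0 1"

definition tangent :: "point \<Rightarrow> point set" where
  "tangent p = {v. fst v \<bullet> fst p = 0 \<and> snd v \<bullet> snd p = 0}"

text \<open>On the unit sphere \<open>d\<theta> \<and> dz\<close> is the form \<open>(u, v) \<mapsto> p \<bullet> (u \<times> v)\<close> on the tangent space
  at \<open>p\<close>.\<close>

definition area_form :: "real^3 \<Rightarrow> real^3 \<Rightarrow> real^3 \<Rightarrow> real" where
  "area_form p u v = p \<bullet> cross3 u v"

definition omega :: "real \<Rightarrow> real \<Rightarrow> point \<Rightarrow> point \<Rightarrow> point \<Rightarrow> real" where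
  "omega R1 R2 p u v =
     - (R1 * area_form (fst p) (fst u) (fst v) + R2 * area_form (snd p) (snd u) (snd v))"

text \<open>In the following, \<open>W\<close> is an open subset of \<open>M\<close> on which the Hamiltonian function \<open>f\<close> is
  defined. The derivative of \<open>f\<close> within \<open>W\<close> is only determined on tangent vectors of \<open>M\<close>, and only
  these are used. The sign convention is \<open>\<omega>(X\<^sub>f, \<cdot>) = - df\<close>.\<close>

definition is_hamiltonian_vector ::
  "real \<Rightarrow> real \<Rightarrow> point set \<Rightarrow> (point \<Rightarrow> real) \<Rightarrow> point \<Rightarrow> point \<Rightarrow> bool" where
  "is_hamiltonian_vector R1 R2 W f p X \<longleftrightarrow>
     X \<in> tangent p \<and>
     (\<exists>df. (f has_derivative df) (at p within W) \<and>
           (\<forall>v\<in>tangent p. omega R1 R2 p X v = - df v))"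

definition is_integral_curve ::
  "real \<Rightarrow> real \<Rightarrow> point set \<Rightarrow> (point \<Rightarrow> real) \<Rightarrow> (real \<Rightarrow> point) \<Rightarrow> bool" where
  "is_integral_curve R1 R2 W f \<gamma> \<longleftrightarrow>
     (\<forall>s. \<gamma> s \<in> W \<and>
          (\<exists>X. is_hamiltonian_vector R1 R2 W f (\<gamma> s) X \<and> (\<gamma> has_vector_derivative X) (at s)))"

text \<open>The time-\<open>s\<close> flow of \<open>X\<^sub>f\<close> takes \<open>a\<close> to \<open>b\<close>.\<close>

definition flows_to ::
  "real \<Rightarrow> real \<Rightarrow> point set \<Rightarrow> (point \<Rightarrow> real) \<Rightarrow> real \<Rightarrow> point \<Rightarrow> point \<Rightarrow> bool" where
  "flows_to R1 R2 W f s a b \<longleftrightarrow> (\<exists>\<gamma>. is_integral_curve R1 R2 W f \<gamma> \<and> \<gamma> 0 = a \<and> \<gamma> s = b)"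

definition flow_orbit ::
  "real \<Rightarrow> real \<Rightarrow> point set \<Rightarrow> (point \<Rightarrow> real) \<Rightarrow> point \<Rightarrow> point set" where
  "flow_orbit R1 R2 W f a = {b. \<exists>s. flows_to R1 R2 W f s a b}"

text \<open>\<open>T2 > 0\<close> is the first return time along \<open>X\<^bsub>f2\<^esub>\<close> to the \<open>f1\<close>-orbit of \<open>a\<close>, and \<open>T1\<close> is a time then
  needed along \<open>X\<^bsub>f1\<^esub>\<close> to return to \<open>a\<close>. If \<open>X\<^bsub>f1\<^esub>\<close> generates a free circle action of period \<open>2\<pi>\<close>
  near \<open>a\<close>, then \<open>T1\<close> is determined exactly as an element of \<open>\<real> / 2\<pi>\<int>\<close>.\<close>

definition are_return_times ::
  "real \<Rightarrow> real \<Rightarrow> point set \<Rightarrow> (point \<Rightarrow> real) \<Rightarrow> (point \<Rightarrow> real) \<Rightarrow> point \<Rightarrow> real \<Rightarrow> real \<Rightarrow> bool"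
where
  "are_return_times R1 R2 W f1 f2 a T1 T2 \<longleftrightarrow>
     0 < T2 \<and>
     (\<exists>b. flows_to R1 R2 W f2 T2 a b \<and> b \<in> flow_orbit R1 R2 W f1 a \<and>
          flows_to R1 R2 W f1 T1 b a) \<and>
     (\<forall>s b. 0 < s \<and> s < T2 \<and> flows_to R1 R2 W f2 s a b \<longrightarrow> b \<notin> flow_orbit R1 R2 W f1 a)"


section \<open>Coupled angular momenta\<close>

definition L :: "real \<Rightarrow> real \<Rightarrow> point \<Rightarrow> real" where
  "L R1 R2 p = R1 * (fst p $ 3 - 1) + R2 * (snd p $ 3 + 1)"

definition H :: "real \<Rightarrow> point \<Rightarrow> real" where
  "H t p = (1 - t) * (fst p $ 3)
     + t * (fst p $ 1 * snd p $ 1 + fst p $ 2 * snd p $ 2 + fst p $ 3 * snd p $ 3) + 2 * t - 1"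

definition F :: "real \<Rightarrow> real \<Rightarrow> real \<Rightarrow> point \<Rightarrow> real \<times> real" where
  "F R1 R2 t p = (L R1 R2 p, H t p)"

definition ff_point :: point where
  "ff_point = (vector [0, 0, 1], vector [0, 0, - 1])"

definition t_plus :: "real \<Rightarrow> real \<Rightarrow> real" where
  "t_plus R1 R2 = R2 / (2 * R2 + R1 - 2 * sqrt (R1 * R2))"

definition t_minus :: "real \<Rightarrow> real \<Rightarrow> real" where
  "t_minus R1 R2 = R2 / (2 * R2 + R1 + 2 * sqrt (R1 * R2))"


section \<open>The local normal form at the focus-focus point\<close>

text \<open>\<open>\<real>\<^sup>4\<close> carries the coordinates \<open>(x1, y1, x2, y2)\<close>.\<close>

type_synonym R4 = "real \<times> real \<times> real \<times> real"

fun omega0 :: "R4 \<Rightarrow> R4 \<Rightarrow> real" where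
  "omega0 (a1, b1, a2, b2) (c1, d1, c2, d2) = (a1 * d1 - b1 * c1) + (a2 * d2 - b2 * c2)"

fun Q1 :: "R4 \<Rightarrow> real" where
  "Q1 (x1, y1, x2, y2) = x1 * y2 - x2 * y1"

fun Q2 :: "R4 \<Rightarrow> real" where
  "Q2 (x1, y1, x2, y2) = x1 * y1 + x2 * y2"

definition Q :: "R4 \<Rightarrow> real \<times> real" where
  "Q v = (Q1 v, Q2 v)"

definition is_symplectomorphism ::
  "real \<Rightarrow> real \<Rightarrow> point set \<Rightarrow> R4 set \<Rightarrow> (point \<Rightarrow> R4) \<Rightarrow> bool" where
  "is_symplectomorphism R1 R2 U V \<phi> \<longleftrightarrow>
     diffeomorphism_on U V \<phi> \<and>
     (\<forall>p\<in>U. \<exists>d\<phi>. (\<phi> has_derivative d\<phi>) (at p within U) \<and>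
        (\<forall>u\<in>tangent p. \<forall>v\<in>tangent p. omega0 (d\<phi> u) (d\<phi> v) = omega R1 R2 p u v))"

definition is_normal_form ::
  "real \<Rightarrow> real \<Rightarrow> real \<Rightarrow> point set \<Rightarrow> R4 set \<Rightarrow> (point \<Rightarrow> R4) \<Rightarrow> (real \<times> real \<Rightarrow> real \<times> real) \<Rightarrow> bool"
where
  "is_normal_form R1 R2 t U V \<phi> g \<longleftrightarrow>
     openin (top_of_set M) U \<and> ff_point \<in> U \<and>
     open V \<and> 0 \<in> V \<and>
     is_symplectomorphism R1 R2 U V \<phi> \<and> \<phi> ff_point = 0 \<and>
     open (F R1 R2 t ` U) \<and>
     diffeomorphism_on (F R1 R2 t ` U) (Q ` V) g \<and>
     (\<forall>p\<in>U. g (F R1 R2 t p) = Q (\<phi> p)) \<and>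
     (\<forall>p\<in>U. L R1 R2 p = Q1 (\<phi> p)) \<and>
     (\<forall>(l, h)\<in>F R1 R2 t ` U. 0 < deriv (\<lambda>y. snd (g (l, y))) h)"


section \<open>The Taylor series invariant\<close>

text \<open>A formal power series in \<open>(l, j)\<close> is given by its coefficients: \<open>s i k\<close> is the coefficient of
  \<open>l^i j^k\<close>.\<close>

definition partial_l :: "(real \<times> real \<Rightarrow> real) \<Rightarrow> real \<times> real \<Rightarrow> real" where
  "partial_l f w = deriv (\<lambda>x. f (x, snd w)) (fst w)"

definition partial_j :: "(real \<times> real \<Rightarrow> real) \<Rightarrow> real \<times> real \<Rightarrow> real" where
  "partial_j f w = deriv (\<lambda>y. f (fst w, y)) (snd w)"

definition taylor_coeff :: "(real \<times> real \<Rightarrow> real) \<Rightarrow> nat \<Rightarrow> nat \<Rightarrow> real" where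
  "taylor_coeff f i k = ((partial_l ^^ i) ((partial_j ^^ k) f)) (0, 0) / (fact i * fact k)"

text \<open>\<open>is_taylor_series_invariant \<epsilon> R1 R2 t s\<close>: the series \<open>s\<close> is the Taylor series invariant,
  computed from some normal form \<open>(U, V, \<phi>, g)\<close>. Here \<open>\<tau>1\<close> is a real-valued lift of the
  \<open>\<real> / 2\<pi>\<int>\<close>-valued return time; the smooth extension \<open>\<sigma>1\<close> fixes the lift up to a global multiple of
  \<open>2\<pi>\<close>, and this also absorbs the choice of a determination of the logarithm.

  The parameter \<open>\<epsilon>\<close> is the sign of the argument in \<open>\<sigma>1 = \<tau>1 + \<epsilon> Im (ln w)\<close>. The literature has
  \<open>\<epsilon> = -1\<close>, stated for Vu Ngoc's complex variable with \<open>Q2\<close> as real and \<open>Q1\<close> as imaginary part. For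
  \<open>w = w1 + i w2\<close> with \<open>w1\<close> the value of \<open>Q1\<close>, as used here, the sign has to be \<open>\<epsilon> = 1\<close>: the form
  \<open>\<tau>1 dw1 + \<tau>2 dw2\<close> is closed and \<open>\<tau>2 + ln \<bar>w\<bar>\<close> is smooth, which forces the singular part of \<open>\<tau>1\<close>
  to be \<open>- Im (ln w)\<close>.\<close>

definition is_taylor_series_invariant ::
  "real \<Rightarrow> real \<Rightarrow> real \<Rightarrow> real \<Rightarrow> (nat \<Rightarrow> nat \<Rightarrow> real) \<Rightarrow> bool" where
  "is_taylor_series_invariant \<epsilon> R1 R2 t s \<longleftrightarrow>
     (\<exists>U V \<phi> g. is_normal_form R1 R2 t U V \<phi> g \<and>
        (let W = {p\<in>M. F R1 R2 t p \<in> F R1 R2 t ` U};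
             \<Phi> = g \<circ> F R1 R2 t
         in \<exists>D \<tau>1 \<tau>2 \<sigma>1 \<sigma>2 S.
              open D \<and> (0, 0) \<in> D \<and> D \<subseteq> Q ` V \<and>
              (\<forall>w\<in>D - {(0, 0)}. \<forall>a\<in>W. \<Phi> a = w \<longrightarrow>
                 are_return_times R1 R2 W (fst \<circ> \<Phi>) (snd \<circ> \<Phi>) a (\<tau>1 w) (\<tau>2 w)) \<and>
              (\<forall>w\<in>D - {(0, 0)}.
                 \<sigma>1 w = \<tau>1 w + \<epsilon> * Im (Ln (Complex (fst w) (snd w))) \<and>
                 \<sigma>2 w = \<tau>2 w + Re (Ln (Complex (fst w) (snd w)))) \<and>
              smooth_map_on D \<sigma>1 \<and> smooth_map_on D \<sigma>2 \<and>
              (\<forall>w\<in>D. (S has_derivative (\<lambda>v. \<sigma>1 w * fst v + \<sigma>2 w * snd v)) (at w)) \<and>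
              S (0, 0) = 0 \<and>
              s = taylor_coeff S))"

text \<open>Equality of formal power series in \<open>(l, j)\<close>, with the coefficient of \<open>l\<close> understood
  modulo \<open>\<pi>\<close>.\<close>

definition eq_mod_pi_l :: "(nat \<Rightarrow> nat \<Rightarrow> real) \<Rightarrow> (nat \<Rightarrow> nat \<Rightarrow> real) \<Rightarrow> bool" where
  "eq_mod_pi_l s s' \<longleftrightarrow>
     (\<forall>i k. (i, k) \<noteq> (1, 0) \<longrightarrow> s i k = s' i k) \<and>
     (\<exists>n::int. s 1 0 = s' 1 0 + of_int n * pi)"

definition reflect_l :: "(nat \<Rightarrow> nat \<Rightarrow> real) \<Rightarrow> nat \<Rightarrow> nat \<Rightarrow> real" where
  "reflect_l s i k = (- 1) ^ i * s i k"

end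

theory Submission
  imports Defs "HOL-Real_Asymp.Real_Asymp"
begin

text \<open>Two facts carry the proof: the symmetry of the system under exchange of the two spheres, and the
independence of the Taylor series invariant of the chosen normal form. The second is needed because
the two given series may come from unrelated normal forms.

\<^emph>\<open>Symmetry.\<close> Exchanging the two spheres and turning both by \<open>\<pi>\<close> about the first axis (\<open>swap_spheres\<close>)
is a symplectic map from the system with parameters \<open>(R1, R2, t)\<close> to that with parameters
\<open>(R2, R1, t')\<close>. It turns \<open>L\<close> into \<open>- L\<close> and \<open>H\<close> into \<open>c * H - d * L\<close> with \<open>c > 0\<close>; that \<open>H\<close> goes into
such a combination is what singles out \<open>t'\<close> (\<open>F_swap\<close>, \<open>H_field_swap\<close>).

\<^emph>\<open>Return times.\<close> Every Hamiltonian vector field of a function \<open>G (L, H)\<close> is a combination of the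
vector fields of \<open>L\<close> and \<open>H\<close> with coefficients that are constant along each curve. The flow of \<open>L\<close> is
the simultaneous rotation \<open>rot\<close>, which commutes with the flow of \<open>H\<close>, so each curve of \<open>G (L, H)\<close> is a
rotated and rescaled curve of \<open>H\<close>. Hence all return times can be expressed by the return times of the
pair \<open>(L, H)\<close> itself (\<open>H_return\<close>), and these are unique, up to multiples of \<open>2 * \<pi>\<close> in the rotation
angle (\<open>H_return_unique\<close>). Comparing a normal form of the first system with the transported normal
form of the second one, whose values are related by a transition map \<open>(x, y) \<mapsto> (x, y + f (x, y))\<close>, shows
that the form \<open>\<tau>1 dx + \<tau>2 dy\<close> of one is the pullback of that of the other, modulo multiples of
\<open>2 * \<pi> dx\<close>.

\<^emph>\<open>Rigidity.\<close> It remains to see that \<open>f\<close> is flat at the origin (\<open>rigidity_on_ray\<close>, \<open>log_rigidity\<close>). On a ray \<open>r \<mapsto> (r, r * y)\<close>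
the singular part of the return times is \<open>- ln r\<close>, so the pullback relation says that a smooth function
plus \<open>ln r\<close> times a partial derivative of \<open>f\<close> is as small as the current bound on the derivatives
of \<open>f\<close> allows. Since a smooth function has no term \<open>r ^ k * ln r\<close> in its expansion, the leading
coefficient of the derivative of \<open>f\<close> vanishes (\<open>log_comparison\<close>), which improves the bound by one power
of \<open>r\<close>. By induction everything is flat on every ray, and a smooth function that is flat on the rays in
a half plane has vanishing Taylor coefficients (\<open>mixed_partial_eq_0_if_flat_on_rays\<close>). The argument of \<open>w\<close>
changes under the reflection \<open>w1 \<mapsto> - w1\<close> by a multiple of \<open>\<pi>\<close> besides its sign, which is the
ambiguity of the coefficient of \<open>l\<close>.\<close>

section \<open>Calculus of smooth maps\<close>



lemma Ck_on_cong:
  assumes "open W" "\<And>x. x \<in> W \<Longrightarrow> f x = g x"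
  shows "Ck_on k f W \<longleftrightarrow> Ck_on k g W"
proof -
  have "Ck_on k f W \<Longrightarrow> Ck_on k g W" if "\<And>x. x \<in> W \<Longrightarrow> f x = g x" for f g :: "'a \<Rightarrow> 'b"
    using that
  proof (induction k arbitrary: f g)
    case 0
    then show ?case by (simp cong: continuous_on_cong)
  next
    case (Suc k)
    have eq: "(f has_derivative D) (at x) \<longleftrightarrow> (g has_derivative D) (at x)" if "x \<in> W" for x D
      using has_derivative_transform_within_open[OF _ assms(1) that, of f D UNIV g]
        has_derivative_transform_within_open[OF _ assms(1) that, of g D UNIV f] Suc.prems(2) by auto
    have fd: "frechet_derivative f (at x) = frechet_derivative g (at x)" if "x \<in> W" for x
      unfolding frechet_derivative_def using eq[OF that] by simp
    have "Ck_on k (\<lambda>x. frechet_derivative g (at x) v) W" for v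
      by (rule Suc.IH[of "\<lambda>x. frechet_derivative f (at x) v"]) (use Suc.prems fd in auto)
    then show ?case
      using Suc.prems(1) eq unfolding Ck_on.simps differentiable_def by blast
  qed
  then show ?thesis using assms(2) by metis
qed

lemma Ck_on_mono: "Ck_on k f W \<Longrightarrow> X \<subseteq> W \<Longrightarrow> Ck_on k f X"
  by (induction k arbitrary: f) (auto intro: continuous_on_subset)

lemma Ck_on_locally:
  assumes "\<And>x. x \<in> W \<Longrightarrow> \<exists>X. open X \<and> x \<in> X \<and> Ck_on k f (X \<inter> W)" and "open W"
  shows "Ck_on k f W"
  using assms(1)
proof (induction k arbitrary: f)
  case 0
  have "isCont f x" if x: "x \<in> W" for x
  proof -
    obtain X where "open X" "x \<in> X" "continuous_on (X \<inter> W) f" using 0[OF x] by auto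
    then show ?thesis using assms(2) x by (simp add: continuous_on_eq_continuous_at open_Int)
  qed
  then show ?case by (simp add: continuous_at_imp_continuous_on)
next
  case (Suc k)
  then have "f differentiable (at x)" if "x \<in> W" for x using that by fastforce
  moreover have "Ck_on k (\<lambda>x. frechet_derivative f (at x) v) W" for v
    by (rule Suc.IH) (use Suc.prems in fastforce)
  ultimately show ?case by simp
qed

lemma Ck_on_continuous: "Ck_on k f W \<Longrightarrow> open W \<Longrightarrow> continuous_on W f"
  by (cases k) (auto intro!: continuous_at_imp_continuous_on differentiable_imp_continuous_within)

lemma Ck_on_Suc_imp: "Ck_on (Suc k) f W \<Longrightarrow> open W \<Longrightarrow> Ck_on k f W"
proof (induction k arbitrary: f)
  case 0
  then show ?case using Ck_on_continuous[OF 0] by simp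
next
  case (Suc k)
  then show ?case by simp
qed

text \<open>A derivative in closed form suffices; the Frechet derivative in the definition of \<open>Ck_on\<close> is then
determined on the open set.\<close>

lemma Ck_on_SucI:
  assumes "open W" "\<And>x. x \<in> W \<Longrightarrow> (f has_derivative f' x) (at x)" "\<And>v. Ck_on k (\<lambda>x. f' x v) W"
  shows "Ck_on (Suc k) f W"
proof -
  have "frechet_derivative f (at x) = f' x" if "x \<in> W" for x
    using assms(2)[OF that] frechet_derivative_at by metis
  then have "Ck_on k (\<lambda>x. frechet_derivative f (at x) v) W" for v
    using Ck_on_cong[OF assms(1), of "\<lambda>x. frechet_derivative f (at x) v" "\<lambda>x. f' x v" k] assms(3) by simp
  moreover have "f differentiable (at x)" if "x \<in> W" for x
    using assms(2)[OF that] by (auto simp: differentiable_def)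
  ultimately show ?thesis by simp
qed

lemma Ck_on_const: "open W \<Longrightarrow> Ck_on k (\<lambda>x. c) W"
proof (induction k arbitrary: c)
  case (Suc k)
  then show ?case by (intro Ck_on_SucI[where f'="\<lambda>x v. 0"]) auto
qed auto

lemma Ck_on_linear: "open W \<Longrightarrow> bounded_linear f \<Longrightarrow> Ck_on k f W"
proof (cases k)
  case 0
  then show "bounded_linear f \<Longrightarrow> ?thesis" by (simp add: linear_continuous_on)
next
  case (Suc n)
  assume "open W" "bounded_linear f"
  then show ?thesis unfolding Suc
    by (intro Ck_on_SucI[where f'="\<lambda>x. f"] bounded_linear_imp_has_derivative Ck_on_const)
qed

lemma Ck_on_add:
  assumes "open W" "Ck_on k f W" "Ck_on k g W" shows "Ck_on k (\<lambda>x. f x + g x) W"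
  using assms(2,3)
proof (induction k arbitrary: f g)
  case 0
  then show ?case by (simp add: continuous_on_add)
next
  case (Suc k)
  show ?case
    by (rule Ck_on_SucI[where f'="\<lambda>x v. frechet_derivative f (at x) v + frechet_derivative g (at x) v"])
      (use Suc assms(1) in \<open>auto intro!: has_derivative_add simp: frechet_derivative_works\<close>)
qed

lemma Ck_on_bilinear:
  fixes f :: "'a::euclidean_space \<Rightarrow> 'b::euclidean_space" and g :: "'a \<Rightarrow> 'c::euclidean_space"
    and pr :: "'b \<Rightarrow> 'c \<Rightarrow> 'd::euclidean_space"
  assumes pr: "bounded_bilinear pr" and "open W" "Ck_on k f W" "Ck_on k g W"
  shows "Ck_on k (\<lambda>x. pr (f x) (g x)) W"
  using assms(3,4)
proof (induction k arbitrary: f g)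
  case 0
  then show ?case using bounded_bilinear.continuous_on[OF pr] by auto
next
  case (Suc k)
  show ?case
  proof (rule Ck_on_SucI[where f'="\<lambda>x v. pr (f x) (frechet_derivative g (at x) v) + pr (frechet_derivative f (at x) v) (g x)"])
    show "((\<lambda>x. pr (f x) (g x)) has_derivative
         (\<lambda>v. pr (f x) (frechet_derivative g (at x) v) + pr (frechet_derivative f (at x) v) (g x))) (at x)"
      if "x \<in> W" for x
      by (rule bounded_bilinear.FDERIV[OF pr]) (use Suc.prems that in \<open>auto simp: frechet_derivative_works\<close>)
    show "Ck_on k (\<lambda>x. pr (f x) (frechet_derivative g (at x) v) + pr (frechet_derivative f (at x) v) (g x)) W" for v
    proof (intro Ck_on_add Suc.IH assms(2))
      show "Ck_on k f W" "Ck_on k g W"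
        using Suc.prems by (auto intro!: Ck_on_Suc_imp[OF _ assms(2)] simp del: Ck_on.simps)
    qed (use Suc.prems in auto)
  qed fact
qed

lemma Ck_on_sum:
  assumes "open W" "\<And>i. i \<in> I \<Longrightarrow> Ck_on k (f i) W"
  shows "Ck_on k (\<lambda>x. \<Sum>i\<in>I. f i x) W"
  using assms(2) by (induction I rule: infinite_finite_induct) (auto intro: Ck_on_const Ck_on_add assms(1))

text \<open>By the chain rule the derivative of \<open>g \<circ> f\<close> in a direction \<open>v\<close> is the sum over a basis of products of
a component of the derivative of \<open>f\<close> and a directional derivative of \<open>g\<close> at \<open>f x\<close>. Only the basis
expansion makes the second factor a composition with \<open>f\<close> to which the induction hypothesis applies.\<close>

lemma Ck_on_compose:
  fixes f :: "'a::euclidean_space \<Rightarrow> 'b::euclidean_space" and g :: "'b \<Rightarrow> 'c::euclidean_space"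
  assumes "open W" "open X" "f ` W \<subseteq> X" "Ck_on k f W" "Ck_on k g X"
  shows "Ck_on k (\<lambda>x. g (f x)) W"
  using assms(3-5)
proof (induction k arbitrary: f g)
  case 0
  then show ?case by (auto intro: continuous_on_compose2)
next
  case (Suc k)
  have f: "(f has_derivative frechet_derivative f (at x)) (at x)" if "x \<in> W" for x
    using Suc.prems(2) that by (auto simp: frechet_derivative_works)
  have g: "(g has_derivative frechet_derivative g (at (f x))) (at (f x))" if "x \<in> W" for x
    using Suc.prems(1,3) that by (auto simp: frechet_derivative_works)
  have split: "frechet_derivative g (at y) u = (\<Sum>b\<in>Basis. (u \<bullet> b) *\<^sub>R frechet_derivative g (at y) b)"
    if "y \<in> X" for y u
  proof -
    have "linear (frechet_derivative g (at y))"
      using Suc.prems(3) that by (auto intro: linear_frechet_derivative)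
    then have "frechet_derivative g (at y) (\<Sum>b\<in>Basis. (u \<bullet> b) *\<^sub>R b) = (\<Sum>b\<in>Basis. (u \<bullet> b) *\<^sub>R frechet_derivative g (at y) b)"
      by (simp add: linear_sum linear_scale)
    then show ?thesis by (simp add: euclidean_representation)
  qed
  show ?case
  proof (rule Ck_on_SucI[where f'="\<lambda>x v. \<Sum>b\<in>Basis. (frechet_derivative f (at x) v \<bullet> b) *\<^sub>R frechet_derivative g (at (f x)) b"])
    show "((\<lambda>x. g (f x)) has_derivative
          (\<lambda>v. \<Sum>b\<in>Basis. (frechet_derivative f (at x) v \<bullet> b) *\<^sub>R frechet_derivative g (at (f x)) b)) (at x)"
      if "x \<in> W" for x
    proof -
      have "((\<lambda>x. g (f x)) has_derivative (\<lambda>v. frechet_derivative g (at (f x)) (frechet_derivative f (at x) v))) (at x)"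
        using diff_chain_at[OF f[OF that] g[OF that]] by (simp add: o_def)
      moreover have "f x \<in> X" using Suc.prems(1) that by auto
      ultimately show ?thesis by (simp add: split[symmetric])
    qed
    show "Ck_on k (\<lambda>x. \<Sum>b\<in>Basis. (frechet_derivative f (at x) v \<bullet> b) *\<^sub>R frechet_derivative g (at (f x)) b) W" for v
    proof (intro Ck_on_sum Ck_on_bilinear[OF bounded_bilinear_scaleR] assms(1))
      fix b :: 'b
      have "Ck_on k (\<lambda>x. frechet_derivative f (at x) v) W" using Suc.prems by simp
      then show "Ck_on k (\<lambda>x. frechet_derivative f (at x) v \<bullet> b) W"
        by (intro Ck_on_bilinear[OF bounded_bilinear_inner] assms(1) Ck_on_const)
      show "Ck_on k (\<lambda>x. frechet_derivative g (at (f x)) b) W"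
        by (rule Suc.IH[of f "\<lambda>y. frechet_derivative g (at y) b"])
          (use Suc.prems assms in \<open>auto intro: Ck_on_Suc_imp\<close>)
    qed
  qed fact
qed


definition smooth :: "('a::euclidean_space \<Rightarrow> 'b::euclidean_space) \<Rightarrow> 'a set \<Rightarrow> bool" where
  "smooth f W \<longleftrightarrow> (\<forall>k. Ck_on k f W)"

lemma smooth_cong: "open W \<Longrightarrow> (\<And>x. x \<in> W \<Longrightarrow> f x = g x) \<Longrightarrow> smooth f W \<longleftrightarrow> smooth g W"
  unfolding smooth_def using Ck_on_cong by blast

lemma smooth_subset: "smooth f W \<Longrightarrow> X \<subseteq> W \<Longrightarrow> smooth f X"
  unfolding smooth_def using Ck_on_mono by blast

lemma smooth_const: "open W \<Longrightarrow> smooth (\<lambda>x. c) W"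
  by (simp add: smooth_def Ck_on_const)

lemma smooth_linear: "bounded_linear f \<Longrightarrow> open W \<Longrightarrow> smooth f W"
  by (simp add: smooth_def Ck_on_linear)

lemma smooth_add: "open W \<Longrightarrow> smooth f W \<Longrightarrow> smooth g W \<Longrightarrow> smooth (\<lambda>x. f x + g x) W"
  by (simp add: smooth_def Ck_on_add)

lemma smooth_compose:
  "smooth g X \<Longrightarrow> smooth f W \<Longrightarrow> f ` W \<subseteq> X \<Longrightarrow> open W \<Longrightarrow> open X \<Longrightarrow> smooth (\<lambda>x. g (f x)) W"
  unfolding smooth_def using Ck_on_compose by blast

lemma smooth_bounded_linear:
  "bounded_linear g \<Longrightarrow> smooth f W \<Longrightarrow> open W \<Longrightarrow> smooth (\<lambda>x. g (f x)) W"
  using smooth_compose[OF smooth_linear[of g UNIV]] by auto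

lemma smooth_diff:
  fixes f :: "'a::euclidean_space \<Rightarrow> 'b::euclidean_space"
  assumes "open W" "smooth f W" "smooth g W" shows "smooth (\<lambda>x. f x - g x) W"
  using smooth_add[OF assms(1,2) smooth_bounded_linear[OF bounded_linear_minus[OF bounded_linear_ident] assms(3,1)]]
  by simp

lemma smooth_continuous: "smooth f W \<Longrightarrow> continuous_on W f"
  unfolding smooth_def by (metis Ck_on.simps(1))

lemma smooth_derivative: "smooth f W \<Longrightarrow> smooth (\<lambda>x. frechet_derivative f (at x) v) W"
  unfolding smooth_def by (metis Ck_on.simps(2))

lemma smooth_has_derivative:
  "smooth f W \<Longrightarrow> x \<in> W \<Longrightarrow> (f has_derivative frechet_derivative f (at x)) (at x)"
  unfolding smooth_def by (metis Ck_on.simps(2) frechet_derivative_works)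

text \<open>On an open set the local extensions agree with the map itself, so smoothness in the sense of
extendability is ordinary smoothness.\<close>

lemma smooth_map_on_open_imp_smooth:
  assumes "smooth_map_on A f" "open D" "D \<subseteq> A" shows "smooth f D"
  unfolding smooth_def
proof
  fix k
  show "Ck_on k f D"
  proof (rule Ck_on_locally[OF _ assms(2)])
    fix x assume "x \<in> D"
    then have "x \<in> A" using assms(3) by blast
    then have "\<exists>W f'. open W \<and> x \<in> W \<and> (\<forall>k. Ck_on k f' W) \<and> (\<forall>y\<in>A \<inter> W. f y = f' y)"
      using assms(1) unfolding smooth_map_on_def by (rule bspec[rotated])
    then obtain W f' where W: "open W" "x \<in> W" "\<forall>k. Ck_on k f' W" "\<forall>y\<in>A \<inter> W. f y = f' y"
      by (elim exE conjE)
    have "Ck_on k f' (W \<inter> D)" by (rule Ck_on_mono[OF spec[OF W(3)]]) simp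
    moreover have "Ck_on k f (W \<inter> D) \<longleftrightarrow> Ck_on k f' (W \<inter> D)"
      by (rule Ck_on_cong) (use W assms in auto)
    ultimately have "open W \<and> x \<in> W \<and> Ck_on k f (W \<inter> D)" using W by simp
    then show "\<exists>X. open X \<and> x \<in> X \<and> Ck_on k f (X \<inter> D)" by (rule exI)
  qed
qed

lemma smooth_deriv:
  fixes a :: "real \<Rightarrow> real"
  assumes "smooth a I" "open I"
  shows "smooth (deriv a) I" "x \<in> I \<Longrightarrow> (a has_real_derivative deriv a x) (at x)"
proof -
  have *: "(a has_real_derivative frechet_derivative a (at x) 1) (at x)" if "x \<in> I" for x
  proof -
    have D: "(a has_derivative frechet_derivative a (at x)) (at x)"
      using smooth_has_derivative[OF assms(1) that] .
    have "frechet_derivative a (at x) v = frechet_derivative a (at x) 1 * v" for v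
      using linear_scale[OF has_derivative_linear[OF D], of v 1] by simp
    then show ?thesis
      by (intro has_derivative_imp_has_field_derivative[OF D]) (metis mult.commute)
  qed
  then have **: "deriv a x = frechet_derivative a (at x) 1" if "x \<in> I" for x
    using DERIV_imp_deriv that by blast
  show "x \<in> I \<Longrightarrow> (a has_real_derivative deriv a x) (at x)" using * ** by simp
  show "smooth (deriv a) I"
    using smooth_derivative[OF assms(1), of 1] smooth_cong[OF assms(2) **] by simp
qed


section \<open>Expansions of smooth functions at the endpoint of a ray\<close>

lemma eventually_at_right_0_less: "0 < (d::real) \<Longrightarrow> \<forall>\<^sub>F r in at_right 0. 0 < r \<and> r < d"
  unfolding eventually_at_right_field by auto

lemma bigo_power_mono: "i \<le> j \<Longrightarrow> (\<lambda>r::real. r ^ j) \<in> O[at_right 0](\<lambda>r. r ^ i)"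
proof (rule bigoI[where c=1])
  assume "i \<le> j"
  then show "\<forall>\<^sub>F x::real in at_right 0. norm (x ^ j) \<le> 1 * norm (x ^ i)"
    by (intro eventually_mono[OF eventually_at_right_0_less[of 1]]) (auto simp: power_decreasing)
qed

lemma tendsto_ident_at_right_0: "((\<lambda>r::real. r) \<longlongrightarrow> 0) (at_right 0)"
  by (rule tendsto_ident_at)

lemma smallo_power: "i < j \<Longrightarrow> (\<lambda>r::real. r ^ j) \<in> o[at_right 0](\<lambda>r. r ^ i)"
proof -
  assume "i < j"
  then obtain m where m: "j = i + Suc m" by (metis add_Suc_right less_iff_Suc_add)
  have "((\<lambda>r::real. r ^ Suc m) \<longlongrightarrow> 0 ^ Suc m) (at_right 0)"
    by (intro tendsto_power tendsto_ident_at_right_0)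
  then have "(\<lambda>r::real. r ^ Suc m) \<in> o[at_right 0](\<lambda>r. 1)"
    by (intro smalloI_tendsto) auto
  then have "(\<lambda>r::real. r ^ i * r ^ Suc m) \<in> o[at_right 0](\<lambda>r. r ^ i * 1)"
    by (intro landau_o.big_small_mult) auto
  then show ?thesis by (simp add: m power_add mult.left_commute)
qed

lemma smallo_power_ln: "i < j \<Longrightarrow> (\<lambda>r::real. r ^ j * ln r) \<in> o[at_right 0](\<lambda>r. r ^ i)"
proof -
  assume "i < j"
  then have ij: "Suc i \<le> j" by simp
  have "((\<lambda>r::real. r * ln r) \<longlongrightarrow> 0) (at_right 0)" by real_asymp
  then have "(\<lambda>r::real. r * ln r) \<in> o[at_right 0](\<lambda>r. 1)"
    by (intro smalloI_tendsto) auto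
  then have "(\<lambda>r::real. r ^ i * (r * ln r)) \<in> o[at_right 0](\<lambda>r. r ^ i * 1)"
    by (intro landau_o.big_small_mult) auto
  moreover have "(\<lambda>r::real. r ^ j * ln r) \<in> O[at_right 0](\<lambda>r. r ^ Suc i * ln r)"
    by (intro landau_o.big.mult bigo_power_mono ij) auto
  ultimately show ?thesis by (auto intro: landau_o.big_small_trans simp: mult_ac)
qed

text \<open>The constant coefficient is the limit at \<open>0\<close>; once it vanishes, a factor \<open>r\<close> can be cancelled and
the same argument applies to the remaining coefficients.\<close>

lemma polynomial_smallo_imp_0:
  fixes c :: "nat \<Rightarrow> real"
  assumes "\<And>j. j < n \<Longrightarrow> (\<lambda>r. \<Sum>i<n. c i * r ^ i) \<in> o[at_right 0](\<lambda>r. r ^ j)" "i < n"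
  shows "c i = 0"
  using assms
proof (induction n arbitrary: c i)
  case (Suc n)
  have "((\<lambda>r. (\<Sum>i<Suc n. c i * r ^ i) / r ^ 0) \<longlongrightarrow> 0) (at_right 0)"
    using Suc.prems(1)[of 0] by (intro smalloD_tendsto) auto
  moreover have "((\<lambda>r. (\<Sum>i<Suc n. c i * r ^ i) / r ^ 0) \<longlongrightarrow> (\<Sum>i<Suc n. c i * 0 ^ i) / 0 ^ 0) (at_right 0)"
    by (intro tendsto_intros) auto
  ultimately have "(\<Sum>i<Suc n. c i * 0 ^ i) = 0"
    using tendsto_unique trivial_limit_at_right_real by fastforce
  then have c0: "c 0 = 0" by (simp add: sum.lessThan_Suc_shift del: sum.lessThan_Suc)
  have split: "(\<Sum>i<Suc n. c i * r ^ i) = r * (\<Sum>i<n. c (Suc i) * r ^ i)" for r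
    by (simp add: sum.lessThan_Suc_shift c0 sum_distrib_left mult_ac del: sum.lessThan_Suc)
  have "c (Suc i) = 0" if "i < n" for i
  proof (rule Suc.IH[OF _ that, of "\<lambda>i. c (Suc i)"])
    fix j assume "j < n"
    then have "(\<lambda>r. r * (\<Sum>i<n. c (Suc i) * r ^ i)) \<in> o[at_right 0](\<lambda>r. r * r ^ j)"
      using Suc.prems(1)[of "Suc j"] unfolding split by simp
    then show "(\<lambda>r. \<Sum>i<n. c (Suc i) * r ^ i) \<in> o[at_right 0](\<lambda>r. r ^ j)"
      by (subst (asm) landau_o.small.mult_cancel_left) (auto simp: eventually_at_filter)
  qed
  then show ?case using c0 Suc.prems(2) by (cases i) auto
qed auto

lemma bigo_integrate:
  fixes a :: "real \<Rightarrow> real"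
  assumes "\<forall>\<^sub>F r in nhds 0. (a has_real_derivative a' r) (at r)" "a 0 = 0"
    and "a' \<in> O[at_right 0](\<lambda>r. r ^ k)"
  shows "a \<in> O[at_right 0](\<lambda>r. r ^ Suc k)"
proof -
  obtain d1 where d1: "0 < d1" "\<And>r. \<bar>r\<bar> < d1 \<Longrightarrow> (a has_real_derivative a' r) (at r)"
    using assms(1) unfolding eventually_nhds_metric by (auto simp: dist_real_def)
  obtain C where "\<forall>\<^sub>F r in at_right 0. norm (a' r) \<le> C * norm (r ^ k)"
    using assms(3) by (elim landau_o.bigE)
  then obtain d2 where d2: "0 < d2" "\<And>r. 0 < r \<Longrightarrow> r < d2 \<Longrightarrow> \<bar>a' r\<bar> \<le> C * r ^ k"
    unfolding eventually_at_right_field by auto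
  show ?thesis
  proof (rule bigoI[where c=C], rule eventually_mono[OF eventually_at_right_0_less[of "min d1 d2"]])
    fix r assume r: "0 < r \<and> r < min d1 d2"
    obtain z where z: "0 < z" "z < r" "a r - a 0 = (r - 0) * a' z"
      using MVT2[of 0 r a a'] r d1 by fastforce
    have "0 \<le> C * z ^ k" using d2(2)[of z] z r by linarith
    moreover have "0 < z ^ k" using z by simp
    ultimately have C: "0 \<le> C" by (simp add: zero_le_mult_iff)
    have "\<bar>a r\<bar> = r * \<bar>a' z\<bar>" using z assms(2) r by (simp add: abs_mult)
    also have "\<dots> \<le> r * (C * z ^ k)" using d2(2)[of z] z r by (intro mult_left_mono) auto
    also have "\<dots> \<le> r * (C * r ^ k)" using z r C by (intro mult_left_mono power_mono) auto
    finally show "norm (a r) \<le> C * norm (r ^ Suc k)" using r by (simp add: mult_ac abs_mult)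
  qed (use d1 d2 in auto)
qed

text \<open>The expansion of \<open>a\<close> is the integral of the expansion of its derivative.\<close>

lemma taylor_at_right_0:
  fixes a :: "real \<Rightarrow> real"
  assumes "smooth a I" "open I" "0 \<in> I"
  obtains c where "(\<lambda>r. a r - (\<Sum>i<n. c i * r ^ i)) \<in> O[at_right 0](\<lambda>r. r ^ n)"
proof -
  have "\<exists>c. (\<lambda>r. a r - (\<Sum>i<n. c i * r ^ i)) \<in> O[at_right 0](\<lambda>r. r ^ n)"
    using assms(1)
  proof (induction n arbitrary: a)
    case 0
    have "isCont a 0" using smooth_continuous[OF 0] assms continuous_on_eq_continuous_at by blast
    then have "(a \<longlongrightarrow> a 0) (at_right 0)"
      by (simp add: isCont_def filterlim_at_split)
    then have "a \<in> O[at_right 0](\<lambda>r. 1)" by (intro bigoI_tendsto[where c="a 0"]) auto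
    then show ?case by simp
  next
    case (Suc n)
    note a' = smooth_deriv[OF Suc.prems assms(2)]
    obtain c where c: "(\<lambda>r. deriv a r - (\<Sum>i<n. c i * r ^ i)) \<in> O[at_right 0](\<lambda>r. r ^ n)"
      using Suc.IH[OF a'(1)] by blast
    define b where "b i = (case i of 0 \<Rightarrow> a 0 | Suc j \<Rightarrow> c j / Suc j)" for i
    have b: "(\<Sum>i<Suc n. b i * r ^ i) = a 0 + (\<Sum>i<n. c i / Suc i * r ^ Suc i)" for r
      by (simp add: sum.lessThan_Suc_shift b_def del: sum.lessThan_Suc)
    have "(\<lambda>r. a r - (a 0 + (\<Sum>i<n. c i / Suc i * r ^ Suc i))) \<in> O[at_right 0](\<lambda>r. r ^ Suc n)"
    proof (rule bigo_integrate[OF _ _ c])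
      have "\<forall>\<^sub>F r in nhds 0. r \<in> I" using assms eventually_nhds by blast
      then show "\<forall>\<^sub>F r in nhds 0. ((\<lambda>r. a r - (a 0 + (\<Sum>i<n. c i / Suc i * r ^ Suc i)))
          has_real_derivative deriv a r - (\<Sum>i<n. c i * r ^ i)) (at r)"
      proof eventually_elim
        case (elim r)
        have "((\<lambda>r. c i / Suc i * r ^ Suc i) has_real_derivative c i * r ^ i) (at r)" for i
          by (auto intro!: derivative_eq_intros simp del: power_Suc)
        then have "((\<lambda>r. a 0 + (\<Sum>i<n. c i / Suc i * r ^ Suc i)) has_real_derivative 0 + (\<Sum>i<n. c i * r ^ i)) (at r)"
          by (intro DERIV_add DERIV_const DERIV_sum)
        from DERIV_diff[OF a'(2)[OF elim] this] show ?case by simp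
      qed
    qed auto
    then show ?case unfolding b[symmetric] by (rule exI[of _ b])
  qed
  then show ?thesis using that by (elim exE)
qed

text \<open>Flatness on one side is all that a function on a ray from the origin can be asked for; for smooth
functions it means that all derivatives at \<open>0\<close> vanish.\<close>

definition flat :: "(real \<Rightarrow> real) \<Rightarrow> bool" where
  "flat a \<longleftrightarrow> (\<forall>k. a \<in> O[at_right 0](\<lambda>r. r ^ k))"

text \<open>Being \<open>o(r ^ j)\<close> for all \<open>j < m\<close> is weaker than being \<open>O(r ^ m)\<close>: it also covers functions of size
\<open>r ^ m * ln r\<close>, to which it is applied in \<open>log_comparison\<close>.\<close>

lemma taylor_at_right_0_coeffs:
  fixes a :: "real \<Rightarrow> real"
  assumes "(\<lambda>r. a r - (\<Sum>i<n. c i * r ^ i)) \<in> O[at_right 0](\<lambda>r. r ^ n)"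
    and "\<And>j. j < m \<Longrightarrow> a \<in> o[at_right 0](\<lambda>r. r ^ j)" "m \<le> n" "i < m"
  shows "c i = 0"
proof (rule polynomial_smallo_imp_0[OF _ assms(4)])
  fix j assume j: "j < m"
  have "(\<lambda>r. c i * r ^ i) \<in> o[at_right 0](\<lambda>r. r ^ j)" if "i \<in> {m..<n}" for i
    using smallo_power[of j i] that j by (cases "c i = 0") auto
  then have 1: "(\<lambda>r. \<Sum>i\<in>{m..<n}. c i * r ^ i) \<in> o[at_right 0](\<lambda>r. r ^ j)"
    by (intro big_sum_in_smallo) 
  have 2: "(\<lambda>r. a r - (\<Sum>i<n. c i * r ^ i)) \<in> o[at_right 0](\<lambda>r. r ^ j)"
    by (rule landau_o.big_small_trans[OF assms(1) smallo_power]) (use j assms(3) in auto)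
  have eq: "(\<Sum>i<n. c i * r ^ i) = (\<Sum>i<m. c i * r ^ i) + (\<Sum>i\<in>{m..<n}. c i * r ^ i)" for r
    using sum.union_disjoint[of "{..<m}" "{m..<n}" "\<lambda>i. c i * r ^ i"] assms(3)
    by (simp add: ivl_disj_un_one(2) ivl_disj_int_one(2))
  have "(\<lambda>r. (a r - (a r - (\<Sum>i<n. c i * r ^ i))) - (\<Sum>i\<in>{m..<n}. c i * r ^ i)) \<in> o[at_right 0](\<lambda>r. r ^ j)"
    by (rule sum_in_smallo(2)[OF sum_in_smallo(2)[OF assms(2)[OF j] 2] 1])
  then show "(\<lambda>r. \<Sum>i<m. c i * r ^ i) \<in> o[at_right 0](\<lambda>r. r ^ j)" by (simp add: eq)
qed

text \<open>The heart of the rigidity argument. If \<open>a = \<alpha> * r ^ k + O(r ^ (k + 1))\<close>, then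
\<open>b = - \<alpha> * r ^ k * ln r + O(r ^ k)\<close>. The expansion of the smooth function \<open>b\<close> contains no
logarithms, so first its terms of order below \<open>k\<close> vanish and then \<open>\<alpha> * ln r\<close> has to be bounded,
which forces \<open>\<alpha> = 0\<close>.\<close>

lemma log_comparison:
  fixes a b :: "real \<Rightarrow> real"
  assumes a: "smooth a I" and b: "smooth b I" and I: "open I" "0 \<in> I"
    and ak: "a \<in> O[at_right 0](\<lambda>r. r ^ k)"
    and ab: "(\<lambda>r. b r + a r * ln r) \<in> O[at_right 0](\<lambda>r. r ^ k)"
  shows "a \<in> O[at_right 0](\<lambda>r. r ^ Suc k)" "b \<in> O[at_right 0](\<lambda>r. r ^ k)"
proof -
  obtain c where c: "(\<lambda>r. a r - (\<Sum>i<Suc k. c i * r ^ i)) \<in> O[at_right 0](\<lambda>r. r ^ Suc k)"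
    using taylor_at_right_0[OF a I] .
  obtain d where d: "(\<lambda>r. b r - (\<Sum>i<k. d i * r ^ i)) \<in> O[at_right 0](\<lambda>r. r ^ k)"
    using taylor_at_right_0[OF b I] .
  have c0: "c i = 0" if "i < k" for i
    by (rule taylor_at_right_0_coeffs[OF c _ _ that]) (use landau_o.big_small_trans[OF ak smallo_power] in auto)
  have al: "(\<lambda>r. a r * ln r) \<in> O[at_right 0](\<lambda>r. r ^ k * ln r)"
    by (intro landau_o.big.mult ak) auto
  have d0: "d i = 0" if "i < k" for i
  proof (rule taylor_at_right_0_coeffs[OF d _ _ that])
    fix j assume "j < k"
    then have "(\<lambda>r. (b r + a r * ln r) - a r * ln r) \<in> o[at_right 0](\<lambda>r. r ^ j)"
      by (intro sum_in_smallo(2) landau_o.big_small_trans[OF ab smallo_power]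
          landau_o.big_small_trans[OF al smallo_power_ln])
    then show "b \<in> o[at_right 0](\<lambda>r. r ^ j)" by simp
  qed auto
  then have "(\<Sum>i<k. d i * r ^ i) = 0" for r by (intro sum.neutral) auto
  then show bk: "b \<in> O[at_right 0](\<lambda>r. r ^ k)" using d by simp
  have "(\<Sum>i<Suc k. c i * r ^ i) = c k * r ^ k" for r using c0 by (simp add: sum.neutral)
  then have c': "(\<lambda>r. a r - c k * r ^ k) \<in> O[at_right 0](\<lambda>r. r ^ Suc k)" using c by simp
  then have "(\<lambda>r. (a r - c k * r ^ k) * ln r) \<in> O[at_right 0](\<lambda>r. r ^ Suc k * ln r)"
    by (intro landau_o.big.mult) auto
  then have "(\<lambda>r. (a r - c k * r ^ k) * ln r) \<in> O[at_right 0](\<lambda>r. r ^ k)"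
    using landau_o.big_trans[OF _ landau_o.small_imp_big[OF smallo_power_ln[of k "Suc k"]]] by blast
  then have "(\<lambda>r. (b r + a r * ln r) - b r - (a r - c k * r ^ k) * ln r) \<in> O[at_right 0](\<lambda>r. r ^ k)"
    by (intro sum_in_bigo ab bk)
  then have *: "(\<lambda>r. r ^ k * (c k * ln r)) \<in> O[at_right 0](\<lambda>r. r ^ k * 1)"
    by (simp add: algebra_simps)
  have "\<forall>\<^sub>F r in at_right 0. r ^ k \<noteq> (0::real)"
    by (rule eventually_mono[OF eventually_at_right_0_less[of 1]]) auto
  then have "(\<lambda>r. c k * ln r) \<in> O[at_right 0](\<lambda>r. 1)"
    by (rule landau_o.big.mult_cancel_left[OF bigtheta_refl, THEN iffD1, OF _ *])
  then obtain C where "\<forall>\<^sub>F r in at_right 0. norm (c k * ln r) \<le> C * norm (1::real)" by (elim landau_o.bigE)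
  moreover have "\<forall>\<^sub>F r::real in at_right 0. ln r < - C / \<bar>c k\<bar>"
    using ln_at_0 unfolding filterlim_at_bot_dense by blast
  ultimately have "\<forall>\<^sub>F r::real in at_right 0. c k = 0"
  proof eventually_elim
    case (elim r)
    show ?case
    proof (rule ccontr)
      assume "c k \<noteq> 0"
      then have "\<bar>c k\<bar> * (- ln r) > C" using elim(2) by (simp add: field_simps)
      moreover have "\<bar>c k\<bar> * (- ln r) \<le> \<bar>c k * ln r\<bar>" 
        unfolding abs_mult by (rule mult_left_mono) auto
      ultimately show False using elim(1) by simp
    qed
  qed
  then have "c k = 0" by simp
  then show "a \<in> O[at_right 0](\<lambda>r. r ^ Suc k)" using c' by simp
qed

text \<open>Integrating the expansion of the derivative gives the expansion of \<open>a\<close>, whose coefficients are zero.\<close>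

lemma flat_deriv:
  fixes a :: "real \<Rightarrow> real"
  assumes a: "smooth a I" and I: "open I" "0 \<in> I" and "flat a"
  shows "flat (deriv a)" "a 0 = 0"
proof -
  note a' = smooth_deriv[OF a I(1)]
  have fl: "a \<in> o[at_right 0](\<lambda>r. r ^ k)" for k
    by (rule landau_o.big_small_trans[OF _ smallo_power[of k "Suc k"]]) (use assms(4) in \<open>auto simp: flat_def simp del: power_Suc\<close>)
  have "isCont a 0" using smooth_continuous[OF a] I continuous_on_eq_continuous_at by blast
  then have "(a \<longlongrightarrow> a 0) (at_right 0)" by (simp add: isCont_def filterlim_at_split)
  moreover have "(a \<longlongrightarrow> 0) (at_right 0)" using smalloD_tendsto[OF fl[of 0]] by simp
  ultimately show a0: "a 0 = 0" using tendsto_unique trivial_limit_at_right_real by blast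
  show "flat (deriv a)" unfolding flat_def
  proof
    fix n
    obtain c where c: "(\<lambda>r. deriv a r - (\<Sum>i<n. c i * r ^ i)) \<in> O[at_right 0](\<lambda>r. r ^ n)"
      using taylor_at_right_0[OF a'(1) I] .
    define b where "b i = (case i of 0 \<Rightarrow> 0 | Suc j \<Rightarrow> c j / Suc j)" for i
    have b: "(\<Sum>i<Suc n. b i * r ^ i) = (\<Sum>i<n. c i / Suc i * r ^ Suc i)" for r
      by (simp add: sum.lessThan_Suc_shift b_def del: sum.lessThan_Suc)
    have "(\<lambda>r. a r - (\<Sum>i<n. c i / Suc i * r ^ Suc i)) \<in> O[at_right 0](\<lambda>r. r ^ Suc n)"
    proof (rule bigo_integrate[OF _ _ c])
      have "\<forall>\<^sub>F r in nhds 0. r \<in> I" using I eventually_nhds by blast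
      then show "\<forall>\<^sub>F r in nhds 0. ((\<lambda>r. a r - (\<Sum>i<n. c i / Suc i * r ^ Suc i))
          has_real_derivative deriv a r - (\<Sum>i<n. c i * r ^ i)) (at r)"
      proof eventually_elim
        case (elim r)
        have "((\<lambda>r. c i / Suc i * r ^ Suc i) has_real_derivative c i * r ^ i) (at r)" for i
          by (auto intro!: derivative_eq_intros simp del: power_Suc)
        then have "((\<lambda>r. \<Sum>i<n. c i / Suc i * r ^ Suc i) has_real_derivative (\<Sum>i<n. c i * r ^ i)) (at r)"
          by (intro DERIV_sum)
        from DERIV_diff[OF a'(2)[OF elim] this] show ?case by simp
      qed
    qed (use a0 in auto)
    then have "(\<lambda>r. a r - (\<Sum>i<Suc n. b i * r ^ i)) \<in> O[at_right 0](\<lambda>r. r ^ Suc n)" by (simp only: b)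
    then have "b i = 0" if "i < Suc n" for i
      using taylor_at_right_0_coeffs[OF _ fl order_refl that] by blast
    from this[of "Suc i" for i] have "c i = 0" if "i < n" for i using that by (simp add: b_def)
    then have "(\<Sum>i<n. c i * r ^ i) = 0" for r by (intro sum.neutral) auto
    then show "deriv a \<in> O[at_right 0](\<lambda>r. r ^ n)" using c by simp
  qed
qed

lemma flat_iterated_deriv:
  fixes a :: "real \<Rightarrow> real"
  assumes "smooth a I" "open I" "0 \<in> I" "flat a"
  shows "(deriv ^^ m) a 0 = 0"
proof -
  have "smooth ((deriv ^^ m) a) I \<and> flat ((deriv ^^ m) a)"
    by (induction m) (use assms smooth_deriv flat_deriv in auto)
  then show ?thesis using flat_deriv(2) assms by blast
qed


section \<open>Mixed partial derivatives in the plane\<close>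

lemma partial_cong:
  assumes "open D" "w \<in> D" "\<And>x. x \<in> D \<Longrightarrow> f x = g x"
  shows "partial_l f w = partial_l g w" "partial_j f w = partial_j g w"
proof -
  have "\<forall>\<^sub>F x in nhds (fst w). (x, snd w) \<in> D"
    using open_vimage[OF assms(1), of "\<lambda>x. (x, snd w)"] assms(2)
    by (auto simp: eventually_nhds continuous_on_Pair intro!: exI[of _ "(\<lambda>x. (x, snd w)) -` D"])
  then show "partial_l f w = partial_l g w"
    unfolding partial_l_def by (intro deriv_cong_ev) (auto elim!: eventually_mono simp: assms(3))
  have "\<forall>\<^sub>F x in nhds (snd w). (fst w, x) \<in> D"
    using open_vimage[OF assms(1), of "\<lambda>x. (fst w, x)"] assms(2)
    by (auto simp: eventually_nhds continuous_on_Pair intro!: exI[of _ "(\<lambda>x. (fst w, x)) -` D"])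
  then show "partial_j f w = partial_j g w"
    unfolding partial_j_def by (intro deriv_cong_ev) (auto elim!: eventually_mono simp: assms(3))
qed

lemma has_derivative_imp_partial_DERIV:
  fixes f :: "real \<times> real \<Rightarrow> real"
  assumes "(f has_derivative (\<lambda>v. a * fst v + b * snd v)) (at w)"
  shows "((\<lambda>x. f (x, snd w)) has_real_derivative a) (at (fst w))"
    and "((\<lambda>y. f (fst w, y)) has_real_derivative b) (at (snd w))"
proof -
  have "((\<lambda>x. (x, snd w)) has_derivative (\<lambda>h. (h, 0))) (at (fst w))"
    by (auto intro!: derivative_eq_intros)
  from has_derivative_compose[OF this, of f "\<lambda>v. a * fst v + b * snd v"] assms
  show "((\<lambda>x. f (x, snd w)) has_real_derivative a) (at (fst w))"
    by (simp add: has_field_derivative_def)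
  have "((\<lambda>x. (fst w, x)) has_derivative (\<lambda>h. (0, h))) (at (snd w))"
    by (auto intro!: derivative_eq_intros)
  from has_derivative_compose[OF this, of f "\<lambda>v. a * fst v + b * snd v"] assms
  show "((\<lambda>y. f (fst w, y)) has_real_derivative b) (at (snd w))"
    by (simp add: has_field_derivative_def)
qed

lemma has_derivative_imp_partial:
  fixes f :: "real \<times> real \<Rightarrow> real"
  assumes "(f has_derivative (\<lambda>v. a * fst v + b * snd v)) (at w)"
  shows "partial_l f w = a" "partial_j f w = b"
  using has_derivative_imp_partial_DERIV[OF assms] DERIV_imp_deriv
  unfolding partial_l_def partial_j_def by blast+

lemma linear_real2_eq:
  fixes f :: "real \<times> real \<Rightarrow> real"
  assumes "linear f"
  shows "f v = f (1, 0) * fst v + f (0, 1) * snd v"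
proof -
  have "v = fst v *\<^sub>R (1, 0) + snd v *\<^sub>R (0, 1)" by (cases v) simp
  then have "f v = f (fst v *\<^sub>R (1, 0) + snd v *\<^sub>R (0, 1))" by simp
  also have "\<dots> = fst v * f (1, 0) + snd v * f (0, 1)"
    using assms by (simp only: linear_add linear_scale real_scaleR_def)
  finally show ?thesis by (simp add: mult.commute)
qed

lemma smooth_has_derivative_partials:
  fixes f :: "real \<times> real \<Rightarrow> real"
  assumes "smooth f D" "w \<in> D"
  shows "(f has_derivative (\<lambda>v. partial_l f w * fst v + partial_j f w * snd v)) (at w)"
    and "partial_l f w = frechet_derivative f (at w) (1, 0)"
    and "partial_j f w = frechet_derivative f (at w) (0, 1)"
proof -
  let ?d = "frechet_derivative f (at w)"
  have d: "(f has_derivative ?d) (at w)" using smooth_has_derivative[OF assms] .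
  have "?d = (\<lambda>v. ?d (1, 0) * fst v + ?d (0, 1) * snd v)"
    by (rule ext) (rule linear_real2_eq[OF has_derivative_linear[OF d]])
  then have *: "(f has_derivative (\<lambda>v. ?d (1, 0) * fst v + ?d (0, 1) * snd v)) (at w)"
    using d by metis
  show "partial_l f w = ?d (1, 0)" "partial_j f w = ?d (0, 1)"
    using has_derivative_imp_partial[OF *] .
  then show "(f has_derivative (\<lambda>v. partial_l f w * fst v + partial_j f w * snd v)) (at w)"
    using * by simp
qed

lemma smooth_partial:
  fixes f :: "real \<times> real \<Rightarrow> real"
  assumes "open D" "smooth f D"
  shows "smooth (partial_l f) D" "smooth (partial_j f) D"
  using smooth_derivative[OF assms(2), of "(1, 0)"] smooth_derivative[OF assms(2), of "(0, 1)"]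
    smooth_cong[OF assms(1) smooth_has_derivative_partials(2)[OF assms(2)]]
    smooth_cong[OF assms(1) smooth_has_derivative_partials(3)[OF assms(2)]] by simp_all

lemma partial_DERIV:
  fixes f :: "real \<times> real \<Rightarrow> real"
  assumes "smooth f D" "(x, y) \<in> D"
  shows "((\<lambda>x. f (x, y)) has_real_derivative partial_l f (x, y)) (at x)"
    and "((\<lambda>y. f (x, y)) has_real_derivative partial_j f (x, y)) (at y)"
  using has_derivative_imp_partial_DERIV[OF smooth_has_derivative_partials(1)[OF assms]] by simp_all

text \<open>The double difference of \<open>f\<close> over a square is symmetric in the two variables. Applying this in both
orders of the variables is what identifies the two mixed derivatives in \<open>partial_commute\<close>.\<close>

lemma double_difference_mvt:
  fixes f g g' :: "real \<Rightarrow> real \<Rightarrow> real"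
  assumes h: "0 < h"
    and g: "\<And>x y. x \<in> {a..a+h} \<Longrightarrow> y \<in> {b..b+h} \<Longrightarrow> ((\<lambda>x. f x y) has_real_derivative g x y) (at x)"
    and g': "\<And>x y. x \<in> {a..a+h} \<Longrightarrow> y \<in> {b..b+h} \<Longrightarrow> ((\<lambda>y. g x y) has_real_derivative g' x y) (at y)"
  obtains x y where "x \<in> {a<..<a+h}" "y \<in> {b<..<b+h}"
    "f (a+h) (b+h) - f (a+h) b - f a (b+h) + f a b = h * h * g' x y"
proof -
  have "\<exists>x. a < x \<and> x < a + h \<and> (f (a+h) (b+h) - f (a+h) b) - (f a (b+h) - f a b) = (a + h - a) * (g x (b+h) - g x b)"
    using h by (intro MVT2[where f="\<lambda>x. f x (b+h) - f x b"] DERIV_diff g) auto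
  then obtain x where x: "a < x" "x < a + h" "(f (a+h) (b+h) - f (a+h) b) - (f a (b+h) - f a b) = h * (g x (b+h) - g x b)"
    by auto
  have "\<exists>y. b < y \<and> y < b + h \<and> g x (b+h) - g x b = (b + h - b) * g' x y"
    using h x by (intro MVT2 g') auto
  then obtain y where "b < y" "y < b + h" "g x (b+h) - g x b = h * g' x y" by auto
  with x show ?thesis by (intro that[of x y]) (auto simp: algebra_simps)
qed

lemma partial_commute:
  fixes f :: "real \<times> real \<Rightarrow> real"
  assumes D: "open D" "smooth f D" "w \<in> D"
  shows "partial_l (partial_j f) w = partial_j (partial_l f) w"
proof (rule ccontr)
  let ?A = "partial_l (partial_j f)" and ?B = "partial_j (partial_l f)"
  note sl = smooth_partial(1)[OF D(1,2)] and sj = smooth_partial(2)[OF D(1,2)]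
  assume "?A w \<noteq> ?B w"
  define e where "e = \<bar>?A w - ?B w\<bar> / 2"
  have "0 < e" using \<open>?A w \<noteq> ?B w\<close> by (simp add: e_def)
  have "\<forall>\<^sub>F v in nhds w. dist (g v) (g w) < e" if "smooth g D" for g :: "real \<times> real \<Rightarrow> real"
  proof -
    have "isCont g w" using smooth_continuous[OF that] D by (simp add: continuous_on_eq_continuous_at)
    then show ?thesis using \<open>0 < e\<close> by (simp add: continuous_at tendsto_iff eventually_nhds_conv_at)
  qed
  from this[OF smooth_partial(1)[OF D(1) sj]] this[OF smooth_partial(2)[OF D(1) sl]]
    eventually_nhds_in_open[OF D(1,3)]
  have "\<forall>\<^sub>F v in nhds w. dist (?A v) (?A w) < e \<and> dist (?B v) (?B w) < e \<and> v \<in> D"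
    by (simp add: eventually_conj)
  then obtain d where d: "0 < d" "\<And>v. dist v w < d \<Longrightarrow> dist (?A v) (?A w) < e \<and> dist (?B v) (?B w) < e \<and> v \<in> D"
    unfolding eventually_nhds_metric by blast
  define h where "h = d / 3"
  obtain a b where w: "w = (a, b)" by (cases w)
  have h: "0 < h" using d by (simp add: h_def)
  have box: "dist (x, y) w < d" if "x \<in> {a..a+h}" "y \<in> {b..b+h}" for x y
  proof -
    have "dist (x, y) w \<le> \<bar>x - a\<bar> + \<bar>y - b\<bar>"
      unfolding w dist_Pair_Pair dist_real_def using sqrt_sum_squares_le_sum_abs[of "\<bar>x - a\<bar>" "\<bar>y - b\<bar>"] by simp
    also have "\<dots> < d" using that d unfolding h_def by auto
    finally show ?thesis .
  qed
  obtain x y where xy: "x \<in> {a<..<a+h}" "y \<in> {b<..<b+h}"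
    "f (a+h, b+h) - f (a+h, b) - f (a, b+h) + f (a, b) = h * h * ?B (x, y)"
  proof (rule double_difference_mvt[OF h, where f="\<lambda>x y. f (x, y)" and g="\<lambda>x y. partial_l f (x, y)" and g'="\<lambda>x y. ?B (x, y)" and a=a and b=b])
    show "((\<lambda>x. f (x, y)) has_real_derivative partial_l f (x, y)) (at x)"
      "((\<lambda>y. partial_l f (x, y)) has_real_derivative ?B (x, y)) (at y)"
      if "x \<in> {a..a + h}" "y \<in> {b..b + h}" for x y
      using partial_DERIV(1)[OF D(2), of x y] partial_DERIV(2)[OF sl, of x y] d(2)[OF box[OF that]] by auto
  qed
  obtain y' x' where xy': "y' \<in> {b<..<b+h}" "x' \<in> {a<..<a+h}"
    "f (a+h, b+h) - f (a, b+h) - f (a+h, b) + f (a, b) = h * h * ?A (x', y')"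
  proof (rule double_difference_mvt[OF h, where f="\<lambda>y x. f (x, y)" and g="\<lambda>y x. partial_j f (x, y)" and g'="\<lambda>y x. ?A (x, y)" and a=b and b=a])
    show "((\<lambda>y. f (x, y)) has_real_derivative partial_j f (x, y)) (at y)"
      "((\<lambda>x. partial_j f (x, y)) has_real_derivative ?A (x, y)) (at x)"
      if "y \<in> {b..b + h}" "x \<in> {a..a + h}" for x y
      using partial_DERIV(2)[OF D(2), of x y] partial_DERIV(1)[OF sj, of x y] d(2)[OF box[OF that(2,1)]] by auto
  qed
  have "h * h * ?A (x', y') = h * h * ?B (x, y)" using xy(3) xy'(3) by linarith
  then have "?A (x', y') = ?B (x, y)" using h by simp
  moreover have "dist (?A (x', y')) (?A w) < e" "dist (?B (x, y)) (?B w) < e"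
    using d(2)[OF box[of x y]] d(2)[OF box[of x' y']] xy xy' by auto
  moreover have "\<bar>?A w - ?B w\<bar> \<le> \<bar>z - ?A w\<bar> + \<bar>z - ?B w\<bar>" for z by arith
  ultimately show False unfolding e_def dist_real_def by (smt (verit) field_sum_of_halves)
qed

definition mixed_partial :: "nat \<Rightarrow> nat \<Rightarrow> (real \<times> real \<Rightarrow> real) \<Rightarrow> real \<times> real \<Rightarrow> real" where
  "mixed_partial i k f = (partial_l ^^ i) ((partial_j ^^ k) f)"

lemma smooth_iterated_partial:
  assumes "open D" "smooth f D"
  shows "smooth ((partial_l ^^ i) f) D" "smooth ((partial_j ^^ k) f) D" "smooth (mixed_partial i k f) D"
proof -
  have *: "smooth ((partial_l ^^ i) f) D" if "smooth f D" for f
    by (induction i) (use smooth_partial assms that in auto)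
  show "smooth ((partial_l ^^ i) f) D" by (rule *) fact
  show "smooth ((partial_j ^^ k) f) D"
    by (induction k) (use smooth_partial assms in auto)
  then show "smooth (mixed_partial i k f) D" unfolding mixed_partial_def by (rule *)
qed

lemma mixed_partial_cong:
  assumes "open D" "w \<in> D" "\<And>x. x \<in> D \<Longrightarrow> f x = g x"
  shows "mixed_partial i k f w = mixed_partial i k g w"
proof -
  have l: "w \<in> D \<Longrightarrow> (partial_l ^^ i) f w = (partial_l ^^ i) g w"
    if "\<And>x. x \<in> D \<Longrightarrow> f x = g x" for f g w
  proof (induction i arbitrary: w)
    case (Suc i)
    then show ?case using partial_cong(1)[OF assms(1) Suc.prems Suc.IH] by simp
  qed (simp add: that)
  have "w \<in> D \<Longrightarrow> (partial_j ^^ k) f w = (partial_j ^^ k) g w" for w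
  proof (induction k arbitrary: w)
    case (Suc k)
    then show ?case using partial_cong(2)[OF assms(1) Suc.prems Suc.IH] by simp
  qed (simp add: assms(3))
  from l[OF this] show ?thesis using assms(2) by (simp add: mixed_partial_def)
qed

lemma mixed_partial_Suc_left: "mixed_partial (Suc i) k f w = partial_l (mixed_partial i k f) w"
  by (simp add: mixed_partial_def)

text \<open>By definition the derivatives in the second variable are taken first; commuting them past those in
the first variable allows another one to be taken last.\<close>

lemma mixed_partial_Suc_right:
  assumes "open D" "smooth f D" "w \<in> D"
  shows "mixed_partial i (Suc k) f w = partial_j (mixed_partial i k f) w"
  using assms(3)
proof (induction i arbitrary: w)
  case (Suc i)
  have "mixed_partial (Suc i) (Suc k) f w = partial_l (partial_j (mixed_partial i k f)) w"
    unfolding mixed_partial_Suc_left by (rule partial_cong(1)[OF assms(1) Suc.prems Suc.IH])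
  also have "\<dots> = partial_j (partial_l (mixed_partial i k f)) w"
    using partial_commute assms smooth_iterated_partial(3) Suc.prems by blast
  finally show ?case by (simp add: mixed_partial_def)
qed (simp add: mixed_partial_def)

lemma smooth_partial_diff:
  assumes "smooth f D" "smooth g D" "w \<in> D"
  shows "partial_l (\<lambda>w. f w - g w) w = partial_l f w - partial_l g w"
    "partial_j (\<lambda>w. f w - g w) w = partial_j f w - partial_j g w"
proof -
  have "((\<lambda>w. f w - g w) has_derivative (\<lambda>v. (partial_l f w - partial_l g w) * fst v + (partial_j f w - partial_j g w) * snd v)) (at w)"
    using has_derivative_diff[OF smooth_has_derivative_partials(1)[OF assms(1,3)] smooth_has_derivative_partials(1)[OF assms(2,3)]]
    by (simp add: algebra_simps)
  from has_derivative_imp_partial[OF this] show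
    "partial_l (\<lambda>w. f w - g w) w = partial_l f w - partial_l g w"
    "partial_j (\<lambda>w. f w - g w) w = partial_j f w - partial_j g w" .
qed

lemma mixed_partial_diff:
  assumes D: "open D" "smooth f D" "smooth g D" "w \<in> D"
  shows "mixed_partial i k (\<lambda>w. f w - g w) w = mixed_partial i k f w - mixed_partial i k g w"
proof -
  note s = smooth_iterated_partial[OF D(1)]
  have l: "\<forall>w\<in>D. (partial_l ^^ i) (\<lambda>w. f w - g w) w = (partial_l ^^ i) f w - (partial_l ^^ i) g w"
    if fg: "smooth f D" "smooth g D" for f g
  proof (induction i)
    case (Suc i)
    show ?case
    proof
      fix w assume w: "w \<in> D"
      show "(partial_l ^^ Suc i) (\<lambda>w. f w - g w) w = (partial_l ^^ Suc i) f w - (partial_l ^^ Suc i) g w"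
        using partial_cong(1)[OF D(1) w, of _ "\<lambda>w. (partial_l ^^ i) f w - (partial_l ^^ i) g w"] Suc
          smooth_partial_diff(1)[OF s(1)[OF fg(1)] s(1)[OF fg(2)] w] by simp
    qed
  qed simp
  have j: "\<forall>w\<in>D. (partial_j ^^ k) (\<lambda>w. f w - g w) w = (partial_j ^^ k) f w - (partial_j ^^ k) g w"
  proof (induction k)
    case (Suc k)
    show ?case
    proof
      fix w assume w: "w \<in> D"
      show "(partial_j ^^ Suc k) (\<lambda>w. f w - g w) w = (partial_j ^^ Suc k) f w - (partial_j ^^ Suc k) g w"
        using partial_cong(2)[OF D(1) w, of _ "\<lambda>w. (partial_j ^^ k) f w - (partial_j ^^ k) g w"] Suc
          smooth_partial_diff(2)[OF s(2)[OF D(2)] s(2)[OF D(3)] w] by simp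
    qed
  qed simp
  have "mixed_partial i k (\<lambda>w. f w - g w) w = mixed_partial i 0 (\<lambda>w. (partial_j ^^ k) f w - (partial_j ^^ k) g w) w"
    using mixed_partial_cong[OF D(1,4), of "(partial_j ^^ k) (\<lambda>w. f w - g w)" _ i 0] j by (simp add: mixed_partial_def)
  then show ?thesis using l[OF s(2)[OF D(2)] s(2)[OF D(3)]] D(4) by (simp add: mixed_partial_def)
qed

text \<open>The derivative in the direction \<open>(1, y)\<close>, that is, along the ray of slope \<open>y\<close>.\<close>

definition dir_deriv :: "real \<Rightarrow> (real \<times> real \<Rightarrow> real) \<Rightarrow> real \<times> real \<Rightarrow> real" where
  "dir_deriv y f w = partial_l f w + y * partial_j f w"

lemma smooth_dir_deriv: "open D \<Longrightarrow> smooth f D \<Longrightarrow> smooth (dir_deriv y f) D"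
  unfolding dir_deriv_def
  by (intro smooth_add smooth_partial smooth_bounded_linear[OF bounded_linear_mult_right])

lemma dir_deriv_cong:
  "open D \<Longrightarrow> w \<in> D \<Longrightarrow> (\<And>x. x \<in> D \<Longrightarrow> f x = g x) \<Longrightarrow> dir_deriv y f w = dir_deriv y g w"
  unfolding dir_deriv_def using partial_cong[of D w f g] by simp

lemma smooth_on_ray:
  fixes f :: "real \<times> real \<Rightarrow> real" and y :: real
  assumes "open D" "smooth f D" "(0, 0) \<in> D"
  defines "I \<equiv> (\<lambda>r. (r, r * y)) -` D"
  shows "open I" "0 \<in> I" "smooth (\<lambda>r. f (r, r * y)) I"
    "\<And>r. r \<in> I \<Longrightarrow> ((\<lambda>r. f (r, r * y)) has_real_derivative dir_deriv y f (r, r * y)) (at r)"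
proof -
  have bl: "bounded_linear (\<lambda>r::real. (r, r * y))"
    by (intro bounded_linear_Pair bounded_linear_ident bounded_linear_mult_left)
  show I: "open I" unfolding I_def using assms(1) by (intro open_vimage linear_continuous_on bl)
  show "0 \<in> I" using assms(3) by (simp add: I_def)
  show "smooth (\<lambda>r. f (r, r * y)) I"
    by (rule smooth_compose[OF assms(2) smooth_linear[OF bl I] _ I assms(1)]) (auto simp: I_def)
  fix r assume "r \<in> I"
  then have "(f has_derivative (\<lambda>v. partial_l f (r, r * y) * fst v + partial_j f (r, r * y) * snd v)) (at (r, r * y))"
    using smooth_has_derivative_partials(1)[OF assms(2)] by (simp add: I_def)
  from has_derivative_compose[OF bounded_linear_imp_has_derivative[OF bl] this]
  show "((\<lambda>r. f (r, r * y)) has_real_derivative dir_deriv y f (r, r * y)) (at r)"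
    by (rule has_derivative_imp_has_field_derivative) (simp add: dir_deriv_def algebra_simps)
qed

lemma iterated_deriv_on_ray:
  assumes "open D" "smooth f D" "(0, 0) \<in> D" "(r, r * y) \<in> D"
  shows "(deriv ^^ m) (\<lambda>r. f (r, r * y)) r = (dir_deriv y ^^ m) f (r, r * y)"
  using assms(4)
proof (induction m arbitrary: r)
  case (Suc m)
  let ?I = "(\<lambda>r. (r, r * y)) -` D"
  have s: "smooth ((dir_deriv y ^^ m) f) D" by (induction m) (use assms smooth_dir_deriv in auto)
  note ray = smooth_on_ray[OF assms(1) s assms(3), where y = y]
  have "\<forall>\<^sub>F r in nhds r. r \<in> ?I" using ray(1) Suc.prems unfolding eventually_nhds by blast
  then have "deriv ((deriv ^^ m) (\<lambda>r. f (r, r * y))) r = deriv (\<lambda>r. (dir_deriv y ^^ m) f (r, r * y)) r"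
    by (intro deriv_cong_ev) (auto elim!: eventually_mono simp: Suc.IH)
  also have "\<dots> = dir_deriv y ((dir_deriv y ^^ m) f) (r, r * y)"
    using ray(4)[of r] Suc.prems by (simp add: DERIV_imp_deriv)
  finally show ?case by simp
qed simp

text \<open>The \<open>c i\<close> are the binomial coefficients. Their positivity allows each mixed derivative to be
recovered from the polynomial in \<open>y\<close>.\<close>

lemma iterated_dir_deriv_expand:
  assumes D: "open D" "smooth f D"
  obtains c :: "nat \<Rightarrow> real" where "\<And>i. i \<le> m \<Longrightarrow> 0 < c i"
    "\<And>y w. w \<in> D \<Longrightarrow> (dir_deriv y ^^ m) f w = (\<Sum>i\<le>m. c i * y ^ i * mixed_partial (m - i) i f w)"
proof -
  have "\<exists>c. (\<forall>i\<le>m. 0 < c i) \<and> (\<forall>y. \<forall>w\<in>D. (dir_deriv y ^^ m) f w = (\<Sum>i\<le>m. c i * y ^ i * mixed_partial (m - i) i f w))"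
  proof (induction m)
    case 0
    show ?case by (rule exI[of _ "\<lambda>_. 1"]) (simp add: mixed_partial_def)
  next
    case (Suc m)
    then obtain c where c: "\<And>i. i \<le> m \<Longrightarrow> (0::real) < c i"
      "\<And>y w. w \<in> D \<Longrightarrow> (dir_deriv y ^^ m) f w = (\<Sum>i\<le>m. c i * y ^ i * mixed_partial (m - i) i f w)"
      by blast
    define c' where "c' i = (if i \<le> m then c i else 0) + (if 1 \<le> i then c (i - 1) else 0)" for i
    have "(dir_deriv y ^^ Suc m) f w = (\<Sum>i\<le>Suc m. c' i * y ^ i * mixed_partial (Suc m - i) i f w)" if w: "w \<in> D" for y w
    proof -
      let ?P = "\<lambda>i k. mixed_partial i k f w"
      have "((\<lambda>w. \<Sum>i\<le>m. c i * y ^ i * mixed_partial (m - i) i f w) has_derivative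
         (\<lambda>v. \<Sum>i\<le>m. c i * y ^ i * (partial_l (mixed_partial (m - i) i f) w * fst v + partial_j (mixed_partial (m - i) i f) w * snd v))) (at w)"
        by (intro has_derivative_sum has_derivative_mult_right smooth_has_derivative_partials(1)[OF _ w] smooth_iterated_partial D)
      then have "((\<lambda>w. \<Sum>i\<le>m. c i * y ^ i * mixed_partial (m - i) i f w) has_derivative
         (\<lambda>v. (\<Sum>i\<le>m. c i * y ^ i * ?P (Suc (m - i)) i) * fst v + (\<Sum>i\<le>m. c i * y ^ i * ?P (m - i) (Suc i)) * snd v)) (at w)"
        by (simp add: sum_distrib_left sum.distrib[symmetric] algebra_simps
            flip: mixed_partial_Suc_left mixed_partial_Suc_right[OF D w])
      note part = has_derivative_imp_partial[OF this]
      have "(dir_deriv y ^^ Suc m) f w = dir_deriv y (\<lambda>w. \<Sum>i\<le>m. c i * y ^ i * mixed_partial (m - i) i f w) w"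
        using dir_deriv_cong[OF D(1) w c(2)] by simp
      also have "\<dots> = (\<Sum>i\<le>m. c i * y ^ i * ?P (Suc (m - i)) i) + (\<Sum>i\<le>m. c i * y ^ Suc i * ?P (m - i) (Suc i))"
        unfolding dir_deriv_def part by (simp add: sum_distrib_left mult_ac)
      also have "(\<Sum>i\<le>m. c i * y ^ i * ?P (Suc (m - i)) i) = (\<Sum>i\<le>Suc m. (if i \<le> m then c i else 0) * y ^ i * ?P (Suc m - i) i)"
        by (simp add: Suc_diff_le cong: sum.cong_simp)
      also have "(\<Sum>i\<le>m. c i * y ^ Suc i * ?P (m - i) (Suc i)) = (\<Sum>i\<le>Suc m. (if 1 \<le> i then c (i - 1) else 0) * y ^ i * ?P (Suc m - i) i)"
        by (subst sum.atMost_Suc_shift) simp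
      finally show ?thesis by (simp add: c'_def sum.distrib[symmetric] algebra_simps del: sum.atMost_Suc)
    qed
    moreover have "0 < c' i" if "i \<le> Suc m" for i
      using c(1)[of i] c(1)[of "i - 1"] that by (cases "i = 0"; cases "i = Suc m") (auto simp: c'_def intro!: add_pos_pos)
    ultimately show ?case by blast
  qed
  then show ?thesis using that by blast
qed

text \<open>The \<open>m\<close>-th derivative along the ray of slope \<open>y\<close> is a polynomial in \<open>y\<close> whose coefficients are
positive multiples of the mixed derivatives of order \<open>m\<close>. It vanishes at the origin for every \<open>y\<close>, hence so
does each coefficient. Thus estimates on each single ray suffice.\<close>

lemma mixed_partial_eq_0_if_flat_on_rays:
  assumes D: "open D" "smooth f D" "(0, 0) \<in> D" and "\<And>y. flat (\<lambda>r. f (r, r * y))"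
  shows "mixed_partial i k f (0, 0) = 0"
proof -
  obtain c where c: "\<And>j. j \<le> i + k \<Longrightarrow> (0::real) < c j"
    "\<And>y w. w \<in> D \<Longrightarrow> (dir_deriv y ^^ (i + k)) f w = (\<Sum>j\<le>i+k. c j * y ^ j * mixed_partial (i + k - j) j f w)"
    using iterated_dir_deriv_expand[OF D(1,2)] by blast
  have "(\<Sum>j\<le>i+k. c j * mixed_partial (i + k - j) j f (0, 0) * y ^ j) = 0" for y
  proof -
    note ray = smooth_on_ray[OF D, where y = y]
    have "(dir_deriv y ^^ (i + k)) f (0, 0) = 0"
      using flat_iterated_deriv[OF ray(3,1,2) assms(4)] iterated_deriv_on_ray[OF D, of 0 y] D(3) by simp
    then show ?thesis using c(2)[OF D(3), of y] by (simp add: mult_ac)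
  qed
  then have "c k * mixed_partial (i + k - k) k f (0, 0) = 0"
    using polyfun_eq_0[of "\<lambda>j. c j * mixed_partial (i + k - j) j f (0, 0)" "i + k", THEN iffD1, rule_format, of k]
    by simp
  then show ?thesis using c(1)[of k] by simp
qed

lemma mixed_partial_eq_if_flat_diff_on_rays:
  assumes D: "open D" "smooth f D" "smooth g D" "(0, 0) \<in> D"
    and "\<And>y. flat (\<lambda>r. f (r, r * y) - g (r, r * y))"
  shows "mixed_partial i k f (0, 0) = mixed_partial i k g (0, 0)"
  using mixed_partial_eq_0_if_flat_on_rays[OF D(1) smooth_diff[OF D(1-3)] D(4) assms(5), of i k]
    mixed_partial_diff[OF D] by simp

lemma mixed_partial_reflect:
  assumes D: "open D" "smooth f D" "(- x, y) \<in> D"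
  shows "mixed_partial i k (\<lambda>w. f (- fst w, snd w)) (x, y) = (- 1) ^ i * mixed_partial i k f (- x, y)"
proof -
  let ?R = "\<lambda>w::real \<times> real. (- fst w, snd w)"
  define D' where "D' = ?R -` D"
  have bl: "bounded_linear ?R"
    by (intro bounded_linear_Pair bounded_linear_minus bounded_linear_fst bounded_linear_snd)
  have D': "open D'" unfolding D'_def using D(1) by (intro open_vimage linear_continuous_on bl)
  have *: "partial_l (\<lambda>w. c * f (?R w)) w = - c * partial_l f (?R w) \<and> partial_j (\<lambda>w. c * f (?R w)) w = c * partial_j f (?R w)"
    if f: "smooth f D" and w: "w \<in> D'" for f c w
  proof -
    have "(f has_derivative (\<lambda>v. partial_l f (?R w) * fst v + partial_j f (?R w) * snd v)) (at (?R w))"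
      using smooth_has_derivative_partials(1)[OF f] w by (simp add: D'_def)
    from has_derivative_mult_right[OF has_derivative_compose[OF bounded_linear_imp_has_derivative[OF bl] this], of c]
    have "((\<lambda>w. c * f (?R w)) has_derivative (\<lambda>v. (- c * partial_l f (?R w)) * fst v + (c * partial_j f (?R w)) * snd v)) (at w)"
      by (simp add: algebra_simps)
    from has_derivative_imp_partial[OF this] show ?thesis by blast
  qed
  have j: "\<forall>w\<in>D'. (partial_j ^^ k) (\<lambda>w. f (?R w)) w = (partial_j ^^ k) f (?R w)"
  proof (induction k)
    case (Suc k)
    then show ?case
      using partial_cong(2)[OF D', of _ "(partial_j ^^ k) (\<lambda>w. f (?R w))" "\<lambda>w. 1 * (partial_j ^^ k) f (?R w)"]
        *[OF smooth_iterated_partial(2)[OF D(1,2), of k], of _ 1] by simp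
  qed simp
  have "\<forall>w\<in>D'. mixed_partial i k (\<lambda>w. f (?R w)) w = (- 1) ^ i * mixed_partial i k f (?R w)"
  proof (induction i)
    case 0
    then show ?case using j by (simp add: mixed_partial_def)
  next
    case (Suc i)
    then show ?case
      using partial_cong(1)[OF D', of _ "mixed_partial i k (\<lambda>w. f (?R w))" "\<lambda>w. (- 1) ^ i * mixed_partial i k f (?R w)"]
        *[OF smooth_iterated_partial(3)[OF D(1,2), of i k], of _ "(- 1) ^ i"] by (simp add: mixed_partial_Suc_left)
  qed
  then show ?thesis using D(3) by (simp add: D'_def)
qed


section \<open>Rigidity of the logarithmic singularity\<close>

lemma arctan_lipschitz: "\<bar>arctan x - arctan y\<bar> \<le> \<bar>x - y\<bar>"
proof -
  have "norm (arctan x - arctan y) \<le> 1 * norm (x - y)"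
  proof (rule field_differentiable_bound[where S=UNIV])
    show "(arctan has_field_derivative inverse (1 + z\<^sup>2)) (at z within UNIV)" for z :: real
      using DERIV_arctan by simp
    show "norm (inverse (1 + z\<^sup>2)) \<le> 1" for z :: real
      by (simp add: field_simps add_pos_nonneg)
  qed auto
  then show ?thesis by simp
qed

lemma ln_lipschitz_away_from_0:
  assumes "0 < r" "r \<le> a" "r \<le> b"
  shows "\<bar>ln a - ln b\<bar> \<le> \<bar>a - b\<bar> / (r::real)"
proof -
  have "ln x - ln y \<le> \<bar>x - y\<bar> / r" if "r \<le> x" "r \<le> y" for x y
  proof -
    have "ln x - ln y \<le> (x - y) / y" using that assms by (intro ln_diff_le) auto
    also have "\<dots> \<le> \<bar>x - y\<bar> / y" using that assms by (intro divide_right_mono) auto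
    also have "\<dots> \<le> \<bar>x - y\<bar> / r" using that assms by (intro divide_left_mono) auto
    finally show ?thesis .
  qed
  from this[of a b] this[of b a] assms show ?thesis by (simp add: abs_le_iff abs_minus_commute)
qed

lemma continuous_int_valued_constant:
  fixes g :: "real \<Rightarrow> real"
  assumes "continuous_on {0<..<d} g" "\<And>r. r \<in> {0<..<d} \<Longrightarrow> g r \<in> \<int>" "0 < d"
  obtains n :: int where "\<And>r. r \<in> {0<..<d} \<Longrightarrow> g r = of_int n"
proof -
  have "g constant_on {0<..<d}"
  proof (rule continuous_discrete_range_constant[OF _ assms(1)])
    fix x assume x: "x \<in> {0<..<d}"
    have "1 \<le> norm (g y - g x)" if "y \<in> {0<..<d}" "g y \<noteq> g x" for y
      using Ints_nonzero_abs_ge1[of "g y - g x"] assms(2)[OF x] assms(2)[OF that(1)] that(2) by auto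
    then show "\<exists>e>0. \<forall>y. y \<in> {0<..<d} \<and> g y \<noteq> g x \<longrightarrow> e \<le> norm (g y - g x)"
      by (intro exI[of _ 1]) auto
  qed auto
  then obtain c where c: "\<And>r. r \<in> {0<..<d} \<Longrightarrow> g r = c" unfolding constant_on_def by blast
  have "c \<in> \<int>" using assms(2)[of "d / 2"] c[of "d / 2"] assms(3) by auto
  then show ?thesis using that c by (metis Ints_cases)
qed

lemma smooth_snd_lipschitz_near:
  fixes q :: "real \<times> real \<Rightarrow> real"
  assumes "open D" "smooth q D" "(0, 0) \<in> D"
  obtains e C where "0 < e" "ball (0, 0) e \<subseteq> D"
    "\<And>x y z. (x, y) \<in> ball (0, 0) e \<Longrightarrow> (x, z) \<in> ball (0, 0) e \<Longrightarrow> \<bar>q (x, y) - q (x, z)\<bar> \<le> C * \<bar>y - z\<bar>"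
proof -
  obtain e1 where e1: "0 < e1" "ball (0, 0) e1 \<subseteq> D" using assms by (meson open_contains_ball)
  have "isCont (partial_j q) (0, 0)"
    using smooth_continuous[OF smooth_partial(2)[OF assms(1,2)]] assms by (simp add: continuous_on_eq_continuous_at)
  then obtain e2 where e2: "0 < e2" "\<And>w. dist w (0, 0) < e2 \<Longrightarrow> dist (partial_j q w) (partial_j q (0, 0)) < 1"
    unfolding continuous_at_eps_delta by (metis zero_less_one)
  define C where "C = \<bar>partial_j q (0, 0)\<bar> + 1"
  define e where "e = min e1 e2"
  have C: "norm (partial_j q w) \<le> C" if "w \<in> ball (0, 0) e" for w
    using e2(2)[of w] that unfolding C_def e_def by (simp add: dist_commute dist_real_def)
  show ?thesis
  proof (rule that[of e C])
    show "0 < e" "ball (0, 0) e \<subseteq> D" using e1 e2 by (auto simp: e_def)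
    fix x y z :: real assume yz: "(x, y) \<in> ball (0, 0) e" "(x, z) \<in> ball (0, 0) e"
    let ?S = "(\<lambda>y. (x, y)) -` ball (0::real \<times> real) e"
    have "norm (q (x, y) - q (x, z)) \<le> C * norm (y - z)"
    proof (rule field_differentiable_bound[where S="?S"])
      show "convex ?S"
      proof (rule convexI)
        fix a b u v :: real assume *: "a \<in> ?S" "b \<in> ?S" "0 \<le> u" "0 \<le> v" "u + v = 1"
        have "u *\<^sub>R (x, a) + v *\<^sub>R (x, b) \<in> ball 0 e"
          using convexD[OF convex_ball, of "(x, a)" 0 e "(x, b)" u v] * by auto
        moreover have "u *\<^sub>R (x, a) + v *\<^sub>R (x, b) = (x, u *\<^sub>R a + v *\<^sub>R b)"
          using \<open>u + v = 1\<close> by (simp flip: distrib_right)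
        ultimately show "u *\<^sub>R a + v *\<^sub>R b \<in> ?S" by simp
      qed
      show "((\<lambda>y. q (x, y)) has_field_derivative partial_j q (x, y)) (at y within ?S)" if "y \<in> ?S" for y
      proof (rule has_field_derivative_at_within, rule partial_DERIV(2)[OF assms(2)])
        show "(x, y) \<in> D" using that e1 by (auto simp: zero_prod_def e_def)
      qed
      show "norm (partial_j q (x, y)) \<le> C" if "y \<in> ?S" for y using C that by (simp add: zero_prod_def)
    qed (use yz in \<open>auto simp: zero_prod_def\<close>)
    then show "\<bar>q (x, y) - q (x, z)\<bar> \<le> C * \<bar>y - z\<bar>" by simp
  qed
qed

lemma isCont_bigo_1: "isCont a 0 \<Longrightarrow> (\<lambda>r. a r) \<in> O[at_right 0](\<lambda>r::real. 1 :: real)"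
  by (intro bigoI_tendsto[where c="a 0"]) (auto simp: isCont_def filterlim_at_split)

text \<open>The setting compares two one-forms with a logarithmic singularity, \<open>(s1 - \<epsilon> arg, s2 - ln \<bar>w\<bar>)\<close>
and \<open>(q1 - \<epsilon> arg, q2 - ln \<bar>w\<bar>)\<close>, by the transition map \<open>h (x, y) = (x, y + f (x, y))\<close>: assumptions \<open>E1\<close> and \<open>E2\<close>
say that the first form is the pullback of the second one under \<open>h\<close>, up to integer multiples of
\<open>\<pi> dx\<close>. They are stated on the half plane \<open>x > 0\<close>, where the argument is \<open>arctan (y / x)\<close> and no
branch cut interferes.\<close>

context
  fixes D :: "(real \<times> real) set" and f s1 s2 q1 q2 :: "real \<times> real \<Rightarrow> real" and \<epsilon> :: real
  assumes D: "open D" "(0, 0) \<in> D"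
    and f: "smooth f D" "f (0, 0) = 0"
    and s: "smooth s1 D" "smooth s2 D" and q: "smooth q1 D" "smooth q2 D"
    and E1: "\<And>x y. (x, y) \<in> D \<Longrightarrow> (x, y + f (x, y)) \<in> D \<Longrightarrow> 0 < x \<Longrightarrow>
      \<exists>n::int. s1 (x, y) - \<epsilon> * arctan (y / x) = q1 (x, y + f (x, y)) - \<epsilon> * arctan ((y + f (x, y)) / x)
        + partial_l f (x, y) * (q2 (x, y + f (x, y)) - ln (norm (x, y + f (x, y)))) + pi * of_int n"
    and E2: "\<And>x y. (x, y) \<in> D \<Longrightarrow> (x, y + f (x, y)) \<in> D \<Longrightarrow> 0 < x \<Longrightarrow>
      s2 (x, y) - ln (norm (x, y)) = (1 + partial_j f (x, y)) * (q2 (x, y + f (x, y)) - ln (norm (x, y + f (x, y))))"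
begin

text \<open>On the ray of slope \<open>y\<close>: the point \<open>u r\<close>, its image \<open>v r\<close> under the transition map, and the values \<open>fr\<close>,
\<open>d1\<close> and \<open>d2\<close> of \<open>f\<close> and its partial derivatives at \<open>u r\<close>.\<close>

context
  fixes y :: real
begin

private definition "u r = (r, r * y)" for r :: real
private definition "fr r = f (u r)" for r
private definition "v r = (r, r * y + fr r)" for r
private definition "d1 r = partial_l f (u r)" for r
private definition "d2 r = partial_j f (u r)" for r
private definition "I = u -` D"

private lemma I: "open I" "0 \<in> I"
  unfolding I_def u_def using smooth_on_ray(1,2)[OF D(1) f(1) D(2), where y=y] .

private lemma smooth_u: "smooth g D \<Longrightarrow> smooth (\<lambda>r. g (u r)) I" for g :: "real \<times> real \<Rightarrow> real"
  unfolding I_def u_def using smooth_on_ray(3)[OF D(1) _ D(2), where y=y] .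

private lemma smooth_F: "smooth fr I" and smooth_d1: "smooth d1 I" and smooth_d2: "smooth d2 I"
  unfolding fr_def d1_def d2_def by (intro smooth_u smooth_partial[OF D(1)] f)+

private lemma F0: "fr 0 = 0" by (simp add: fr_def u_def f)

private lemma isCont_on_I: "smooth g I \<Longrightarrow> isCont g r" if "r \<in> I"
  using smooth_continuous[of g I] I that by (simp add: continuous_on_eq_continuous_at)

private lemma F_deriv: "r \<in> I \<Longrightarrow> (fr has_real_derivative d1 r + y * d2 r) (at r)"
  using smooth_on_ray(4)[OF D(1) f(1) D(2), where y=y]
  unfolding I_def fr_def d1_def d2_def u_def dir_deriv_def .

private lemma F_bigo:
  assumes "d1 \<in> O[at_right 0](\<lambda>r. r ^ k)" "d2 \<in> O[at_right 0](\<lambda>r. r ^ k)"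
  shows "fr \<in> O[at_right 0](\<lambda>r. r ^ Suc k)"
proof (rule bigo_integrate[where a=fr, OF _ F0])
  show "\<forall>\<^sub>F r in nhds 0. (fr has_real_derivative d1 r + y * d2 r) (at r)"
    using F_deriv eventually_nhds_in_open[OF I] by (auto elim: eventually_mono)
  show "(\<lambda>r. d1 r + y * d2 r) \<in> O[at_right 0](\<lambda>r. r ^ k)"
    using assms by (intro sum_in_bigo) auto
qed

private lemma isCont_u: "isCont u r"
  unfolding u_def by (intro continuous_intros)

private lemma isCont_v: "r \<in> I \<Longrightarrow> isCont v r"
  unfolding v_def using isCont_on_I[OF _ smooth_F] by (intro continuous_intros) auto

private lemma ev_in: "open X \<Longrightarrow> (0, 0) \<in> X \<Longrightarrow> \<forall>\<^sub>F r in at_right 0. 0 < r \<and> r \<in> I \<and> u r \<in> X \<and> v r \<in> X"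
proof (intro eventually_conj)
  assume X: "open X" "(0, 0) \<in> X"
  have *: "\<forall>\<^sub>F r in at_right 0. g r \<in> X" if "isCont g 0" "g 0 \<in> X" for g :: "real \<Rightarrow> real \<times> real"
  proof -
    have "(g \<longlongrightarrow> g 0) (at_right 0)" using that(1) by (simp add: isCont_def filterlim_at_split)
    then show ?thesis by (rule topological_tendstoD) (fact X(1) that(2))+
  qed
  show "\<forall>\<^sub>F r in at_right 0. u r \<in> X" by (rule *[OF isCont_u]) (simp add: u_def X)
  show "\<forall>\<^sub>F r in at_right 0. v r \<in> X" by (rule *[OF isCont_v[OF I(2)]]) (simp add: v_def F0 X)
  show "\<forall>\<^sub>F r::real in at_right 0. 0 < r"
    using eventually_at_right_0_less[of 1] by (rule eventually_mono) auto
  show "\<forall>\<^sub>F r::real in at_right 0. r \<in> I"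
    using eventually_nhds_in_open[OF I] by (simp add: eventually_nhds_conv_at eventually_at_split)
qed

private lemma norm_uv: "0 < r \<Longrightarrow> r \<le> norm (u r)" "0 < r \<Longrightarrow> r \<le> norm (v r)"
  using norm_fst_le[of r "r * y"] norm_fst_le[of r "r * y + fr r"] by (auto simp: u_def v_def)

private lemma norm_diff_uv: "\<bar>norm (v r) - norm (u r)\<bar> \<le> \<bar>fr r\<bar>"
  using norm_triangle_ineq3[of "v r" "u r"] by (simp add: u_def v_def norm_Pair)

text \<open>The transition map moves \<open>u r\<close> by \<open>fr r\<close> only, and both points have norm at least \<open>r\<close>; so everything
that is Lipschitz with constant of order \<open>1 / r\<close> changes by \<open>O(fr r / r)\<close>.\<close>

private lemma bounds:
  fixes g :: "real \<times> real \<Rightarrow> real"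
  assumes F: "fr \<in> O[at_right 0](\<lambda>r. r ^ Suc k)"
  shows "smooth g D \<Longrightarrow> (\<lambda>r. g (v r) - g (u r)) \<in> O[at_right 0](\<lambda>r. r ^ k)"
    and "smooth g D \<Longrightarrow> (\<lambda>r. g (v r)) \<in> O[at_right 0](\<lambda>r. 1)"
    and "(\<lambda>r. ln (norm (u r)) - ln (norm (v r))) \<in> O[at_right 0](\<lambda>r. r ^ k)"
    and "(\<lambda>r. ln (norm (v r)) - ln r) \<in> O[at_right 0](\<lambda>r. 1)"
    and "(\<lambda>r. arctan (snd (u r) / r) - arctan (snd (v r) / r)) \<in> O[at_right 0](\<lambda>r. r ^ k)"
proof -
  have Fk: "fr \<in> O[at_right 0](\<lambda>r. r ^ k)"
    by (rule landau_o.big_trans[OF F bigo_power_mono]) simp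
  have pos: "\<forall>\<^sub>F r::real in at_right 0. 0 < r"
    using eventually_at_right_0_less[of 1] by (rule eventually_mono) auto
  have "(\<lambda>r. fr r / r) \<in> O[at_right 0](\<lambda>r. r ^ Suc k / r)"
    using F by (intro landau_o.big.divide_right) (auto intro: eventually_mono[OF pos])
  also have "(\<lambda>r. r ^ Suc k / r) \<in> O[at_right 0](\<lambda>r. r ^ k)"
    by (rule bigoI[of _ 1]) (auto intro: eventually_mono[OF pos])
  finally have Fr: "(\<lambda>r. fr r / r) \<in> O[at_right 0](\<lambda>r. r ^ k)" .
  show "(\<lambda>r. g (v r) - g (u r)) \<in> O[at_right 0](\<lambda>r. r ^ k)" if g: "smooth g D"
  proof -
    obtain e C where e: "0 < e" "ball (0, 0) e \<subseteq> D"
      "\<And>x y z. (x, y) \<in> ball (0, 0) e \<Longrightarrow> (x, z) \<in> ball (0, 0) e \<Longrightarrow> \<bar>g (x, y) - g (x, z)\<bar> \<le> C * \<bar>y - z\<bar>"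
      using smooth_snd_lipschitz_near[OF D(1) g D(2)] by blast
    have "(\<lambda>r. g (v r) - g (u r)) \<in> O[at_right 0](fr)"
    proof (rule bigoI[where c=C], rule eventually_mono[OF ev_in[of "ball (0, 0) e"]])
      fix r assume "0 < r \<and> r \<in> I \<and> u r \<in> ball (0, 0) e \<and> v r \<in> ball (0, 0) e"
      then show "norm (g (v r) - g (u r)) \<le> C * norm (fr r)"
        using e(3)[of r "r * y + fr r" "r * y"] by (simp add: u_def v_def)
    qed (use e in auto)
    then show ?thesis using Fk by (rule landau_o.big_trans)
  qed note 1 = this
  show "(\<lambda>r. g (v r)) \<in> O[at_right 0](\<lambda>r. 1)" if "smooth g D"
  proof (rule isCont_bigo_1)
    have "isCont g (v 0)"
      using smooth_continuous[OF that] D by (simp add: continuous_on_eq_continuous_at v_def F0)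
    then show "isCont (\<lambda>r. g (v r)) 0" using isCont_v[OF I(2)] isCont_o2 by blast
  qed
  have "(\<lambda>r. ln (norm (u r)) - ln (norm (v r))) \<in> O[at_right 0](\<lambda>r. fr r / r)"
  proof (rule bigoI[where c=1], rule eventually_mono[OF pos])
    fix r :: real assume r: "0 < r"
    have "\<bar>ln (norm (u r)) - ln (norm (v r))\<bar> \<le> \<bar>norm (u r) - norm (v r)\<bar> / r"
      by (intro ln_lipschitz_away_from_0 norm_uv r)
    also have "\<dots> \<le> \<bar>fr r\<bar> / r"
      using norm_diff_uv[of r] r by (intro divide_right_mono) (auto simp: abs_minus_commute)
    finally show "norm (ln (norm (u r)) - ln (norm (v r))) \<le> 1 * norm (fr r / r)" using r by (simp add: abs_divide)
  qed
  then show "(\<lambda>r. ln (norm (u r)) - ln (norm (v r))) \<in> O[at_right 0](\<lambda>r. r ^ k)"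
    using Fr by (rule landau_o.big_trans)
  have "(\<lambda>r. ln (norm (v r)) - ln r) \<in> O[at_right 0](\<lambda>r. \<bar>y\<bar> + \<bar>fr r / r\<bar>)"
  proof (rule bigoI[where c=1], rule eventually_mono[OF pos])
    fix r :: real assume r: "0 < r"
    have "\<bar>ln (norm (v r)) - ln r\<bar> \<le> \<bar>norm (v r) - r\<bar> / r"
      by (intro ln_lipschitz_away_from_0 norm_uv r) simp
    also have "norm (v r) \<le> \<bar>r\<bar> + \<bar>r * y + fr r\<bar>"
      using norm_Pair_le[of r "r * y + fr r"] by (simp add: v_def)
    then have "\<bar>norm (v r) - r\<bar> / r \<le> (\<bar>r * y\<bar> + \<bar>fr r\<bar>) / r"
      using norm_uv(2)[OF r] r by (intro divide_right_mono) auto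
    also have "\<dots> = \<bar>y\<bar> + \<bar>fr r / r\<bar>" using r by (simp add: add_divide_distrib abs_mult abs_divide)
    finally show "norm (ln (norm (v r)) - ln r) \<le> 1 * norm (\<bar>y\<bar> + \<bar>fr r / r\<bar>)" by simp
  qed
  also have "(\<lambda>r. \<bar>y\<bar> + \<bar>fr r / r\<bar>) \<in> O[at_right 0](\<lambda>r. 1)"
  proof (rule sum_in_bigo)
    have "(\<lambda>r. fr r / r) \<in> O[at_right 0](\<lambda>r. r ^ 0)"
      by (rule landau_o.big_trans[OF Fr bigo_power_mono]) simp
    then show "(\<lambda>r. \<bar>fr r / r\<bar>) \<in> O[at_right 0](\<lambda>r. 1)" by (simp del: abs_divide)
  qed auto
  finally show "(\<lambda>r. ln (norm (v r)) - ln r) \<in> O[at_right 0](\<lambda>r. 1)" .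
  have "(\<lambda>r. arctan (snd (u r) / r) - arctan (snd (v r) / r)) \<in> O[at_right 0](\<lambda>r. fr r / r)"
  proof (rule bigoI[where c=1], rule always_eventually, rule allI)
    fix r
    have "snd (u r) / r - snd (v r) / r = - (fr r / r)"
      unfolding u_def v_def by (simp add: add_divide_distrib)
    then show "norm (arctan (snd (u r) / r) - arctan (snd (v r) / r)) \<le> 1 * norm (fr r / r)"
      using arctan_lipschitz[of "snd (u r) / r" "snd (v r) / r"] by (simp only: real_norm_def abs_minus_cancel mult_1)
  qed
  then show "(\<lambda>r. arctan (snd (u r) / r) - arctan (snd (v r) / r)) \<in> O[at_right 0](\<lambda>r. r ^ k)"
    using Fr by (rule landau_o.big_trans)
qed

private definition "e1 r = s1 (u r) - q1 (v r) - \<epsilon> * (arctan (snd (u r) / r) - arctan (snd (v r) / r))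
   - d1 r * (q2 (v r) - ln (norm (v r)))" for r

text \<open>The integer in \<open>E1\<close> depends continuously on \<open>r\<close> along the ray, hence not at all. Without this it
could absorb the growth of \<open>d1 r * ln r\<close>.\<close>

private lemma E1_constant: "\<exists>n::int. \<forall>\<^sub>F r in at_right 0. e1 r = pi * of_int n"
proof -
  obtain d where d: "0 < d" "\<And>r. 0 < r \<Longrightarrow> r < d \<Longrightarrow> r \<in> I \<and> u r \<in> D \<and> v r \<in> D"
    using ev_in[OF D] unfolding eventually_at_right_field by auto
  have c: "isCont (\<lambda>r. g (w r)) r" if "smooth g D" "isCont w r" "w r \<in> D" for g :: "real \<times> real \<Rightarrow> real" and w :: "real \<Rightarrow> real \<times> real" and r
  proof (rule isCont_o2[OF that(2)])
    show "isCont g (w r)" using smooth_continuous[OF that(1)] D that(3) by (simp add: continuous_on_eq_continuous_at)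
  qed
  have "continuous_on {0<..<d} (\<lambda>r. e1 r / pi)"
  proof (rule continuous_at_imp_continuous_on, rule ballI)
    fix r assume r: "r \<in> {0<..<d}"
    have "norm (v r) \<noteq> 0" using norm_uv(2)[of r] r by auto
    then show "isCont (\<lambda>r. e1 r / pi) r" unfolding e1_def
      using r d(2)[of r] s q
      by (intro continuous_intros c isCont_u isCont_v isCont_on_I smooth_d1) auto
  qed
  moreover have "e1 r / pi \<in> \<int>" if "r \<in> {0<..<d}" for r
  proof -
    have "\<exists>n::int. s1 (u r) - \<epsilon> * arctan (snd (u r) / r) = q1 (v r) - \<epsilon> * arctan (snd (v r) / r)
        + d1 r * (q2 (v r) - ln (norm (v r))) + pi * of_int n"
      using E1[of r "r * y"] d(2)[of r] that unfolding u_def v_def d1_def fr_def by simp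
    then obtain n :: int where "e1 r = pi * of_int n" unfolding e1_def by (auto simp: algebra_simps)
    then show ?thesis by simp
  qed
  ultimately obtain n :: int where n: "\<And>r. r \<in> {0<..<d} \<Longrightarrow> e1 r / pi = of_int n"
    using continuous_int_valued_constant d(1) by blast
  show ?thesis
    by (rule exI[of _ n], rule eventually_mono[OF eventually_at_right_0_less[OF d(1)]])
      (use n in \<open>auto simp: field_simps\<close>)
qed

text \<open>Bootstrapping: if the derivatives \<open>d1\<close> and \<open>d2\<close> are \<open>O(r ^ k)\<close>, then \<open>fr\<close> is \<open>O(r ^ (k + 1))\<close> and
\<open>E1\<close> and \<open>E2\<close> become \<open>b + d * ln r = O(r ^ k)\<close> with \<open>b\<close> smooth, so that \<open>log_comparison\<close> gives
\<open>O(r ^ (k + 1))\<close> for the derivatives.\<close>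

lemma rigidity_on_ray:
  obtains n :: int where "flat (\<lambda>r. s1 (r, r * y) - (q1 (r, r * y) + pi * of_int n))"
    "flat (\<lambda>r. s2 (r, r * y) - q2 (r, r * y))"
proof -
  obtain n :: int where n: "\<forall>\<^sub>F r in at_right 0. e1 r = pi * of_int n" using E1_constant by blast
  define b1 where "b1 r = s1 (u r) - (q1 (u r) + pi * of_int n)" for r
  define b2 where "b2 r = s2 (u r) - q2 (u r)" for r
  have b1: "smooth b1 I" and b2: "smooth b2 I"
    unfolding b1_def b2_def by (intro smooth_diff smooth_add smooth_const I smooth_u s q)+
  have step: "(\<lambda>r. b1 r + d1 r * ln r) \<in> O[at_right 0](\<lambda>r. r ^ k) \<and> (\<lambda>r. b2 r + d2 r * ln r) \<in> O[at_right 0](\<lambda>r. r ^ k)"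
    if d: "d1 \<in> O[at_right 0](\<lambda>r. r ^ k)" "d2 \<in> O[at_right 0](\<lambda>r. r ^ k)" for k
  proof
    note bd = bounds[OF F_bigo[OF d]]
    have dm: "(\<lambda>r. dd r * g r) \<in> O[at_right 0](\<lambda>r. r ^ k)"
      if "dd \<in> O[at_right 0](\<lambda>r. r ^ k)" "g \<in> O[at_right 0](\<lambda>r. 1)" for dd g :: "real \<Rightarrow> real"
      using landau_o.big.mult[OF that] by simp
    have "(\<lambda>r. b1 r + d1 r * ln r) \<in> O[at_right 0](\<lambda>r. (q1 (v r) - q1 (u r))
        + \<epsilon> * (arctan (snd (u r) / r) - arctan (snd (v r) / r)) + d1 r * q2 (v r) - d1 r * (ln (norm (v r)) - ln r))"
      by (rule bigoI[where c=1], rule eventually_mono[OF n]) (simp add: b1_def e1_def algebra_simps)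
    also have "(\<lambda>r. (q1 (v r) - q1 (u r))
        + \<epsilon> * (arctan (snd (u r) / r) - arctan (snd (v r) / r)) + d1 r * q2 (v r) - d1 r * (ln (norm (v r)) - ln r))
      \<in> O[at_right 0](\<lambda>r. r ^ k)"
    proof -
      have "(\<lambda>r. \<epsilon> * (arctan (snd (u r) / r) - arctan (snd (v r) / r))) \<in> O[at_right 0](\<lambda>r. r ^ k)"
        using bd(5) by (cases "\<epsilon> = 0") auto
      from sum_in_bigo(2)[OF sum_in_bigo(1)[OF sum_in_bigo(1)[OF bd(1)[OF q(1)] this] dm[OF d(1) bd(2)[OF q(2)]]] dm[OF d(1) bd(4)]]
      show ?thesis .
    qed
    finally show "(\<lambda>r. b1 r + d1 r * ln r) \<in> O[at_right 0](\<lambda>r. r ^ k)" .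
    have "(\<lambda>r. b2 r + d2 r * ln r) \<in> O[at_right 0](\<lambda>r. (q2 (v r) - q2 (u r))
        + d2 r * q2 (v r) + (ln (norm (u r)) - ln (norm (v r))) - d2 r * (ln (norm (v r)) - ln r))"
    proof (rule bigoI[where c=1], rule eventually_mono[OF ev_in[OF D]])
      fix r assume r: "0 < r \<and> r \<in> I \<and> u r \<in> D \<and> v r \<in> D"
      then have "s2 (u r) - ln (norm (u r)) = (1 + d2 r) * (q2 (v r) - ln (norm (v r)))"
        using E2[of r "r * y"] unfolding u_def v_def d2_def fr_def by simp
      then show "norm (b2 r + d2 r * ln r) \<le> 1 * norm ((q2 (v r) - q2 (u r))
        + d2 r * q2 (v r) + (ln (norm (u r)) - ln (norm (v r))) - d2 r * (ln (norm (v r)) - ln r))"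
        by (simp add: b2_def algebra_simps)
    qed
    also have "(\<lambda>r. (q2 (v r) - q2 (u r))
        + d2 r * q2 (v r) + (ln (norm (u r)) - ln (norm (v r))) - d2 r * (ln (norm (v r)) - ln r)) \<in> O[at_right 0](\<lambda>r. r ^ k)"
      by (rule sum_in_bigo(2)[OF sum_in_bigo(1)[OF sum_in_bigo(1)[OF bd(1)[OF q(2)] dm[OF d(2) bd(2)[OF q(2)]]] bd(3)] dm[OF d(2) bd(4)]])
    finally show "(\<lambda>r. b2 r + d2 r * ln r) \<in> O[at_right 0](\<lambda>r. r ^ k)" .
  qed
  have d: "d1 \<in> O[at_right 0](\<lambda>r. r ^ k) \<and> d2 \<in> O[at_right 0](\<lambda>r. r ^ k)" for k
  proof (induction k)
    case 0
    show ?case using isCont_bigo_1[OF isCont_on_I[OF I(2) smooth_d1]] isCont_bigo_1[OF isCont_on_I[OF I(2) smooth_d2]] by simp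
  next
    case (Suc k)
    then show ?case
      using log_comparison(1)[OF smooth_d1 b1 I] log_comparison(1)[OF smooth_d2 b2 I] step[of k] by blast
  qed
  have "flat b1" "flat b2" unfolding flat_def
    using log_comparison(2)[OF smooth_d1 b1 I] log_comparison(2)[OF smooth_d2 b2 I] step d by blast+
  then show ?thesis using that[of n] unfolding b1_def b2_def u_def by blast
qed

end

text \<open>The integer is the same on all rays, since it is determined by the values at the origin, where all
rays meet.\<close>

lemma log_rigidity:
  obtains n :: int where "\<And>i k. mixed_partial i k s1 (0, 0) = mixed_partial i k (\<lambda>w. q1 w + pi * of_int n) (0, 0)"
    "\<And>i k. mixed_partial i k s2 (0, 0) = mixed_partial i k q2 (0, 0)"
proof -
  have sm: "smooth (\<lambda>w. q1 w + pi * of_int n) D" for n :: int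
    by (intro smooth_add smooth_const D q)
  have *: "s1 (0, 0) = q1 (0, 0) + pi * of_int n" if "flat (\<lambda>r. s1 (r, r * y) - (q1 (r, r * y) + pi * of_int n))" for y and n :: int
    using flat_deriv(2)[OF smooth_on_ray(3,1,2)[OF D(1) smooth_diff[OF D(1) s(1) sm] D(2), where y=y] that] by simp
  obtain n :: int where n: "flat (\<lambda>r. s1 (r, r * 0) - (q1 (r, r * 0) + pi * of_int n))"
    using rigidity_on_ray by blast
  have f1: "flat (\<lambda>r. s1 (r, r * y) - (q1 (r, r * y) + pi * of_int n))"
    and f2: "flat (\<lambda>r. s2 (r, r * y) - q2 (r, r * y))" for y
  proof -
    obtain m :: int where m: "flat (\<lambda>r. s1 (r, r * y) - (q1 (r, r * y) + pi * of_int m))"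
      and f2: "flat (\<lambda>r. s2 (r, r * y) - q2 (r, r * y))"
      using rigidity_on_ray by blast
    have "pi * real_of_int m = pi * of_int n" using *[OF m] *[OF n] by simp
    then show "flat (\<lambda>r. s1 (r, r * y) - (q1 (r, r * y) + pi * of_int n))" using m by simp
    show "flat (\<lambda>r. s2 (r, r * y) - q2 (r, r * y))" by fact
  qed
  show ?thesis
    by (rule that[of n]) (rule mixed_partial_eq_if_flat_diff_on_rays[OF D(1) _ _ D(2)]; fact s q sm f1 f2)+
qed

end


section \<open>Hamiltonian vector fields on the product of spheres\<close>

definition e3 :: "real^3" where "e3 = vector [0, 0, 1]"

text \<open>The Hamiltonian vector fields of \<open>L\<close> and of \<open>H\<close>, as linear and quadratic vector fields on the ambient space.\<close>

definition L_field :: "point \<Rightarrow> point" where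
  "L_field p = (cross3 e3 (fst p), cross3 e3 (snd p))"

definition H_field :: "real \<Rightarrow> real \<Rightarrow> real \<Rightarrow> point \<Rightarrow> point" where
  "H_field R1 R2 t p =
     ((1 / R1) *\<^sub>R cross3 ((1 - t) *\<^sub>R e3 + t *\<^sub>R snd p) (fst p), (t / R2) *\<^sub>R cross3 (fst p) (snd p))"

text \<open>Rodrigues' formula for the rotation of both spheres by the angle \<open>\<theta>\<close> about the third axis, which is the
flow of \<open>L\<close>. Written with the linear map \<open>L_field\<close> it can be differentiated and composed using
\<open>L_field_cube\<close> alone.\<close>

definition rot :: "real \<Rightarrow> point \<Rightarrow> point" where
  "rot \<theta> p = p + sin \<theta> *\<^sub>R L_field p + (1 - cos \<theta>) *\<^sub>R L_field (L_field p)"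

definition dL :: "real \<Rightarrow> real \<Rightarrow> point \<Rightarrow> real" where
  "dL R1 R2 v = R1 * fst v $ 3 + R2 * snd v $ 3"

definition dH :: "real \<Rightarrow> point \<Rightarrow> point \<Rightarrow> real" where
  "dH t p v = ((1 - t) *\<^sub>R e3 + t *\<^sub>R snd p) \<bullet> fst v + t * (fst p \<bullet> snd v)"

lemma L_field_components:
  "fst (L_field p) $ 1 = - (fst p $ 2)" "fst (L_field p) $ 2 = fst p $ 1" "fst (L_field p) $ 3 = 0"
  "snd (L_field p) $ 1 = - (snd p $ 2)" "snd (L_field p) $ 2 = snd p $ 1" "snd (L_field p) $ 3 = 0"
  by (simp_all add: L_field_def e3_def cross3_def)

lemma rot_components:
  "fst (rot \<theta> p) $ 1 = cos \<theta> * fst p $ 1 - sin \<theta> * fst p $ 2"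
  "fst (rot \<theta> p) $ 2 = sin \<theta> * fst p $ 1 + cos \<theta> * fst p $ 2"
  "fst (rot \<theta> p) $ 3 = fst p $ 3"
  "snd (rot \<theta> p) $ 1 = cos \<theta> * snd p $ 1 - sin \<theta> * snd p $ 2"
  "snd (rot \<theta> p) $ 2 = sin \<theta> * snd p $ 1 + cos \<theta> * snd p $ 2"
  "snd (rot \<theta> p) $ 3 = snd p $ 3"
  by (simp_all add: rot_def L_field_components algebra_simps)

lemma point_eqI:
  fixes p q :: point
  assumes "\<And>i. fst p $ i = fst q $ i" "\<And>i. snd p $ i = snd q $ i"
  shows "p = q"
  using assms by (simp add: prod_eq_iff vec_eq_iff)

lemma linear_L_field: "linear L_field"
  by (rule linearI) (auto simp: L_field_def cross_add_right cross_mult_right)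

lemma bounded_linear_L_field: "bounded_linear L_field"
  using linear_L_field linear_conv_bounded_linear by blast

lemma L_field_cube: "L_field (L_field (L_field p)) = - L_field p"
proof (rule point_eqI)
  fix i :: 3
  show "fst (L_field (L_field (L_field p))) $ i = fst (- L_field p) $ i"
    using exhaust_3[of i] by (auto simp: L_field_components)
  show "snd (L_field (L_field (L_field p))) $ i = snd (- L_field p) $ i"
    using exhaust_3[of i] by (auto simp: L_field_components)
qed

lemma linear_rot: "linear (rot \<theta>)"
  unfolding rot_def using linear_L_field
  by (intro linearI) (auto simp: linear_add linear_scale algebra_simps)

lemma rot_0 [simp]: "rot 0 p = p"
  by (simp add: rot_def)

lemma rot_rot: "rot a (rot b p) = rot (a + b) p"
proof (rule point_eqI)
  fix i :: 3
  show "fst (rot a (rot b p)) $ i = fst (rot (a + b) p) $ i"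
    using exhaust_3[of i] by (auto simp: rot_components sin_add cos_add algebra_simps)
  show "snd (rot a (rot b p)) $ i = snd (rot (a + b) p) $ i"
    using exhaust_3[of i] by (auto simp: rot_components sin_add cos_add algebra_simps)
qed

lemma rot_in_M: "p \<in> M \<Longrightarrow> rot \<theta> p \<in> M"
proof -
  have *: "(c * x - s * y)\<^sup>2 + (s * x + c * y)\<^sup>2 = x\<^sup>2 + y\<^sup>2" if "s\<^sup>2 + c\<^sup>2 = 1" for c s x y :: real
  proof -
    have "(c * x - s * y)\<^sup>2 + (s * x + c * y)\<^sup>2 = (s\<^sup>2 + c\<^sup>2) * (x\<^sup>2 + y\<^sup>2)"
      by (simp add: power2_eq_square algebra_simps)
    then show ?thesis using that by simp
  qed
  assume "p \<in> M"
  then show ?thesis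
    using *[OF sin_cos_squared_add, of \<theta> "fst p $ 1" "fst p $ 2"] *[OF sin_cos_squared_add, of \<theta> "snd p $ 1" "snd p $ 2"]
    by (auto simp: M_def mem_Times_iff norm_eq_sqrt_inner inner_vec_def sum_3 rot_components power2_eq_square)
qed

lemma F_rot: "F R1 R2 t (rot \<theta> p) = F R1 R2 t p"
proof -
  have *: "(c * x - s * y) * (c * x' - s * y') + (s * x + c * y) * (s * x' + c * y') = x * x' + y * y'"
    if "s\<^sup>2 + c\<^sup>2 = 1" for c s x y x' y' :: real
  proof -
    have "(c * x - s * y) * (c * x' - s * y') + (s * x + c * y) * (s * x' + c * y') = (s\<^sup>2 + c\<^sup>2) * (x * x' + y * y')"
      by (simp add: power2_eq_square algebra_simps)
    then show ?thesis using that by simp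
  qed
  show ?thesis
    using *[OF sin_cos_squared_add, of \<theta> "fst p $ 1" "fst p $ 2" "snd p $ 1" "snd p $ 2"]
    by (simp add: F_def L_def H_def rot_components)
qed

lemma L_field_rot: "L_field (rot \<theta> p) = rot \<theta> (L_field p)"
  using linear_L_field by (simp add: rot_def linear_add linear_scale)

lemma H_field_rot: "H_field R1 R2 t (rot \<theta> p) = rot \<theta> (H_field R1 R2 t p)"
proof -
  have sc: "sin \<theta> * (sin \<theta> * x) + cos \<theta> * (cos \<theta> * x) = x" for x
    using sin_cos_squared_add[of \<theta>] by (simp add: power2_eq_square flip: mult.assoc distrib_right)
  have sc': "sin \<theta> * (sin \<theta> * x) = x - cos \<theta> * (cos \<theta> * x)" for x using sc[of x] by simp
  show ?thesis
  proof (rule point_eqI)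
    fix i :: 3
    show "fst (H_field R1 R2 t (rot \<theta> p)) $ i = fst (rot \<theta> (H_field R1 R2 t p)) $ i"
      using exhaust_3[of i]
      by (auto simp: rot_components H_field_def cross3_def e3_def) (auto simp: algebra_simps sc' add_divide_distrib diff_divide_distrib)
    show "snd (H_field R1 R2 t (rot \<theta> p)) $ i = snd (rot \<theta> (H_field R1 R2 t p)) $ i"
      using exhaust_3[of i]
      by (auto simp: rot_components H_field_def cross3_def e3_def) (auto simp: algebra_simps sc' add_divide_distrib diff_divide_distrib)
  qed
qed

lemma F_has_derivative: "(F R1 R2 t has_derivative (\<lambda>v. (dL R1 R2 v, dH t p v))) (at p)"
proof -
  have c: "((\<lambda>p::point. fst p $ i) has_derivative (\<lambda>v. fst v $ i)) (at p)"
    "((\<lambda>p::point. snd p $ i) has_derivative (\<lambda>v. snd v $ i)) (at p)" for i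
    by (rule bounded_linear_imp_has_derivative,
        intro bounded_linear_compose[OF bounded_linear_vec_nth] bounded_linear_fst bounded_linear_snd)+
  have "(L R1 R2 has_derivative dL R1 R2) (at p)"
    unfolding L_def[abs_def] dL_def[abs_def] by (auto intro!: derivative_eq_intros c)
  moreover have "(H t has_derivative dH t p) (at p)"
    unfolding H_def[abs_def] dH_def[abs_def]
    by (rule derivative_eq_intros c refl)+
      (auto simp: e3_def inner_vec_def sum_3 fun_eq_iff algebra_simps)
  ultimately show ?thesis unfolding F_def[abs_def] by (rule has_derivative_Pair)
qed

lemma F_derivative_fields:
  assumes "R1 \<noteq> 0" "R2 \<noteq> 0"
  shows "dL R1 R2 (L_field p) = 0" "dH t p (L_field p) = 0"
    "dL R1 R2 (H_field R1 R2 t p) = 0" "dH t p (H_field R1 R2 t p) = 0"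
  using assms
  by (simp_all add: dL_def dH_def L_field_def H_field_def e3_def cross3_def inner_vec_def sum_3 field_simps)

text \<open>On the tangent plane at \<open>p\<close>, rotating a gradient \<open>g\<close> by a right angle turns the pairing with \<open>g\<close> into
the area form. This is how the formulas for the vector fields arise.\<close>

lemma area_form_cross:
  assumes "norm p = 1" "v \<bullet> p = 0"
  shows "area_form p (cross3 g p) v = g \<bullet> v"
proof -
  have "area_form p (cross3 g p) v = (p \<bullet> p) * (g \<bullet> v) - (p \<bullet> g) * (v \<bullet> p)"
    unfolding area_form_def by (simp add: cross3_simps)
  then show ?thesis using assms by (simp add: norm_eq_1)
qed

lemma area_form_scale: "area_form p (c *\<^sub>R u) v = c * area_form p u v"
  by (simp add: area_form_def cross_mult_left)

lemma area_form_add: "area_form p (u + u') v = area_form p u v + area_form p u' v"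
  by (simp add: area_form_def cross_add_left inner_add_right)

lemma omega_fields:
  assumes "p \<in> M" "v \<in> tangent p" "R1 \<noteq> 0" "R2 \<noteq> 0"
  shows "omega R1 R2 p (\<alpha> *\<^sub>R L_field p + \<beta> *\<^sub>R H_field R1 R2 t p) v = - (\<alpha> * dL R1 R2 v + \<beta> * dH t p v)"
proof -
  have p: "norm (fst p) = 1" "norm (snd p) = 1" "fst v \<bullet> fst p = 0" "snd v \<bullet> snd p = 0"
    using assms by (auto simp: M_def tangent_def)
  have e3: "e3 \<bullet> x = x $ 3" for x by (simp add: e3_def inner_vec_def sum_3)
  show ?thesis
    using assms(3,4)
    by (simp add: omega_def L_field_def H_field_def area_form_scale area_form_add
        area_form_cross[OF p(1,3)] area_form_cross[OF p(2,4)] dL_def dH_def e3 algebra_simps)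
qed

lemma fields_tangent: "\<alpha> *\<^sub>R L_field p + \<beta> *\<^sub>R H_field R1 R2 t p \<in> tangent p"
  by (simp add: tangent_def L_field_def H_field_def inner_add_left dot_cross_self)

text \<open>The difference \<open>X - Y\<close> is paired with the vector obtained from it by a rotation by a right angle on one of
the spheres; the value is a multiple of the squared norm of its component there.\<close>

lemma omega_nondegenerate:
  assumes "p \<in> M" "X \<in> tangent p" "Y \<in> tangent p" "R1 \<noteq> 0" "R2 \<noteq> 0"
    and "\<And>v. v \<in> tangent p \<Longrightarrow> omega R1 R2 p X v = omega R1 R2 p Y v"
  shows "X = Y"
proof -
  have *: "u - w = 0"
    if "norm q = 1" "u \<bullet> q = 0" "w \<bullet> q = 0" "area_form q u (cross3 q (u - w)) = area_form q w (cross3 q (u - w))"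
    for q u w :: "real^3"
  proof -
    have "area_form q (u - w) (cross3 q (u - w)) = 0"
      using that(4) by (simp add: area_form_def Cross3.left_diff_distrib inner_diff_right)
    moreover have "area_form q (u - w) (cross3 q (u - w)) = (q \<bullet> q) * ((u - w) \<bullet> (u - w)) - (q \<bullet> (u - w)) * (q \<bullet> (u - w))"
      unfolding area_form_def by (simp add: Lagrange inner_diff_right inner_commute)
    moreover have "q \<bullet> (u - w) = 0" using that by (simp add: inner_diff_right inner_commute)
    ultimately have "(u - w) \<bullet> (u - w) = 0" using that(1) by (simp only: norm_eq_1 mult_1 mult_zero_left diff_zero)
    then show ?thesis by (simp only: inner_eq_zero_iff)
  qed
  have p: "norm (fst p) = 1" "norm (snd p) = 1" using assms by (auto simp: M_def)
  have "fst X - fst Y = 0"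
    by (rule *[OF p(1)])
      (use assms(2-4) assms(6)[of "(cross3 (fst p) (fst X - fst Y), 0)"] in
        \<open>auto simp: tangent_def dot_cross_self omega_def area_form_def\<close>)
  moreover have "snd X - snd Y = 0"
    by (rule *[OF p(2)])
      (use assms(2,3,5) assms(6)[of "(0, cross3 (snd p) (snd X - snd Y))"] in
        \<open>auto simp: tangent_def dot_cross_self omega_def area_form_def\<close>)
  ultimately show ?thesis by (simp add: prod_eq_iff)
qed

text \<open>A curve on the sphere with prescribed velocity, by normalising a straight line.\<close>

lemma sphere_curve:
  fixes p v :: "real^3"
  assumes "norm p = 1" "v \<bullet> p = 0"
  defines "c \<equiv> (\<lambda>s. (1 / sqrt (1 + s\<^sup>2 * (v \<bullet> v))) *\<^sub>R (p + s *\<^sub>R v))"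
  shows "norm (c s) = 1" "c 0 = p" "(c has_vector_derivative v) (at 0)"
proof -
  have n: "0 < 1 + s\<^sup>2 * (v \<bullet> v)" for s by (simp add: add_pos_nonneg)
  have "norm (p + s *\<^sub>R v) = sqrt (1 + s\<^sup>2 * (v \<bullet> v))"
    using assms(1,2) by (simp add: norm_eq_sqrt_inner inner_add_left inner_add_right inner_commute power2_eq_square)
  then show "norm (c s) = 1" using n[of s] by (simp add: c_def less_imp_neq[symmetric])
  show "c 0 = p" by (simp add: c_def)
  have "((\<lambda>s. 1 / sqrt (1 + s\<^sup>2 * (v \<bullet> v))) has_real_derivative 0) (at 0)"
    by (auto intro!: derivative_eq_intros)
  moreover have "((\<lambda>s. p + s *\<^sub>R v) has_vector_derivative v) (at 0)"
    by (auto intro!: derivative_eq_intros)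
  ultimately show "(c has_vector_derivative v) (at 0)"
    unfolding c_def using has_vector_derivative_scaleR by fastforce
qed

text \<open>A derivative within a subset of \<open>M\<close> is not unique as a linear map on the ambient space. On tangent
vectors it is, since these are velocities of curves that stay in the subset.\<close>

lemma derivative_within_M_unique:
  fixes f :: "point \<Rightarrow> real"
  assumes W: "openin (top_of_set M) W" "p \<in> W" and v: "v \<in> tangent p"
    and "(f has_derivative df) (at p within W)" "(f has_derivative df') (at p within W)"
  shows "df v = df' v"
proof -
  obtain T where T: "open T" "W = M \<inter> T" using W(1) by (auto simp: openin_open)
  have p: "norm (fst p) = 1" "norm (snd p) = 1" "fst v \<bullet> fst p = 0" "snd v \<bullet> snd p = 0"
    using T W(2) v by (auto simp: M_def tangent_def)
  define c1 where "c1 s = (1 / sqrt (1 + s\<^sup>2 * (fst v \<bullet> fst v))) *\<^sub>R (fst p + s *\<^sub>R fst v)" for s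
  define c2 where "c2 s = (1 / sqrt (1 + s\<^sup>2 * (snd v \<bullet> snd v))) *\<^sub>R (snd p + s *\<^sub>R snd v)" for s
  note c1 = sphere_curve[OF p(1,3), folded c1_def] and c2 = sphere_curve[OF p(2,4), folded c2_def]
  let ?c = "\<lambda>s. (c1 s, c2 s)"
  have "(?c has_vector_derivative (fst v, snd v)) (at 0)"
    by (rule has_vector_derivative_Pair[OF c1(3) c2(3)])
  then have c': "(?c has_derivative (\<lambda>s. s *\<^sub>R v)) (at 0)" by (simp add: has_vector_derivative_def)
  then have "isCont ?c 0" by (rule has_derivative_continuous)
  then have "(?c \<longlongrightarrow> ?c 0) (at 0)" by (simp add: isCont_def)
  then have "\<forall>\<^sub>F s in at 0. ?c s \<in> T"
    by (rule topological_tendstoD) (use T W c1(2) c2(2) in auto)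
  then have "\<forall>\<^sub>F s in nhds 0. ?c s \<in> T"
    using T W c1(2) c2(2) by (simp add: eventually_nhds_conv_at)
  then obtain N where N: "open N" "0 \<in> N" "\<And>s. s \<in> N \<Longrightarrow> ?c s \<in> T" unfolding eventually_nhds by blast
  have sub: "?c ` N \<subseteq> W" using N(3) T c1(1) c2(1) by (auto simp: M_def)
  have "((f \<circ> ?c) has_derivative (g \<circ> (\<lambda>s. s *\<^sub>R v))) (at 0)" if "(f has_derivative g) (at p within W)" for g
  proof -
    have "(f has_derivative g) (at (?c 0) within ?c ` N)"
      using has_derivative_subset[OF that sub] c1(2) c2(2) by simp
    from diff_chain_within[OF has_derivative_at_withinI[OF c'] this] show ?thesis
      by (simp only: at_within_open[OF N(2,1)])
  qed
  from has_derivative_unique[OF this[OF assms(4)] this[OF assms(5)]]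
  have "(df \<circ> (\<lambda>s. s *\<^sub>R v)) 1 = (df' \<circ> (\<lambda>s. s *\<^sub>R v)) 1" by simp
  then show ?thesis by simp
qed

lemma continuous_on_F: "continuous_on A (F R1 R2 t)"
  using F_has_derivative has_derivative_continuous by (blast intro: continuous_at_imp_continuous_on)

lemma openin_F_preimage:
  assumes "open B" shows "openin (top_of_set M) {p \<in> M. F R1 R2 t p \<in> B}"
proof -
  have "{p \<in> M. F R1 R2 t p \<in> B} = M \<inter> F R1 R2 t -` B" by auto
  then show ?thesis using continuous_openin_preimage_gen[OF continuous_on_F assms] by metis
qed

lemma is_hamiltonian_vector_iff:
  assumes R: "R1 \<noteq> 0" "R2 \<noteq> 0" and B: "open B" and G: "smooth G B"
    and W: "W = {p \<in> M. F R1 R2 t p \<in> B}" and p: "p \<in> W"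
  shows "is_hamiltonian_vector R1 R2 W (\<lambda>p. G (F R1 R2 t p)) p X \<longleftrightarrow>
    X = partial_l G (F R1 R2 t p) *\<^sub>R L_field p + partial_j G (F R1 R2 t p) *\<^sub>R H_field R1 R2 t p"
proof -
  define \<alpha> \<beta> where "\<alpha> = partial_l G (F R1 R2 t p)" and "\<beta> = partial_j G (F R1 R2 t p)"
  define df where "df v = \<alpha> * dL R1 R2 v + \<beta> * dH t p v" for v
  have pM: "p \<in> M" "F R1 R2 t p \<in> B" using p W by auto
  have "((\<lambda>p. G (F R1 R2 t p)) has_derivative df) (at p)"
    using has_derivative_compose[OF F_has_derivative smooth_has_derivative_partials(1)[OF G pM(2)]]
    unfolding df_def \<alpha>_def \<beta>_def by simp
  then have df: "((\<lambda>p. G (F R1 R2 t p)) has_derivative df) (at p within W)"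
    by (rule has_derivative_at_withinI)
  have om: "omega R1 R2 p (\<alpha> *\<^sub>R L_field p + \<beta> *\<^sub>R H_field R1 R2 t p) v = - df v" if "v \<in> tangent p" for v
    unfolding df_def using omega_fields[OF pM(1) that R] .
  show ?thesis unfolding \<alpha>_def[symmetric] \<beta>_def[symmetric]
  proof
    assume "is_hamiltonian_vector R1 R2 W (\<lambda>p. G (F R1 R2 t p)) p X"
    then obtain df' where X: "X \<in> tangent p" "((\<lambda>p. G (F R1 R2 t p)) has_derivative df') (at p within W)"
      "\<forall>v\<in>tangent p. omega R1 R2 p X v = - df' v" unfolding is_hamiltonian_vector_def by blast
    have oW: "openin (top_of_set M) W" unfolding W by (rule openin_F_preimage[OF B])
    show "X = \<alpha> *\<^sub>R L_field p + \<beta> *\<^sub>R H_field R1 R2 t p"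
    proof (rule omega_nondegenerate[OF pM(1) X(1) fields_tangent R])
      fix v assume v: "v \<in> tangent p"
      show "omega R1 R2 p X v = omega R1 R2 p (\<alpha> *\<^sub>R L_field p + \<beta> *\<^sub>R H_field R1 R2 t p) v"
        using om[OF v] X(3) v derivative_within_M_unique[OF oW p v X(2) df] by simp
    qed
  next
    assume "X = \<alpha> *\<^sub>R L_field p + \<beta> *\<^sub>R H_field R1 R2 t p"
    then show "is_hamiltonian_vector R1 R2 W (\<lambda>p. G (F R1 R2 t p)) p X"
      unfolding is_hamiltonian_vector_def using fields_tangent df om by blast
  qed
qed


section \<open>Return times in terms of the pair (L, H)\<close>

definition is_curve :: "(point \<Rightarrow> point) \<Rightarrow> (real \<Rightarrow> point) \<Rightarrow> bool" where
  "is_curve X \<gamma> \<longleftrightarrow> (\<forall>s. \<gamma> s \<in> M \<and> (\<gamma> has_vector_derivative X (\<gamma> s)) (at s))"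

lemma rot_has_vector_derivative:
  assumes "(\<gamma> has_vector_derivative \<gamma>') (at s)"
  shows "((\<lambda>s. rot (c * s) (\<gamma> s)) has_vector_derivative rot (c * s) (\<gamma>' + c *\<^sub>R L_field (\<gamma> s))) (at s)"
proof -
  note L = bounded_linear.has_vector_derivative[OF bounded_linear_L_field]
  have "((\<lambda>s. sin (c * s)) has_real_derivative c * cos (c * s)) (at s)"
    "((\<lambda>s. 1 - cos (c * s)) has_real_derivative c * sin (c * s)) (at s)"
    by (auto intro!: derivative_eq_intros)
  note d = this
  have "((\<lambda>s. \<gamma> s + sin (c * s) *\<^sub>R L_field (\<gamma> s) + (1 - cos (c * s)) *\<^sub>R L_field (L_field (\<gamma> s)))
    has_vector_derivative
    \<gamma>' + (sin (c * s) *\<^sub>R L_field \<gamma>' + (c * cos (c * s)) *\<^sub>R L_field (\<gamma> s))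
      + ((1 - cos (c * s)) *\<^sub>R L_field (L_field \<gamma>') + (c * sin (c * s)) *\<^sub>R L_field (L_field (\<gamma> s)))) (at s)"
    by (intro has_vector_derivative_add assms has_vector_derivative_scaleR d L)
  then show ?thesis
    using linear_L_field unfolding rot_def
    by (simp add: linear_add linear_scale L_field_cube algebra_simps)
qed

lemma is_curve_scale:
  assumes "is_curve X \<gamma>" shows "is_curve (\<lambda>p. k *\<^sub>R X p) (\<lambda>s. \<gamma> (k * s))"
  unfolding is_curve_def
proof (intro allI conjI)
  fix s
  show "\<gamma> (k * s) \<in> M" using assms by (simp add: is_curve_def)
  have "((\<lambda>s. k * s) has_vector_derivative k) (at s)"
    by (auto intro!: derivative_eq_intros)
  from vector_diff_chain_at[OF this, of \<gamma> "X (\<gamma> (k * s))"] assms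
  show "((\<lambda>s. \<gamma> (k * s)) has_vector_derivative k *\<^sub>R X (\<gamma> (k * s))) (at s)"
    by (simp add: is_curve_def o_def)
qed

text \<open>Superposing a steady rotation on the curves of a rotation invariant vector field adds a multiple of the
vector field of \<open>L\<close>.\<close>

lemma is_curve_rot:
  assumes "is_curve X \<gamma>" and "\<And>\<theta> p. X (rot \<theta> p) = rot \<theta> (X p)"
  shows "is_curve (\<lambda>p. c *\<^sub>R L_field p + X p) (\<lambda>s. rot (c * s) (\<gamma> s))"
  unfolding is_curve_def
proof (intro allI conjI)
  fix s
  show "rot (c * s) (\<gamma> s) \<in> M" using assms by (simp add: is_curve_def rot_in_M)
  have "(\<gamma> has_vector_derivative X (\<gamma> s)) (at s)" using assms(1) by (simp add: is_curve_def)
  from rot_has_vector_derivative[OF this, of c]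
  show "((\<lambda>s. rot (c * s) (\<gamma> s)) has_vector_derivative c *\<^sub>R L_field (rot (c * s) (\<gamma> s)) + X (rot (c * s) (\<gamma> s))) (at s)"
    by (simp add: assms(2) L_field_rot linear_add[OF linear_rot] linear_scale[OF linear_rot] add.commute)
qed

abbreviation "H_curve R1 R2 t \<equiv> is_curve (H_field R1 R2 t)"

lemma curve_of_H_curve:
  assumes "H_curve R1 R2 t \<eta>"
  shows "is_curve (\<lambda>p. \<alpha> *\<^sub>R L_field p + \<beta> *\<^sub>R H_field R1 R2 t p) (\<lambda>s. rot (\<alpha> * s) (\<eta> (\<beta> * s)))"
  by (intro is_curve_rot is_curve_scale assms) (simp add: H_field_rot linear_scale[OF linear_rot])

text \<open>Conversely to \<open>curve_of_H_curve\<close>: undoing the rotation and the change of time recovers a curve of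
\<open>H\<close>. The two lemmas transfer existence of curves in both directions.\<close>

lemma H_curve_of_curve:
  assumes "is_curve (\<lambda>p. \<alpha> *\<^sub>R L_field p + \<beta> *\<^sub>R H_field R1 R2 t p) \<gamma>" and "\<beta> \<noteq> 0"
  obtains \<eta> where "H_curve R1 R2 t \<eta>" "\<eta> 0 = \<gamma> 0" "\<And>s. \<gamma> s = rot (\<alpha> * s) (\<eta> (\<beta> * s))"
proof
  let ?\<eta> = "\<lambda>s. rot (- (\<alpha> / \<beta>) * s) (\<gamma> (1 / \<beta> * s))"
  have "is_curve (\<lambda>p. - (\<alpha> / \<beta>) *\<^sub>R L_field p + (1 / \<beta>) *\<^sub>R (\<alpha> *\<^sub>R L_field p + \<beta> *\<^sub>R H_field R1 R2 t p)) ?\<eta>"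
    by (intro is_curve_rot is_curve_scale assms)
      (simp add: H_field_rot L_field_rot linear_scale[OF linear_rot] linear_add[OF linear_rot])
  moreover have "(\<lambda>p. - (\<alpha> / \<beta>) *\<^sub>R L_field p + (1 / \<beta>) *\<^sub>R (\<alpha> *\<^sub>R L_field p + \<beta> *\<^sub>R H_field R1 R2 t p)) = H_field R1 R2 t"
    using assms(2) by (auto simp: fun_eq_iff scaleR_add_right)
  ultimately show "H_curve R1 R2 t ?\<eta>" by simp
  show "?\<eta> 0 = \<gamma> 0" by simp
  show "\<gamma> s = rot (\<alpha> * s) (?\<eta> (\<beta> * s))" for s using assms(2) by (simp add: rot_rot)
qed

lemma F_constant_along:
  assumes R: "R1 \<noteq> 0" "R2 \<noteq> 0"
    and "\<And>s. (\<gamma> has_vector_derivative (\<alpha> s *\<^sub>R L_field (\<gamma> s) + \<beta> s *\<^sub>R H_field R1 R2 t (\<gamma> s))) (at s)"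
  shows "F R1 R2 t (\<gamma> s) = F R1 R2 t (\<gamma> 0)"
proof -
  have "((\<lambda>s. F R1 R2 t (\<gamma> s)) has_vector_derivative 0) (at s)" for s
  proof -
    define X where "X = \<alpha> s *\<^sub>R L_field (\<gamma> s) + \<beta> s *\<^sub>R H_field R1 R2 t (\<gamma> s)"
    have lin: "linear (\<lambda>v. (dL R1 R2 v, dH t (\<gamma> s) v))"
      by (rule has_derivative_linear[OF F_has_derivative])
    have "(dL R1 R2 X, dH t (\<gamma> s) X) = 0"
      unfolding X_def using linear_add[OF lin] linear_scale[OF lin] F_derivative_fields[OF R, where p="\<gamma> s"]
      by (simp add: zero_prod_def)
    then have "(\<lambda>h. (dL R1 R2 (h *\<^sub>R X), dH t (\<gamma> s) (h *\<^sub>R X))) = (\<lambda>h. h *\<^sub>R 0)"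
      using linear_scale[OF lin] by (simp add: zero_prod_def)
    then show ?thesis
      using has_derivative_compose[OF assms(3)[of s, folded X_def, unfolded has_vector_derivative_def] F_has_derivative[where p="\<gamma> s" and ?R1.0=R1 and ?R2.0=R2 and t=t]]
      unfolding has_vector_derivative_def by simp
  qed
  then obtain c where "\<And>s. F R1 R2 t (\<gamma> s) = c"
    using has_vector_derivative_zero_constant[of UNIV "\<lambda>s. F R1 R2 t (\<gamma> s)"] by auto
  then show ?thesis by simp
qed

text \<open>Since \<open>L\<close> and \<open>H\<close> Poisson commute, the curve stays on a fibre of \<open>F\<close>, where the two coefficients
of the vector field are constant.\<close>

lemma is_integral_curve_iff:
  assumes R: "R1 \<noteq> 0" "R2 \<noteq> 0" and B: "open B" and G: "smooth G B"
    and W: "W = {p \<in> M. F R1 R2 t p \<in> B}" and a: "\<gamma> 0 \<in> W"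
  shows "is_integral_curve R1 R2 W (\<lambda>p. G (F R1 R2 t p)) \<gamma> \<longleftrightarrow>
    is_curve (\<lambda>p. partial_l G (F R1 R2 t (\<gamma> 0)) *\<^sub>R L_field p + partial_j G (F R1 R2 t (\<gamma> 0)) *\<^sub>R H_field R1 R2 t p) \<gamma>"
    (is "?I \<longleftrightarrow> ?C")
proof -
  note ham = is_hamiltonian_vector_iff[OF R B G W]
  show ?thesis
  proof
    assume I: ?I
    then have sW: "\<gamma> s \<in> W" for s by (simp add: is_integral_curve_def)
    have der: "(\<gamma> has_vector_derivative (partial_l G (F R1 R2 t (\<gamma> s)) *\<^sub>R L_field (\<gamma> s)
        + partial_j G (F R1 R2 t (\<gamma> s)) *\<^sub>R H_field R1 R2 t (\<gamma> s))) (at s)" for s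
    proof -
      have "\<exists>X. is_hamiltonian_vector R1 R2 W (\<lambda>p. G (F R1 R2 t p)) (\<gamma> s) X \<and> (\<gamma> has_vector_derivative X) (at s)"
        using I unfolding is_integral_curve_def by blast
      then obtain X where "is_hamiltonian_vector R1 R2 W (\<lambda>p. G (F R1 R2 t p)) (\<gamma> s) X" "(\<gamma> has_vector_derivative X) (at s)"
        by (elim exE conjE)
      then show ?thesis using ham[OF sW[of s]] by simp
    qed
    have F0: "F R1 R2 t (\<gamma> s) = F R1 R2 t (\<gamma> 0)" for s by (rule F_constant_along[OF R der])
    show ?C unfolding is_curve_def
    proof (intro allI conjI)
      fix s
      show "\<gamma> s \<in> M" using sW W by simp
      from der[of s] show "(\<gamma> has_vector_derivative (partial_l G (F R1 R2 t (\<gamma> 0)) *\<^sub>R L_field (\<gamma> s)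
        + partial_j G (F R1 R2 t (\<gamma> 0)) *\<^sub>R H_field R1 R2 t (\<gamma> s))) (at s)"
        unfolding F0[of s] .
    qed
  next
    assume C: ?C
    have F0: "F R1 R2 t (\<gamma> s) = F R1 R2 t (\<gamma> 0)" for s
      by (rule F_constant_along[OF R, where \<alpha>="\<lambda>_. partial_l G (F R1 R2 t (\<gamma> 0))" and \<beta>="\<lambda>_. partial_j G (F R1 R2 t (\<gamma> 0))"])
        (use C in \<open>simp add: is_curve_def\<close>)
    have sW: "\<gamma> s \<in> W" for s using C a F0[of s] unfolding is_curve_def W by simp
    show ?I unfolding is_integral_curve_def
    proof (intro allI conjI)
      fix s
      show "\<exists>X. is_hamiltonian_vector R1 R2 W (\<lambda>p. G (F R1 R2 t p)) (\<gamma> s) X \<and> (\<gamma> has_vector_derivative X) (at s)"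
        unfolding ham[OF sW] F0[of s] using C by (simp add: is_curve_def)
    qed (rule sW)
  qed
qed

lemma flows_to_iff:
  assumes R: "R1 \<noteq> 0" "R2 \<noteq> 0" and B: "open B" and G: "smooth G B"
    and W: "W = {p \<in> M. F R1 R2 t p \<in> B}" and a: "a \<in> W"
    and \<beta>: "partial_j G (F R1 R2 t a) \<noteq> 0"
  shows "flows_to R1 R2 W (\<lambda>p. G (F R1 R2 t p)) s a b \<longleftrightarrow>
    (\<exists>\<eta>. H_curve R1 R2 t \<eta> \<and> \<eta> 0 = a \<and>
      b = rot (partial_l G (F R1 R2 t a) * s) (\<eta> (partial_j G (F R1 R2 t a) * s)))"
proof -
  let ?\<alpha> = "partial_l G (F R1 R2 t a)" and ?\<beta> = "partial_j G (F R1 R2 t a)"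
  note iff = is_integral_curve_iff[OF R B G W]
  show ?thesis
  proof
    assume "flows_to R1 R2 W (\<lambda>p. G (F R1 R2 t p)) s a b"
    then obtain \<gamma> where g: "is_integral_curve R1 R2 W (\<lambda>p. G (F R1 R2 t p)) \<gamma>" "\<gamma> 0 = a" "\<gamma> s = b"
      unfolding flows_to_def by blast
    then have "is_curve (\<lambda>p. ?\<alpha> *\<^sub>R L_field p + ?\<beta> *\<^sub>R H_field R1 R2 t p) \<gamma>"
      using iff[of \<gamma>] a by simp
    from H_curve_of_curve[OF this \<beta>] obtain \<eta> where
      "H_curve R1 R2 t \<eta>" "\<eta> 0 = \<gamma> 0" "\<And>s. \<gamma> s = rot (?\<alpha> * s) (\<eta> (?\<beta> * s))" by metis
    then show "\<exists>\<eta>. H_curve R1 R2 t \<eta> \<and> \<eta> 0 = a \<and> b = rot (?\<alpha> * s) (\<eta> (?\<beta> * s))"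
      using g by metis
  next
    assume "\<exists>\<eta>. H_curve R1 R2 t \<eta> \<and> \<eta> 0 = a \<and> b = rot (?\<alpha> * s) (\<eta> (?\<beta> * s))"
    then obtain \<eta> where h: "H_curve R1 R2 t \<eta>" "\<eta> 0 = a" "b = rot (?\<alpha> * s) (\<eta> (?\<beta> * s))" by blast
    let ?\<gamma> = "\<lambda>s. rot (?\<alpha> * s) (\<eta> (?\<beta> * s))"
    have 0: "?\<gamma> 0 = a" using h(2) by simp
    have "is_integral_curve R1 R2 W (\<lambda>p. G (F R1 R2 t p)) ?\<gamma>"
      using iff[of ?\<gamma>] a curve_of_H_curve[OF h(1), of ?\<alpha> ?\<beta>] unfolding 0 by simp
    then show "flows_to R1 R2 W (\<lambda>p. G (F R1 R2 t p)) s a b"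
      unfolding flows_to_def using 0 h(3) by blast
  qed
qed

lemma L_curve_eq_rot:
  assumes "is_curve L_field \<gamma>" shows "\<gamma> s = rot s (\<gamma> 0)"
proof -
  have "((\<lambda>s. rot (- 1 * s) (\<gamma> s)) has_vector_derivative 0) (at s)" for s
  proof -
    have "(\<gamma> has_vector_derivative L_field (\<gamma> s)) (at s)" using assms by (simp add: is_curve_def)
    from rot_has_vector_derivative[OF this, of "- 1"] show ?thesis
      using linear_0[OF linear_rot] by simp
  qed
  then obtain c where c: "\<And>s. rot (- 1 * s) (\<gamma> s) = c"
    using has_vector_derivative_zero_constant[of UNIV "\<lambda>s. rot (- 1 * s) (\<gamma> s)"] by auto
  then have "rot s (rot (- 1 * s) (\<gamma> s)) = rot s (\<gamma> 0)" using c[of 0] by simp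
  then show ?thesis by (simp add: rot_rot)
qed

lemma L_flows_to_iff:
  assumes R: "R1 \<noteq> 0" "R2 \<noteq> 0" and B: "open B" and G: "smooth G B" "\<And>b. b \<in> B \<Longrightarrow> G b = fst b"
    and W: "W = {p \<in> M. F R1 R2 t p \<in> B}" and a: "a \<in> W"
  shows "flows_to R1 R2 W (\<lambda>p. G (F R1 R2 t p)) s a b \<longleftrightarrow> b = rot s a"
proof -
  have Fa: "F R1 R2 t a \<in> B" using a W by simp
  have "((\<lambda>b::real \<times> real. fst b) has_derivative (\<lambda>v. 1 * fst v + 0 * snd v)) (at w)" for w
    by (auto intro!: derivative_eq_intros)
  note p = has_derivative_imp_partial[OF this]
  have G': "partial_l G (F R1 R2 t a) = 1" "partial_j G (F R1 R2 t a) = 0"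
    using partial_cong[OF B Fa G(2)] p[of "F R1 R2 t a"] by auto
  note iff = is_integral_curve_iff[OF R B G(1) W]
  show ?thesis
  proof
    assume "flows_to R1 R2 W (\<lambda>p. G (F R1 R2 t p)) s a b"
    then obtain \<gamma> where g: "is_integral_curve R1 R2 W (\<lambda>p. G (F R1 R2 t p)) \<gamma>" "\<gamma> 0 = a" "\<gamma> s = b"
      unfolding flows_to_def by blast
    then have "is_curve L_field \<gamma>" using iff[of \<gamma>] a G' by simp
    then show "b = rot s a" using L_curve_eq_rot g by metis
  next
    assume b: "b = rot s a"
    have aM: "a \<in> M" using a W by simp
    have "is_curve (\<lambda>p. 1 *\<^sub>R L_field p + 0) (\<lambda>s. rot (1 * s) a)"
      by (rule is_curve_rot[where X="\<lambda>p. 0"]) (use aM linear_0[OF linear_rot] in \<open>auto simp: is_curve_def\<close>)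
    then have "is_integral_curve R1 R2 W (\<lambda>p. G (F R1 R2 t p)) (\<lambda>s. rot s a)"
      using iff[of "\<lambda>s. rot s a"] a G' by simp
    then show "flows_to R1 R2 W (\<lambda>p. G (F R1 R2 t p)) s a b"
      unfolding flows_to_def using b by (intro exI[of _ "\<lambda>s. rot s a"]) simp
  qed
qed

text \<open>The return times for the functions \<open>L\<close> and \<open>H\<close> themselves: after time \<open>\<theta>2\<close> along \<open>H\<close> the curve meets the
rotation orbit of \<open>a\<close> for the first time, and the rotation by \<open>\<theta>1\<close> leads back to \<open>a\<close>. They depend on the
system alone and serve to compare different normal forms.\<close>

definition H_return :: "real \<Rightarrow> real \<Rightarrow> real \<Rightarrow> point \<Rightarrow> real \<Rightarrow> real \<Rightarrow> bool" where
  "H_return R1 R2 t a \<theta>1 \<theta>2 \<longleftrightarrow> 0 < \<theta>2 \<and>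
    (\<exists>\<eta>. H_curve R1 R2 t \<eta> \<and> \<eta> 0 = a \<and> rot \<theta>1 (\<eta> \<theta>2) = a) \<and>
    (\<forall>\<eta> s x. H_curve R1 R2 t \<eta> \<and> \<eta> 0 = a \<and> 0 < s \<and> s < \<theta>2 \<longrightarrow> rot x (\<eta> s) \<noteq> a)"

text \<open>If the vector field of \<open>G2 (L, H)\<close> is \<open>\<alpha> * X\<^sub>L + \<beta> * X\<^sub>H\<close> on the fibre through \<open>a\<close>, its flow for time \<open>T2\<close> is the flow
of \<open>H\<close> for time \<open>\<beta> * T2\<close> followed by a rotation by \<open>\<alpha> * T2\<close>. The sign of \<open>\<beta>\<close> guarantees that the
order of the return times is preserved.\<close>

lemma are_return_times_imp_H_return:
  assumes R: "R1 \<noteq> 0" "R2 \<noteq> 0" and B: "open B" and G1: "smooth G1 B" "\<And>b. b \<in> B \<Longrightarrow> G1 b = fst b"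
    and G2: "smooth G2 B" "0 < partial_j G2 (F R1 R2 t a)"
    and W: "W = {p \<in> M. F R1 R2 t p \<in> B}" and a: "a \<in> W"
    and ret: "are_return_times R1 R2 W (\<lambda>p. G1 (F R1 R2 t p)) (\<lambda>p. G2 (F R1 R2 t p)) a T1 T2"
  shows "H_return R1 R2 t a (T1 + partial_l G2 (F R1 R2 t a) * T2) (partial_j G2 (F R1 R2 t a) * T2)"
proof -
  let ?\<alpha> = "partial_l G2 (F R1 R2 t a)" and ?\<beta> = "partial_j G2 (F R1 R2 t a)"
  have \<beta>: "?\<beta> \<noteq> 0" using G2(2) by simp
  have f1: "flows_to R1 R2 W (\<lambda>p. G1 (F R1 R2 t p)) s a b \<longleftrightarrow> b = rot s a" if "a \<in> W" for s a b
    by (rule L_flows_to_iff[OF R B G1(1) _ W that]) (rule G1(2))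
  note f2 = flows_to_iff[OF R B G2(1) W a \<beta>]
  have T2: "0 < T2" using ret by (simp add: are_return_times_def)
  obtain b where b: "flows_to R1 R2 W (\<lambda>p. G2 (F R1 R2 t p)) T2 a b"
    "b \<in> flow_orbit R1 R2 W (\<lambda>p. G1 (F R1 R2 t p)) a" "flows_to R1 R2 W (\<lambda>p. G1 (F R1 R2 t p)) T1 b a"
    using ret unfolding are_return_times_def by blast
  have orb: "c \<in> flow_orbit R1 R2 W (\<lambda>p. G1 (F R1 R2 t p)) a \<longleftrightarrow> (\<exists>s. c = rot s a)" for c
    using f1[OF a] by (simp add: flow_orbit_def)
  obtain s where s: "b = rot s a" using b(2) orb by blast
  have "b \<in> W" using a s rot_in_M F_rot by (simp add: W)
  then have ab: "a = rot T1 b" using f1 b(3) by blast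
  show ?thesis unfolding H_return_def
  proof (intro conjI allI impI)
    show "0 < ?\<beta> * T2" using T2 G2(2) by simp
    obtain \<eta> where \<eta>: "H_curve R1 R2 t \<eta>" "\<eta> 0 = a" "b = rot (?\<alpha> * T2) (\<eta> (?\<beta> * T2))"
      using b(1) f2 by blast
    then have "rot (T1 + ?\<alpha> * T2) (\<eta> (?\<beta> * T2)) = rot T1 b" by (simp add: rot_rot)
    then have "rot (T1 + ?\<alpha> * T2) (\<eta> (?\<beta> * T2)) = a" by (simp only: ab[symmetric])
    then show "\<exists>\<eta>. H_curve R1 R2 t \<eta> \<and> \<eta> 0 = a \<and> rot (T1 + ?\<alpha> * T2) (\<eta> (?\<beta> * T2)) = a"
      using \<eta> by blast
  next
    fix \<eta> s x assume h: "H_curve R1 R2 t \<eta> \<and> \<eta> 0 = a \<and> 0 < s \<and> s < ?\<beta> * T2"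
    show "rot x (\<eta> s) \<noteq> a"
    proof
      assume x: "rot x (\<eta> s) = a"
      let ?s = "s / ?\<beta>"
      have "flows_to R1 R2 W (\<lambda>p. G2 (F R1 R2 t p)) ?s a (rot (?\<alpha> * ?s) (\<eta> s))"
        unfolding f2 using h \<beta> by (intro exI[of _ \<eta>]) simp
      moreover have "rot (?\<alpha> * ?s) (\<eta> s) = rot (?\<alpha> * ?s - x) a"
        unfolding x[symmetric] by (simp add: rot_rot)
      moreover have "0 < ?s" "?s < T2" using h G2(2) by (simp_all add: divide_less_eq mult.commute)
      ultimately show False using ret orb unfolding are_return_times_def by blast
    qed
  qed
qed

lemma norm_cross3_le: "norm (cross3 x y) \<le> norm x * norm y"
proof -
  have "(norm (cross3 x y))\<^sup>2 \<le> (norm x * norm y)\<^sup>2"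
    using norm_cross_dot[of x y] by (smt (verit) zero_le_power2)
  then show ?thesis by (rule power2_le_imp_le) simp
qed

lemma norm_e3: "norm e3 = 1"
  by (simp add: e3_def norm_eq_sqrt_inner inner_vec_def sum_3)

lemma H_field_lipschitz:
  assumes "p \<in> M" "q \<in> M"
  shows "norm (H_field R1 R2 t p - H_field R1 R2 t q)
    \<le> (\<bar>1 / R1\<bar> * (\<bar>1 - t\<bar> + 2 * \<bar>t\<bar>) + \<bar>t / R2\<bar> * 2) * norm (p - q)"
proof -
  have n: "norm (fst p) = 1" "norm (snd p) = 1" "norm (fst q) = 1" "norm (snd q) = 1"
    using assms by (auto simp: M_def)
  have d: "norm (fst p - fst q) \<le> norm (p - q)" "norm (snd p - snd q) \<le> norm (p - q)"
    using norm_fst_le[of "fst p - fst q" "snd p - snd q"] norm_snd_le[of "snd p - snd q" "fst p - fst q"]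
    by (simp_all add: minus_prod_def)
  have cr: "norm (cross3 x y - cross3 x' y') \<le> 2 * norm (p - q)"
    if "norm y = 1" "norm x' = 1" "norm (x - x') \<le> norm (p - q)" "norm (y - y') \<le> norm (p - q)" for x y x' y'
  proof -
    have "cross3 x y - cross3 x' y' = cross3 (x - x') y + cross3 x' (y - y')"
      by (simp add: Cross3.left_diff_distrib Cross3.right_diff_distrib)
    then have "norm (cross3 x y - cross3 x' y') \<le> norm (cross3 (x - x') y) + norm (cross3 x' (y - y'))"
      by (simp only: norm_triangle_ineq)
    also have "\<dots> \<le> norm (x - x') * norm y + norm x' * norm (y - y')"
      by (intro add_mono norm_cross3_le)
    finally show ?thesis using that by simp
  qed
  have "fst (H_field R1 R2 t p) = (1 / R1) *\<^sub>R ((1 - t) *\<^sub>R cross3 e3 (fst p) + t *\<^sub>R cross3 (snd p) (fst p))" for p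
    by (simp add: H_field_def cross_add_left cross_mult_left)
  then have "fst (H_field R1 R2 t p - H_field R1 R2 t q) = (1 / R1) *\<^sub>R
    ((1 - t) *\<^sub>R cross3 e3 (fst p - fst q) + t *\<^sub>R (cross3 (snd p) (fst p) - cross3 (snd q) (fst q)))"
    by (simp add: Cross3.right_diff_distrib scaleR_right_diff_distrib scaleR_add_right)
  then have "norm (fst (H_field R1 R2 t p - H_field R1 R2 t q)) = \<bar>1 / R1\<bar> * norm
    ((1 - t) *\<^sub>R cross3 e3 (fst p - fst q) + t *\<^sub>R (cross3 (snd p) (fst p) - cross3 (snd q) (fst q)))"
    by simp
  also have "\<dots> \<le> \<bar>1 / R1\<bar> * (\<bar>1 - t\<bar> * norm (p - q) + \<bar>t\<bar> * (2 * norm (p - q)))"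
  proof (intro mult_left_mono norm_triangle_le add_mono)
    have "norm (cross3 e3 (fst p - fst q)) \<le> norm (p - q)"
      using norm_cross3_le[of e3 "fst p - fst q"] d norm_e3 by simp
    then show "norm ((1 - t) *\<^sub>R cross3 e3 (fst p - fst q)) \<le> \<bar>1 - t\<bar> * norm (p - q)"
      by (simp add: mult_left_mono)
    show "norm (t *\<^sub>R (cross3 (snd p) (fst p) - cross3 (snd q) (fst q))) \<le> \<bar>t\<bar> * (2 * norm (p - q))"
      using cr[OF n(1,4) d(2,1)] by (simp add: mult_left_mono)
  qed auto
  finally have 1: "norm (fst (H_field R1 R2 t p - H_field R1 R2 t q)) \<le> \<bar>1 / R1\<bar> * (\<bar>1 - t\<bar> + 2 * \<bar>t\<bar>) * norm (p - q)"
    by (simp add: algebra_simps)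
  have "snd (H_field R1 R2 t p - H_field R1 R2 t q) = (t / R2) *\<^sub>R (cross3 (fst p) (snd p) - cross3 (fst q) (snd q))"
    by (simp add: H_field_def algebra_simps)
  then have "norm (snd (H_field R1 R2 t p - H_field R1 R2 t q)) = \<bar>t / R2\<bar> * norm (cross3 (fst p) (snd p) - cross3 (fst q) (snd q))"
    by simp
  also have "\<dots> \<le> \<bar>t / R2\<bar> * (2 * norm (p - q))"
    by (intro mult_left_mono cr n d) auto
  finally have 2: "norm (snd (H_field R1 R2 t p - H_field R1 R2 t q)) \<le> \<bar>t / R2\<bar> * 2 * norm (p - q)"
    by (simp add: algebra_simps)
  have "norm (H_field R1 R2 t p - H_field R1 R2 t q) \<le>
    norm (fst (H_field R1 R2 t p - H_field R1 R2 t q)) + norm (snd (H_field R1 R2 t p - H_field R1 R2 t q))"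
    by (metis prod.collapse norm_Pair_le)
  then show ?thesis using 1 2 by (simp add: distrib_right)
qed

text \<open>Gronwall's argument: the squared distance of the two curves, damped by \<open>exp (- 2 * K * s)\<close> with a
Lipschitz constant \<open>K\<close> of the vector field on \<open>M\<close>, is nonincreasing and starts at \<open>0\<close>.\<close>

lemma H_curve_unique:
  assumes c: "H_curve R1 R2 t \<eta>" "H_curve R1 R2 t \<eta>'" "\<eta> 0 = \<eta>' 0" and "0 \<le> s"
  shows "\<eta> s = \<eta>' s"
proof -
  define K where "K = \<bar>1 / R1\<bar> * (\<bar>1 - t\<bar> + 2 * \<bar>t\<bar>) + \<bar>t / R2\<bar> * 2"
  define d where "d s = (\<eta> s - \<eta>' s) \<bullet> (\<eta> s - \<eta>' s)" for s
  define d' where "d' s = 2 * ((\<eta> s - \<eta>' s) \<bullet> (H_field R1 R2 t (\<eta> s) - H_field R1 R2 t (\<eta>' s)))" for s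
  have M: "\<eta> s \<in> M" "\<eta>' s \<in> M" for s using c by (auto simp: is_curve_def)
  have d: "(d has_real_derivative d' s) (at s)" for s
  proof -
    have "((\<lambda>s. \<eta> s - \<eta>' s) has_vector_derivative (H_field R1 R2 t (\<eta> s) - H_field R1 R2 t (\<eta>' s))) (at s)"
      using c by (intro has_vector_derivative_diff) (auto simp: is_curve_def)
    from bounded_bilinear.has_vector_derivative[OF bounded_bilinear_inner this this]
    show ?thesis unfolding d_def d'_def has_real_derivative_iff_has_vector_derivative
      by (simp add: inner_commute)
  qed
  have dle: "d' s \<le> 2 * K * d s" for s
  proof -
    have "(\<eta> s - \<eta>' s) \<bullet> (H_field R1 R2 t (\<eta> s) - H_field R1 R2 t (\<eta>' s))
      \<le> norm (\<eta> s - \<eta>' s) * norm (H_field R1 R2 t (\<eta> s) - H_field R1 R2 t (\<eta>' s))"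
      by (rule norm_cauchy_schwarz)
    also have "\<dots> \<le> norm (\<eta> s - \<eta>' s) * (K * norm (\<eta> s - \<eta>' s))"
      unfolding K_def by (intro mult_left_mono H_field_lipschitz M) auto
    also have "\<dots> = K * d s" by (simp add: d_def dot_square_norm power2_eq_square)
    finally show ?thesis by (simp add: d'_def)
  qed
  define g where "g s = d s * exp (- 2 * K * s)" for s
  have "(g has_real_derivative (d' s - 2 * K * d s) * exp (- 2 * K * s)) (at s)" for s
    unfolding g_def by (rule derivative_eq_intros d refl)+ (simp add: algebra_simps)
  moreover have "(d' s - 2 * K * d s) * exp (- 2 * K * s) \<le> 0" for s
    using dle[of s] by (intro mult_nonpos_nonneg) auto
  ultimately have "g s \<le> g 0"
    using DERIV_nonpos_imp_nonincreasing[OF \<open>0 \<le> s\<close>, of g] by blast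
  then have "d s \<le> 0" using c(3) by (simp add: g_def d_def mult_le_0_iff)
  then have "d s = 0" using inner_ge_zero[of "\<eta> s - \<eta>' s"] by (simp add: d_def)
  then show ?thesis by (simp add: d_def)
qed


text \<open>A nontrivial rotation only fixes the four points with both components at poles. There \<open>L\<close> takes the
values \<open>0\<close>, \<open>2 * R2\<close>, \<open>- 2 * R1\<close> and \<open>2 * (R2 - R1)\<close>, which the bounds on \<open>L\<close> exclude.\<close>

lemma rot_eq_self_imp_2pi:
  assumes a: "a \<in> M" "rot \<theta> a = a" and R: "0 < R1" "R1 < R2"
    and L: "0 < L R1 R2 a" "L R1 R2 a < 2 * (R2 - R1)"
  obtains n :: int where "\<theta> = 2 * pi * of_int n"
proof -
  have "cos \<theta> = 1"
  proof (rule ccontr)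
    assume ne: "cos \<theta> \<noteq> 1"
    have *: "x = 0 \<and> y = 0" if "cos \<theta> * x - sin \<theta> * y = x" "sin \<theta> * x + cos \<theta> * y = y" for x y :: real
    proof -
      have "x * (cos \<theta> * x - sin \<theta> * y) + y * (sin \<theta> * x + cos \<theta> * y) = x * x + y * y" by (simp only: that)
      then have "(cos \<theta> - 1) * (x * x + y * y) = 0" by (simp add: algebra_simps)
      then show ?thesis using ne by (simp add: sum_squares_eq_zero_iff)
    qed
    have "fst a $ 1 = 0" "fst a $ 2 = 0" "snd a $ 1 = 0" "snd a $ 2 = 0"
      using *[of "fst a $ 1" "fst a $ 2"] *[of "snd a $ 1" "snd a $ 2"] a(2) rot_components[of \<theta> a] by simp_all
    then have "\<bar>fst a $ 3\<bar> = 1" "\<bar>snd a $ 3\<bar> = 1"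
      using a(1) by (auto simp: M_def mem_Times_iff norm_eq_sqrt_inner inner_vec_def sum_3)
    then have "fst a $ 3 = 1 \<or> fst a $ 3 = - 1" "snd a $ 3 = 1 \<or> snd a $ 3 = - 1"
      by linarith+
    then show False using L R by (auto simp: L_def algebra_simps)
  qed
  then obtain n :: int where "\<theta> = of_int n * 2 * pi" using cos_one_2pi_int by blast
  then show ?thesis using that[of n] by (simp add: mult_ac)
qed

lemma H_return_unique:
  assumes "H_return R1 R2 t a \<theta>1 \<theta>2" "H_return R1 R2 t a \<theta>1' \<theta>2'"
    and a: "a \<in> M" and R: "0 < R1" "R1 < R2" and L: "0 < L R1 R2 a" "L R1 R2 a < 2 * (R2 - R1)"
  obtains n :: int where "\<theta>2 = \<theta>2'" "\<theta>1 = \<theta>1' + 2 * pi * of_int n"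
proof -
  obtain \<eta> where \<eta>: "H_curve R1 R2 t \<eta>" "\<eta> 0 = a" "rot \<theta>1 (\<eta> \<theta>2) = a" and p: "0 < \<theta>2"
    and min: "\<And>\<eta> s x. H_curve R1 R2 t \<eta> \<Longrightarrow> \<eta> 0 = a \<Longrightarrow> 0 < s \<Longrightarrow> s < \<theta>2 \<Longrightarrow> rot x (\<eta> s) \<noteq> a"
    using assms(1) unfolding H_return_def by blast
  obtain \<eta>' where \<eta>': "H_curve R1 R2 t \<eta>'" "\<eta>' 0 = a" "rot \<theta>1' (\<eta>' \<theta>2') = a" and p': "0 < \<theta>2'"
    and min': "\<And>\<eta> s x. H_curve R1 R2 t \<eta> \<Longrightarrow> \<eta> 0 = a \<Longrightarrow> 0 < s \<Longrightarrow> s < \<theta>2' \<Longrightarrow> rot x (\<eta> s) \<noteq> a"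
    using assms(2) unfolding H_return_def by blast
  have eq: "\<theta>2 = \<theta>2'"
    using min[OF \<eta>'(1,2) p'] min'[OF \<eta>(1,2) p] \<eta>(3) \<eta>'(3) by (metis linorder_neqE)
  have "\<eta> \<theta>2 = \<eta>' \<theta>2'"
    unfolding eq by (rule H_curve_unique[OF \<eta>(1) \<eta>'(1)]) (use \<eta>(2) \<eta>'(2) p' in auto)
  then have "rot (\<theta>1 - \<theta>1') (rot \<theta>1' (\<eta>' \<theta>2')) = a" using \<eta>(3) by (simp add: rot_rot)
  then have "rot (\<theta>1 - \<theta>1') a = a" by (simp only: \<eta>'(3))
  then obtain n :: int where "\<theta>1 - \<theta>1' = 2 * pi * of_int n"
    using rot_eq_self_imp_2pi[OF a _ R L] by blast
  then show ?thesis using that[of n] eq by (simp add: algebra_simps)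
qed

section \<open>Exchanging the two spheres\<close>

text \<open>A rotation of the sphere that reverses the third coordinate. A rotation is needed, and not the
reflection at the equator, in order to preserve the area form.\<close>

definition half_turn :: "real^3 \<Rightarrow> real^3" where
  "half_turn x = vector [x $ 1, - (x $ 2), - (x $ 3)]"

definition swap_spheres :: "point \<Rightarrow> point" where
  "swap_spheres p = (half_turn (snd p), half_turn (fst p))"

lemma swap_spheres_components:
  "fst (swap_spheres p) $ 1 = snd p $ 1" "fst (swap_spheres p) $ 2 = - (snd p $ 2)" "fst (swap_spheres p) $ 3 = - (snd p $ 3)"
  "snd (swap_spheres p) $ 1 = fst p $ 1" "snd (swap_spheres p) $ 2 = - (fst p $ 2)" "snd (swap_spheres p) $ 3 = - (fst p $ 3)"
  by (simp_all add: swap_spheres_def half_turn_def)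

lemma swap_swap [simp]: "swap_spheres (swap_spheres p) = p"
proof (rule point_eqI)
  fix i :: 3
  show "fst (swap_spheres (swap_spheres p)) $ i = fst p $ i" "snd (swap_spheres (swap_spheres p)) $ i = snd p $ i"
    using exhaust_3[of i] by (auto simp: swap_spheres_components)
qed

lemma linear_swap: "linear swap_spheres"
proof (rule linearI; rule point_eqI)
  fix x y :: point and r :: real and i :: 3
  show "fst (swap_spheres (x + y)) $ i = fst (swap_spheres x + swap_spheres y) $ i"
    "snd (swap_spheres (x + y)) $ i = snd (swap_spheres x + swap_spheres y) $ i"
    "fst (swap_spheres (r *\<^sub>R x)) $ i = fst (r *\<^sub>R swap_spheres x) $ i"
    "snd (swap_spheres (r *\<^sub>R x)) $ i = snd (r *\<^sub>R swap_spheres x) $ i"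
    using exhaust_3[of i] by (auto simp: swap_spheres_components)
qed

lemma swap_in_M: "p \<in> M \<Longrightarrow> swap_spheres p \<in> M"
  by (auto simp: M_def mem_Times_iff norm_eq_sqrt_inner inner_vec_def sum_3 swap_spheres_components)

lemma rot_swap: "rot \<theta> (swap_spheres p) = swap_spheres (rot (- \<theta>) p)"
proof (rule point_eqI)
  fix i :: 3
  show "fst (rot \<theta> (swap_spheres p)) $ i = fst (swap_spheres (rot (- \<theta>) p)) $ i"
    "snd (rot \<theta> (swap_spheres p)) $ i = snd (swap_spheres (rot (- \<theta>) p)) $ i"
    using exhaust_3[of i] by (auto simp: swap_spheres_components rot_components)
qed

text \<open>The constants \<open>c\<close> and \<open>d\<close> are those for which \<open>H\<close> with parameter \<open>t'\<close> pulls back to \<open>c * H - d * L\<close>: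
the three equations compare the coefficients of the interaction term and of the two heights. They are
solvable precisely for the \<open>t'\<close> of the theorem (\<open>coupling_parameter_reflection\<close>).\<close>

context
  fixes R1 R2 t t' c d :: real
  assumes R: "R1 \<noteq> 0" "R2 \<noteq> 0"
    and ct: "c * t = t'" and dR2: "d * R2 = 1 - t'" and dR1: "d * R1 = c * (1 - t)" and c: "0 < c"
begin

lemma F_swap: "F R2 R1 t' (swap_spheres p) = (- L R1 R2 p, c * H t p - d * L R1 R2 p)"
proof -
  have "c * H t p - d * L R1 R2 p = c * (1 - t) * fst p $ 3 + (c * t) * (fst p $ 1 * snd p $ 1 + fst p $ 2 * snd p $ 2 + fst p $ 3 * snd p $ 3)
    + c * t - c * (1 - t) - ((d * R1) * (fst p $ 3 - 1) + (d * R2) * (snd p $ 3 + 1))"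
    by (simp add: H_def L_def algebra_simps)
  also have "\<dots> = H t' (swap_spheres p)"
    unfolding dR1 dR2 ct by (simp add: H_def swap_spheres_components algebra_simps)
  finally show ?thesis by (simp add: F_def L_def swap_spheres_components algebra_simps)
qed

lemma H_field_swap:
  "H_field R2 R1 t' (swap_spheres p) = swap_spheres ((- d) *\<^sub>R L_field p + c *\<^sub>R H_field R1 R2 t p)"
proof -
  have e1: "d = (1 - t') / R2" "d = c * (1 - t) / R1" using dR1 dR2 R by (simp_all add: field_simps)
  show ?thesis
  proof (rule point_eqI)
    fix i :: 3
    show "fst (H_field R2 R1 t' (swap_spheres p)) $ i = fst (swap_spheres ((- d) *\<^sub>R L_field p + c *\<^sub>R H_field R1 R2 t p)) $ i"
      using exhaust_3[of i] R unfolding ct[symmetric]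
      by (auto simp: swap_spheres_components L_field_components H_field_def cross3_def e3_def e1(1) field_simps ct)
    show "snd (H_field R2 R1 t' (swap_spheres p)) $ i = snd (swap_spheres ((- d) *\<^sub>R L_field p + c *\<^sub>R H_field R1 R2 t p)) $ i"
      using exhaust_3[of i] R
      by (auto simp: swap_spheres_components L_field_components H_field_def cross3_def e3_def e1(2) field_simps ct[symmetric])
  qed
qed

lemma swap_curve:
  assumes "is_curve X \<gamma>" "\<And>p. Y (swap_spheres p) = swap_spheres (X p)"
  shows "is_curve Y (\<lambda>s. swap_spheres (\<gamma> s))"
  unfolding is_curve_def
proof (intro allI conjI)
  fix s
  show "swap_spheres (\<gamma> s) \<in> M" using assms(1) by (simp add: is_curve_def swap_in_M)
  have "bounded_linear swap_spheres" using linear_swap linear_conv_bounded_linear by blast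
  from bounded_linear.has_vector_derivative[OF this, of \<gamma> "X (\<gamma> s)"]
  show "((\<lambda>s. swap_spheres (\<gamma> s)) has_vector_derivative Y (swap_spheres (\<gamma> s))) (at s)"
    using assms by (simp add: is_curve_def)
qed

text \<open>The exchange of spheres reverses rotations, and the curves of \<open>H\<close> for the second system correspond to
those of \<open>c * H - d * L\<close> for the first one, which are curves of \<open>H\<close> run at speed \<open>c\<close> and rotated at
speed \<open>- d\<close>.\<close>

lemma H_return_swap:
  assumes ret: "H_return R2 R1 t' (swap_spheres a) \<theta>1 \<theta>2"
  shows "H_return R1 R2 t a (- \<theta>1 - d * \<theta>2) (c * \<theta>2)"
proof -
  let ?X = "\<lambda>p. (- d) *\<^sub>R L_field p + c *\<^sub>R H_field R1 R2 t p"
  have Xs: "?X (swap_spheres p) = swap_spheres (H_field R2 R1 t' p)" for p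
    using H_field_swap[of "swap_spheres p"] by (metis swap_swap)
  obtain \<eta>' where \<eta>': "H_curve R2 R1 t' \<eta>'" "\<eta>' 0 = swap_spheres a" "rot \<theta>1 (\<eta>' \<theta>2) = swap_spheres a"
    and p: "0 < \<theta>2"
    and min: "\<And>\<eta> s x. H_curve R2 R1 t' \<eta> \<Longrightarrow> \<eta> 0 = swap_spheres a \<Longrightarrow> 0 < s \<Longrightarrow> s < \<theta>2 \<Longrightarrow> rot x (\<eta> s) \<noteq> swap_spheres a"
    using ret unfolding H_return_def by blast
  show ?thesis unfolding H_return_def
  proof (intro conjI allI impI)
    show "0 < c * \<theta>2" using p c by simp
    have cn: "c \<noteq> 0" using c by simp
    obtain \<eta> where \<eta>: "H_curve R1 R2 t \<eta>" "\<eta> 0 = swap_spheres (\<eta>' 0)"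
      "\<And>s. swap_spheres (\<eta>' s) = rot (- d * s) (\<eta> (c * s))"
      using H_curve_of_curve[OF swap_curve[OF \<eta>'(1), of ?X, OF Xs] cn] by metis
    have "rot (- \<theta>1 - d * \<theta>2) (\<eta> (c * \<theta>2)) = rot (- \<theta>1) (swap_spheres (\<eta>' \<theta>2))"
      by (simp add: \<eta>(3) rot_rot)
    also have "\<dots> = swap_spheres (rot \<theta>1 (\<eta>' \<theta>2))" by (simp add: rot_swap)
    finally have "rot (- \<theta>1 - d * \<theta>2) (\<eta> (c * \<theta>2)) = a" by (simp add: \<eta>'(3))
    then show "\<exists>\<eta>. H_curve R1 R2 t \<eta> \<and> \<eta> 0 = a \<and> rot (- \<theta>1 - d * \<theta>2) (\<eta> (c * \<theta>2)) = a"
      using \<eta> \<eta>'(2) by (intro exI[of _ \<eta>]) simp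
  next
    fix \<eta> s x assume h: "H_curve R1 R2 t \<eta> \<and> \<eta> 0 = a \<and> 0 < s \<and> s < c * \<theta>2"
    let ?\<zeta> = "\<lambda>s. swap_spheres (rot (- d * s) (\<eta> (c * s)))"
    have "H_curve R2 R1 t' ?\<zeta>"
      by (rule swap_curve[OF curve_of_H_curve H_field_swap]) (use h in blast)
    moreover have "?\<zeta> 0 = swap_spheres a" using h by simp
    moreover have "0 < s / c" "s / c < \<theta>2" using h c by (simp_all add: divide_less_eq mult.commute)
    ultimately have ne: "rot y (?\<zeta> (s / c)) \<noteq> swap_spheres a" for y using min by blast
    show "rot x (\<eta> s) \<noteq> a"
    proof
      assume x: "rot x (\<eta> s) = a"
      have "rot (- (x + d * s / c)) (?\<zeta> (s / c)) = swap_spheres (rot x (\<eta> s))"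
        using c by (simp add: rot_swap rot_rot)
      then show False using ne x by simp
    qed
  qed
qed

end

section \<open>Unfolding the Taylor series invariant\<close>

lemma taylor_coeff_primitive:
  assumes D: "open D" "(0, 0) \<in> D" and s: "smooth \<sigma>1 D" "smooth \<sigma>2 D"
    and S: "\<forall>w\<in>D. (S has_derivative (\<lambda>v. \<sigma>1 w * fst v + \<sigma>2 w * snd v)) (at w)"
  shows "taylor_coeff S 0 0 = S (0, 0)"
    "taylor_coeff S i (Suc k) = mixed_partial i k \<sigma>2 (0, 0) / (fact i * fact (Suc k))"
    "taylor_coeff S (Suc i) 0 = mixed_partial i 0 \<sigma>1 (0, 0) / fact (Suc i)"
proof -
  have p: "partial_l S w = \<sigma>1 w" "partial_j S w = \<sigma>2 w" if "w \<in> D" for w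
    using has_derivative_imp_partial[of S "\<sigma>1 w" "\<sigma>2 w" w] S that by blast+
  show "taylor_coeff S 0 0 = S (0, 0)" by (simp add: taylor_coeff_def)
  have "mixed_partial i k (partial_j S) (0, 0) = mixed_partial i k \<sigma>2 (0, 0)"
    by (rule mixed_partial_cong[OF D p(2)])
  then show "taylor_coeff S i (Suc k) = mixed_partial i k \<sigma>2 (0, 0) / (fact i * fact (Suc k))"
    unfolding taylor_coeff_def mixed_partial_def by (simp only: funpow_Suc_right o_apply)
  have "mixed_partial i 0 (partial_l S) (0, 0) = mixed_partial i 0 \<sigma>1 (0, 0)"
    by (rule mixed_partial_cong[OF D p(1)])
  then show "taylor_coeff S (Suc i) 0 = mixed_partial i 0 \<sigma>1 (0, 0) / fact (Suc i)"
    unfolding taylor_coeff_def mixed_partial_def by (simp only: funpow_Suc_right o_apply funpow_0 fact_0 mult_1_right)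
qed

text \<open>What remains of a normal form once the symplectic chart is forgotten. As \<open>L\<close> is the first component of
both sides, the diffeomorphism has the form \<open>(l, h) \<mapsto> (l, g (l, h))\<close> on \<open>B = F ` U\<close>, with inverse
\<open>w \<mapsto> (fst w, k w)\<close>; the series is given by the derivatives of \<open>\<sigma>1\<close> and \<open>\<sigma>2\<close>, because
\<open>\<sigma>1\<close> and \<open>\<sigma>2\<close> are the partial derivatives of \<open>S\<close>.\<close>

lemma taylor_series_invariantE:
  assumes R: "R1 \<noteq> 0" "R2 \<noteq> 0" and inv: "is_taylor_series_invariant \<epsilon> R1 R2 t s"
  obtains B D :: "(real \<times> real) set" and g k \<tau>1 \<tau>2 \<sigma>1 \<sigma>2 :: "real \<times> real \<Rightarrow> real"
  where "open B" "(0, 0) \<in> B" "smooth g B" "g (0, 0) = 0" "\<And>b. b \<in> B \<Longrightarrow> 0 < partial_j g b"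
    "\<And>b. b \<in> B \<Longrightarrow> \<exists>a\<in>M. F R1 R2 t a = b"
    "open D" "(0, 0) \<in> D" "smooth k D" "k (0, 0) = 0"
    "\<And>w. w \<in> D \<Longrightarrow> (fst w, k w) \<in> B \<and> g (fst w, k w) = snd w"
    "\<And>a. a \<in> M \<Longrightarrow> F R1 R2 t a \<in> B \<Longrightarrow> (L R1 R2 a, g (F R1 R2 t a)) \<in> D - {(0, 0)} \<Longrightarrow>
      H_return R1 R2 t a
        (\<tau>1 (L R1 R2 a, g (F R1 R2 t a)) + partial_l g (F R1 R2 t a) * \<tau>2 (L R1 R2 a, g (F R1 R2 t a)))
        (partial_j g (F R1 R2 t a) * \<tau>2 (L R1 R2 a, g (F R1 R2 t a)))"
    "\<And>x y. (x, y) \<in> D - {(0, 0)} \<Longrightarrow> \<sigma>1 (x, y) = \<tau>1 (x, y) + \<epsilon> * Im (Ln (Complex x y))"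
    "\<And>x y. (x, y) \<in> D - {(0, 0)} \<Longrightarrow> \<sigma>2 (x, y) = \<tau>2 (x, y) + Re (Ln (Complex x y))"
    "smooth \<sigma>1 D" "smooth \<sigma>2 D" "s 0 0 = 0"
    "\<And>i k. s i (Suc k) = mixed_partial i k \<sigma>2 (0, 0) / (fact i * fact (Suc k))"
    "\<And>i. s (Suc i) 0 = mixed_partial i 0 \<sigma>1 (0, 0) / fact (Suc i)"
proof -
  obtain U V \<phi> g D \<tau>1 \<tau>2 \<sigma>1 \<sigma>2 S where nf: "is_normal_form R1 R2 t U V \<phi> g"
    and D: "open D" "(0, 0) \<in> D" "D \<subseteq> Q ` V"
    and ret: "\<forall>w\<in>D - {(0, 0)}. \<forall>a\<in>{p\<in>M. F R1 R2 t p \<in> F R1 R2 t ` U}. (g \<circ> F R1 R2 t) a = w \<longrightarrow>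
       are_return_times R1 R2 {p\<in>M. F R1 R2 t p \<in> F R1 R2 t ` U}
         (fst \<circ> (g \<circ> F R1 R2 t)) (snd \<circ> (g \<circ> F R1 R2 t)) a (\<tau>1 w) (\<tau>2 w)"
    and \<sigma>: "\<forall>w\<in>D - {(0, 0)}.
       \<sigma>1 w = \<tau>1 w + \<epsilon> * Im (Ln (Complex (fst w) (snd w))) \<and>
       \<sigma>2 w = \<tau>2 w + Re (Ln (Complex (fst w) (snd w)))"
    and sm: "smooth_map_on D \<sigma>1" "smooth_map_on D \<sigma>2"
    and S: "\<forall>w\<in>D. (S has_derivative (\<lambda>v. \<sigma>1 w * fst v + \<sigma>2 w * snd v)) (at w)"
      "S (0, 0) = 0" "s = taylor_coeff S"
    using inv unfolding is_taylor_series_invariant_def Let_def by (elim exE conjE) (rule that)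
  define B where "B = F R1 R2 t ` U"
  have UM: "U \<subseteq> M" and ff: "ff_point \<in> U" and B: "open B" and \<phi>0: "\<phi> ff_point = 0"
    and dg: "diffeomorphism_on B (Q ` V) g"
    and gQ: "\<And>p. p \<in> U \<Longrightarrow> g (F R1 R2 t p) = Q (\<phi> p)" and LQ: "\<And>p. p \<in> U \<Longrightarrow> L R1 R2 p = Q1 (\<phi> p)"
    and pos: "\<forall>(l, h)\<in>B. 0 < deriv (\<lambda>y. snd (g (l, y))) h"
    using nf unfolding is_normal_form_def B_def by (auto dest: openin_imp_subset)
  have F0: "F R1 R2 t ff_point = (0, 0)" by (simp add: F_def L_def H_def ff_point_def)
  have B0: "(0, 0) \<in> B" using ff F0 unfolding B_def by (metis imageI)
  have g0: "g (0, 0) = (0, 0)"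
    using gQ[OF ff] F0 \<phi>0 by (simp add: Q_def zero_prod_def)
  have fst_g: "fst (g b) = fst b" if b: "b \<in> B" for b
  proof -
    obtain p where "p \<in> U" "b = F R1 R2 t p" using b unfolding B_def by blast
    then show ?thesis using gQ[of p] LQ[of p] by (simp add: Q_def F_def)
  qed
  have sg: "smooth g B"
    using dg B by (intro smooth_map_on_open_imp_smooth[of B]) (auto simp: diffeomorphism_on_def)
  have sg1: "smooth (\<lambda>b. fst (g b)) B" and sg2: "smooth (\<lambda>b. snd (g b)) B"
    by (rule smooth_bounded_linear[OF bounded_linear_fst sg B]) (rule smooth_bounded_linear[OF bounded_linear_snd sg B])
  define K where "K = inv_into B g"
  have bij: "bij_betw g B (Q ` V)" using dg by (simp add: diffeomorphism_on_def)
  have K: "K w \<in> B \<and> g (K w) = w" if "w \<in> D" for w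
    using D(3) that bij unfolding K_def by (metis bij_betw_imp_surj_on f_inv_into_f inv_into_into subsetD)
  have K0: "K (0, 0) = (0, 0)"
    using bij B0 g0 unfolding K_def by (metis bij_betw_def inv_into_f_f)
  have Kfst: "fst (K w) = fst w" if "w \<in> D" for w using fst_g[of "K w"] K[OF that] by simp
  have sK: "smooth K D"
    using dg D unfolding K_def by (intro smooth_map_on_open_imp_smooth[of "Q ` V"]) (auto simp: diffeomorphism_on_def)
  have s\<sigma>: "smooth \<sigma>1 D" "smooth \<sigma>2 D" using sm D(1) by (auto intro: smooth_map_on_open_imp_smooth)
  define W where "W = {p \<in> M. F R1 R2 t p \<in> B}"
  show ?thesis
  proof (rule that[of B "\<lambda>b. snd (g b)" D "\<lambda>w. snd (K w)" \<tau>1 \<tau>2 \<sigma>1 \<sigma>2])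
    show "0 < partial_j (\<lambda>b. snd (g b)) b" if "b \<in> B" for b
      using pos that unfolding partial_j_def by (cases b) auto
    show "\<exists>a\<in>M. F R1 R2 t a = b" if "b \<in> B" for b using that UM unfolding B_def by blast
    show "(fst w, snd (K w)) \<in> B \<and> snd (g (fst w, snd (K w))) = snd w" if "w \<in> D" for w
      using K[OF that] Kfst[OF that] by (metis prod.collapse)
    show "smooth (\<lambda>w. snd (K w)) D" by (rule smooth_bounded_linear[OF bounded_linear_snd sK D(1)])
    show "H_return R1 R2 t a
        (\<tau>1 (L R1 R2 a, snd (g (F R1 R2 t a))) + partial_l (\<lambda>b. snd (g b)) (F R1 R2 t a) * \<tau>2 (L R1 R2 a, snd (g (F R1 R2 t a))))
        (partial_j (\<lambda>b. snd (g b)) (F R1 R2 t a) * \<tau>2 (L R1 R2 a, snd (g (F R1 R2 t a))))"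
      if a: "a \<in> M" "F R1 R2 t a \<in> B" and w: "(L R1 R2 a, snd (g (F R1 R2 t a))) \<in> D - {(0, 0)}" for a
    proof (rule are_return_times_imp_H_return[OF R B sg1 _ sg2, where W=W])
      have "g (F R1 R2 t a) = (L R1 R2 a, snd (g (F R1 R2 t a)))"
        using fst_g[OF a(2)] by (simp add: prod_eq_iff F_def)
      then show "are_return_times R1 R2 W (\<lambda>p. fst (g (F R1 R2 t p))) (\<lambda>p. snd (g (F R1 R2 t p))) a
         (\<tau>1 (L R1 R2 a, snd (g (F R1 R2 t a)))) (\<tau>2 (L R1 R2 a, snd (g (F R1 R2 t a))))"
        using ret w a unfolding W_def B_def o_def by blast
      show "0 < partial_j (\<lambda>b. snd (g b)) (F R1 R2 t a)"
        using pos a(2) unfolding partial_j_def by (cases "F R1 R2 t a") auto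
    qed (use a W_def fst_g in auto)
    show "\<sigma>1 (x, y) = \<tau>1 (x, y) + \<epsilon> * Im (Ln (Complex x y))" if "(x, y) \<in> D - {(0, 0)}" for x y
      using \<sigma> that by force
    show "\<sigma>2 (x, y) = \<tau>2 (x, y) + Re (Ln (Complex x y))" if "(x, y) \<in> D - {(0, 0)}" for x y
      using \<sigma> that by force
    show "s 0 0 = 0" "\<And>i k. s i (Suc k) = mixed_partial i k \<sigma>2 (0, 0) / (fact i * fact (Suc k))"
      "\<And>i. s (Suc i) 0 = mixed_partial i 0 \<sigma>1 (0, 0) / fact (Suc i)"
      unfolding S(3) using taylor_coeff_primitive[OF D(1,2) s\<sigma> S(1)] S(2) by simp_all
  qed (use B B0 sg2 g0 D K0 s\<sigma> in auto)
qed

section \<open>Comparison of the two systems\<close>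

lemma Im_Ln_right_half_plane: "0 < x \<Longrightarrow> Im (Ln (Complex x y)) = arctan (y / x)"
  using arg_conv_arctan[of "Complex x y"] Arg_eq_Im_Ln[of "Complex x y"] by (auto simp: complex_eq_iff)

lemma Im_Ln_reflected:
  assumes "0 < x"
  obtains m :: int where "Im (Ln (Complex (- x) y)) = - arctan (y / x) + pi * of_int m"
proof -
  have z: "Complex (- x) y = - Complex x (- y)" "Complex x (- y) \<noteq> 0" using assms by (auto simp: complex_eq_iff)
  have "Im (Ln (Complex (- x) y)) = Im (Ln (Complex x (- y))) + pi * of_int 1
    \<or> Im (Ln (Complex (- x) y)) = Im (Ln (Complex x (- y))) + pi * of_int (- 1)"
    unfolding z(1) using Ln_minus[OF z(2)] by auto
  then show ?thesis
    unfolding Im_Ln_right_half_plane[OF assms] using that[of 1] that[of "- 1"]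
    by (elim disjE) (simp_all add: arctan_minus)
qed

lemma Re_Ln_eq_ln_norm: "(x, y) \<noteq> (0, 0) \<Longrightarrow> Re (Ln (Complex x y)) = ln (norm (x, y))"
  by (subst Re_Ln) (auto simp: complex_eq_iff norm_Pair cmod_def)

lemma partial_l_iterate_const: "(partial_l ^^ i) (\<lambda>w. c) w = (if i = 0 then c else 0)"
proof -
  have "partial_l (\<lambda>w. c) = (\<lambda>w. 0)" for c by (simp add: partial_l_def fun_eq_iff)
  then have "(partial_l ^^ Suc i) (\<lambda>w. c) = (\<lambda>w. 0)" for i by (induction i) auto
  then show ?thesis by (cases i) (auto simp del: funpow.simps(2))
qed


text \<open>The bounds on \<open>t\<close> give \<open>0 < t < 1\<close>, so that the denominator \<open>R2 * (1 - t) + R1 * t\<close> of \<open>t'\<close> is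
positive. The bound \<open>t_plus R1 R2 \<le> 1\<close> is the inequality between the arithmetic and the
geometric mean.\<close>

lemma coupling_parameter_reflection:
  assumes R: "0 < R1" "R1 < R2" and t: "t_minus R1 R2 < t" "t < t_plus R1 R2"
    and t': "t' = R1 * t / (R2 + R1 * t - R2 * t)"
  obtains c d where "0 < c" "c * t = t'" "d * R2 = 1 - t'" "d * R1 = c * (1 - t)"
proof -
  have am: "2 * sqrt (R1 * R2) \<le> R1 + R2" using arith_geo_mean_sqrt[of R1 R2] R by simp
  have "0 < t_minus R1 R2" unfolding t_minus_def using R by (intro divide_pos_pos add_pos_nonneg) auto
  moreover have "t_plus R1 R2 \<le> 1" unfolding t_plus_def using am R by (subst divide_le_eq) auto
  ultimately have t01: "0 < t" "t < 1" using t by auto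
  define N where "N = R2 + R1 * t - R2 * t"
  have "0 < R2 * (1 - t) + R1 * t" using t01 R by (intro add_pos_pos mult_pos_pos) auto
  then have N: "0 < N" by (simp add: N_def algebra_simps)
  show ?thesis
  proof (rule that[of "R1 / N" "(1 - t) / N"])
    show "0 < R1 / N" using N R by simp
    show "R1 / N * t = t'" by (simp add: t' N_def)
    have "1 - t' = (N - R1 * t) / N" using N unfolding t' N_def[symmetric] by (simp add: field_simps)
    then show "(1 - t) / N * R2 = 1 - t'" by (simp add: N_def algebra_simps)
    show "(1 - t) / N * R1 = R1 / N * (1 - t)" by simp
  qed
qed

theorem corollary3p16:
  fixes R1 R2 t t' \<epsilon> :: real and S S' :: "nat \<Rightarrow> nat \<Rightarrow> real"
  assumes "0 < R1" and "R1 < R2"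
    and "t_minus R1 R2 < t" and "t < t_plus R1 R2"
    and "t' = R1 * t / (R2 + R1 * t - R2 * t)"
    and "\<epsilon> \<in> {- 1, 1}"
    and "is_taylor_series_invariant \<epsilon> R1 R2 t S"
    and "is_taylor_series_invariant \<epsilon> R2 R1 t' S'"
  shows "eq_mod_pi_l S (reflect_l S')"
proof -
  have R: "R1 \<noteq> 0" "R2 \<noteq> 0" using assms(1,2) by auto
  obtain c d where cd: "0 < c" "c * t = t'" "d * R2 = 1 - t'" "d * R1 = c * (1 - t)"
    using coupling_parameter_reflection[OF assms(1-5)] .
  obtain B D g k \<tau>1 \<tau>2 \<sigma>1 \<sigma>2 where B: "open B" "(0, 0) \<in> B" and g: "smooth g B" "g (0, 0) = 0"
    and g_pos: "\<And>b. b \<in> B \<Longrightarrow> 0 < partial_j g b" and surj: "\<And>b. b \<in> B \<Longrightarrow> \<exists>a\<in>M. F R1 R2 t a = b"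
    and D: "open D" "(0, 0) \<in> D" and k: "smooth k D" "k (0, 0) = 0"
    and kB: "\<And>w. w \<in> D \<Longrightarrow> (fst w, k w) \<in> B \<and> g (fst w, k w) = snd w"
    and ret: "\<And>a. a \<in> M \<Longrightarrow> F R1 R2 t a \<in> B \<Longrightarrow> (L R1 R2 a, g (F R1 R2 t a)) \<in> D - {(0, 0)} \<Longrightarrow>
      H_return R1 R2 t a
        (\<tau>1 (L R1 R2 a, g (F R1 R2 t a)) + partial_l g (F R1 R2 t a) * \<tau>2 (L R1 R2 a, g (F R1 R2 t a)))
        (partial_j g (F R1 R2 t a) * \<tau>2 (L R1 R2 a, g (F R1 R2 t a)))"
    and \<sigma>1: "\<And>x y. (x, y) \<in> D - {(0, 0)} \<Longrightarrow> \<sigma>1 (x, y) = \<tau>1 (x, y) + \<epsilon> * Im (Ln (Complex x y))"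
    and \<sigma>2: "\<And>x y. (x, y) \<in> D - {(0, 0)} \<Longrightarrow> \<sigma>2 (x, y) = \<tau>2 (x, y) + Re (Ln (Complex x y))"
    and s\<sigma>: "smooth \<sigma>1 D" "smooth \<sigma>2 D"
    and S: "S 0 0 = 0" "\<And>i k. S i (Suc k) = mixed_partial i k \<sigma>2 (0, 0) / (fact i * fact (Suc k))"
      "\<And>i. S (Suc i) 0 = mixed_partial i 0 \<sigma>1 (0, 0) / fact (Suc i)"
    by (rule taylor_series_invariantE[OF R assms(7)]) (rule that)
  obtain B' D' g' k' \<tau>1' \<tau>2' \<sigma>1' \<sigma>2' where B': "open B'" "(0, 0) \<in> B'" and g': "smooth g' B'" "g' (0, 0) = 0"
    and D': "open D'" "(0, 0) \<in> D'"
    and ret': "\<And>a. a \<in> M \<Longrightarrow> F R2 R1 t' a \<in> B' \<Longrightarrow> (L R2 R1 a, g' (F R2 R1 t' a)) \<in> D' - {(0, 0)} \<Longrightarrow>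
      H_return R2 R1 t' a
        (\<tau>1' (L R2 R1 a, g' (F R2 R1 t' a)) + partial_l g' (F R2 R1 t' a) * \<tau>2' (L R2 R1 a, g' (F R2 R1 t' a)))
        (partial_j g' (F R2 R1 t' a) * \<tau>2' (L R2 R1 a, g' (F R2 R1 t' a)))"
    and \<sigma>1': "\<And>x y. (x, y) \<in> D' - {(0, 0)} \<Longrightarrow> \<sigma>1' (x, y) = \<tau>1' (x, y) + \<epsilon> * Im (Ln (Complex x y))"
    and \<sigma>2': "\<And>x y. (x, y) \<in> D' - {(0, 0)} \<Longrightarrow> \<sigma>2' (x, y) = \<tau>2' (x, y) + Re (Ln (Complex x y))"
    and s\<sigma>': "smooth \<sigma>1' D'" "smooth \<sigma>2' D'"
    and S': "S' 0 0 = 0" "\<And>i k. S' i (Suc k) = mixed_partial i k \<sigma>2' (0, 0) / (fact i * fact (Suc k))"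
      "\<And>i. S' (Suc i) 0 = mixed_partial i 0 \<sigma>1' (0, 0) / fact (Suc i)"
    by (rule taylor_series_invariantE[OF R(2,1) assms(8)]) (rule that)

  \<comment> \<open>In the coordinates \<open>w\<close> of the first normal form, \<open>A w\<close> is the value of \<open>F\<close> of the second system at
    the exchanged point, and \<open>(x, y) \<mapsto> (x, y + f (x, y))\<close> is the transition to the second normal form,
    reflected in the first coordinate. On \<open>E\<close> everything is defined, and by the bound on \<open>fst w\<close> the points over it
    with \<open>fst w > 0\<close> have trivial stabiliser under rotations.\<close>
  define A where "A w = (- fst w, c * k w - d * fst w)" for w
  define f where "f w = g' (A w) - snd w" for w
  define rf where "rf w = (- fst w, snd w)" for w :: "real \<times> real"
  define E where "E = {w \<in> D. A w \<in> B'} \<inter> (rf -` D' \<inter> {w. fst w < 2 * (R2 - R1)})"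
  have sA: "smooth A D"
  proof -
    have "smooth (\<lambda>w. (- fst w, - d * fst w) + (0, c * k w)) D"
    proof (rule smooth_add[OF D(1)])
      show "smooth (\<lambda>w::real \<times> real. (- fst w, - d * fst w)) D"
        by (intro smooth_linear D bounded_linear_Pair bounded_linear_minus bounded_linear_fst
            bounded_linear_const_mult)
      show "smooth (\<lambda>w. (0::real, c * k w)) D"
        by (rule smooth_bounded_linear[OF _ k(1) D(1)])
          (intro bounded_linear_Pair bounded_linear_zero bounded_linear_mult_right)
    qed
    then show ?thesis unfolding A_def by (simp add: algebra_simps)
  qed
  have blr: "bounded_linear rf"
    unfolding rf_def by (intro bounded_linear_Pair bounded_linear_minus bounded_linear_fst bounded_linear_snd)
  have oA: "open {w \<in> D. A w \<in> B'}"
    using continuous_open_preimage[OF smooth_continuous[OF sA] D(1) B'(1)] by (simp add: vimage_def Int_def)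
  have orf: "open (rf -` D')" by (intro open_vimage D' linear_continuous_on blr)
  have E: "open E" unfolding E_def
    by (intro open_Int oA orf open_Collect_less continuous_intros)
  have E0: "(0, 0) \<in> E" using D D' B' k assms(2) by (simp add: E_def A_def rf_def)
  have ED: "E \<subseteq> D" and EB: "A ` E \<subseteq> B'" and Er: "rf ` E \<subseteq> D'" by (auto simp: E_def)
  have sf: "smooth f E" unfolding f_def
    by (intro smooth_diff E smooth_compose[OF g'(1) smooth_subset[OF sA ED] EB E B'(1)]
        smooth_linear bounded_linear_snd)
  have f0: "f (0, 0) = 0" using g' k by (simp add: f_def A_def)

  \<comment> \<open>The chain rule, with \<open>k\<close> eliminated by differentiating \<open>g (w1, k w) = w2\<close>.\<close>
  have partials: "partial_l f w = - partial_l g' (A w) - d * partial_j g' (A w)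
        - (1 + partial_j f w) * partial_l g (fst w, k w)
      \<and> (1 + partial_j f w) * partial_j g (fst w, k w) = c * partial_j g' (A w)" if w: "w \<in> E" for w
  proof -
    have wD: "w \<in> D" using w ED by blast
    let ?kl = "partial_l k w" and ?kj = "partial_j k w"
    let ?b = "(fst w, k w)"
    have dk: "(k has_derivative (\<lambda>v. ?kl * fst v + ?kj * snd v)) (at w)"
      by (rule smooth_has_derivative_partials(1)[OF k(1) wD])
    have dfst: "(fst has_derivative fst) (at w)" and dsnd: "(snd has_derivative snd) (at w)"
      by (rule bounded_linear_imp_has_derivative[OF bounded_linear_fst])
        (rule bounded_linear_imp_has_derivative[OF bounded_linear_snd])
    have "((\<lambda>w. g (fst w, k w)) has_derivative (\<lambda>v. partial_l g ?b * fst v + partial_j g ?b * (?kl * fst v + ?kj * snd v))) (at w)"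
      using has_derivative_compose[OF has_derivative_Pair[OF dfst dk]
          smooth_has_derivative_partials(1)[OF g(1) conjunct1[OF kB[OF wD]]]] by simp
    then have "((\<lambda>w. g (fst w, k w)) has_derivative (\<lambda>v. (partial_l g ?b + partial_j g ?b * ?kl) * fst v + (partial_j g ?b * ?kj) * snd v)) (at w)"
      by (simp add: algebra_simps)
    note 1 = has_derivative_imp_partial[OF this]
    have "((\<lambda>w::real \<times> real. snd w) has_derivative (\<lambda>v. 0 * fst v + 1 * snd v)) (at w)" using dsnd by simp
    note 2 = has_derivative_imp_partial[OF this]
    have eq: "partial_l g ?b + partial_j g ?b * ?kl = 0" "partial_j g ?b * ?kj = 1"
      using partial_cong[OF D(1) wD, of "\<lambda>w. g (fst w, k w)" "\<lambda>w. snd w"] kB 1 2 by simp_all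
    have "(A has_derivative (\<lambda>v. (- fst v, c * (?kl * fst v + ?kj * snd v) - d * fst v))) (at w)"
      unfolding A_def[abs_def]
      by (intro has_derivative_Pair has_derivative_minus has_derivative_diff has_derivative_mult_right dk dfst)
    from has_derivative_diff[OF has_derivative_compose[OF this smooth_has_derivative_partials(1)[OF g'(1)]] dsnd]
    have "(f has_derivative (\<lambda>v. (- partial_l g' (A w) + partial_j g' (A w) * (c * ?kl - d)) * fst v
        + (partial_j g' (A w) * c * ?kj - 1) * snd v)) (at w)"
      using EB w unfolding f_def[abs_def] by (auto simp: algebra_simps)
    note 3 = has_derivative_imp_partial[OF this]
    have nz: "partial_j g ?b \<noteq> 0" using g_pos[of ?b] kB[OF wD] by auto
    have kj: "?kj = 1 / partial_j g ?b" and kl: "?kl = - partial_l g ?b / partial_j g ?b"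
      using eq nz by (simp_all add: field_simps)
    show ?thesis unfolding 3 kj kl using nz by (simp add: field_simps)
  qed

  \<comment> \<open>Both normal forms determine the return times of \<open>(L, H)\<close> at the same point \<open>a\<close>, which are unique.\<close>
  have key: "\<exists>n::int. \<tau>1 (x, y) = - \<tau>1' (- x, y + f (x, y)) + partial_l f (x, y) * \<tau>2' (- x, y + f (x, y)) + 2 * pi * of_int n
      \<and> \<tau>2 (x, y) = (1 + partial_j f (x, y)) * \<tau>2' (- x, y + f (x, y))"
    if w: "(x, y) \<in> E" "(x, y + f (x, y)) \<in> E" "0 < x" for x y
  proof -
    let ?w = "(x, y)" and ?w' = "(- x, y + f (x, y))"
    define b where "b = (x, k (x, y))"
    have bB: "b \<in> B" "g b = y" using kB[of ?w] w(1) ED by (auto simp: b_def)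
    obtain a where a: "a \<in> M" "F R1 R2 t a = b" using surj[OF bB(1)] by blast
    have La: "L R1 R2 a = x" and Ha: "H t a = k ?w" using a(2) by (auto simp: F_def b_def)
    have L2: "x < 2 * (R2 - R1)" using w(1) by (simp add: E_def)
    have 1: "H_return R1 R2 t a (\<tau>1 ?w + partial_l g b * \<tau>2 ?w) (partial_j g b * \<tau>2 ?w)"
      using ret[OF a(1)] a(2) bB La w ED by auto
    have Fs: "F R2 R1 t' (swap_spheres a) = A ?w"
      unfolding F_swap[OF R cd(2,3,4,1)] La Ha by (simp add: A_def)
    then have Ls: "L R2 R1 (swap_spheres a) = - x" by (simp add: F_def A_def)
    have gs: "g' (A ?w) = y + f ?w" by (simp add: f_def)
    have "?w' \<in> D'" using w(2) Er by (force simp: rf_def)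
    then have "H_return R2 R1 t' (swap_spheres a)
        (\<tau>1' ?w' + partial_l g' (A ?w) * \<tau>2' ?w') (partial_j g' (A ?w) * \<tau>2' ?w')"
      using ret'[OF swap_in_M[OF a(1)]] w EB unfolding Fs Ls gs by auto
    from H_return_swap[OF R cd(2,3,4,1) this]
    have 2: "H_return R1 R2 t a (- (\<tau>1' ?w' + partial_l g' (A ?w) * \<tau>2' ?w') - d * (partial_j g' (A ?w) * \<tau>2' ?w'))
      (c * (partial_j g' (A ?w) * \<tau>2' ?w'))" .
    have Lpos: "0 < L R1 R2 a" "L R1 R2 a < 2 * (R2 - R1)" using La w(3) L2 by simp_all
    obtain n :: int where n: "partial_j g b * \<tau>2 ?w = c * (partial_j g' (A ?w) * \<tau>2' ?w')"
      "\<tau>1 ?w + partial_l g b * \<tau>2 ?w = - (\<tau>1' ?w' + partial_l g' (A ?w) * \<tau>2' ?w')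
        - d * (partial_j g' (A ?w) * \<tau>2' ?w') + 2 * pi * of_int n"
      using H_return_unique[OF 1 2 a(1) assms(1,2) Lpos] by blast
    have p: "partial_l f ?w = - partial_l g' (A ?w) - d * partial_j g' (A ?w) - (1 + partial_j f ?w) * partial_l g b"
      "(1 + partial_j f ?w) * partial_j g b = c * partial_j g' (A ?w)"
      using partials[OF w(1)] by (simp_all add: b_def)
    have "partial_j g b * \<tau>2 ?w = partial_j g b * ((1 + partial_j f ?w) * \<tau>2' ?w')"
      using n(1) p(2) by (metis mult.assoc mult.commute)
    then have t2: "\<tau>2 ?w = (1 + partial_j f ?w) * \<tau>2' ?w'"
      using g_pos[OF bB(1)] by simp
    have "\<tau>1 ?w = - \<tau>1' ?w' + partial_l f ?w * \<tau>2' ?w' + 2 * pi * of_int n"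
      using n(2) unfolding p(1) t2 by (simp add: algebra_simps)
    then show ?thesis using t2 by blast
  qed

  \<comment> \<open>The reflection changes the sign of \<open>dx\<close>, hence that of the first component of the form.\<close>
  define q1 where "q1 w = - \<sigma>1' (rf w)" for w
  define q2 where "q2 w = \<sigma>2' (rf w)" for w
  have srf: "smooth rf E" by (rule smooth_linear[OF blr E])
  have sq: "smooth q1 E" "smooth q2 E" unfolding q1_def q2_def
    by (intro smooth_bounded_linear[OF bounded_linear_minus[OF bounded_linear_ident]] smooth_compose[OF s\<sigma>'(1) srf Er E D'(1)] E)
      (rule smooth_compose[OF s\<sigma>'(2) srf Er E D'(1)])
  have reflected: "\<sigma>2' (- x, y') = \<tau>2' (- x, y') + ln (norm (x, y'))"
    "\<exists>m::int. \<sigma>1' (- x, y') = \<tau>1' (- x, y') + \<epsilon> * (- arctan (y' / x) + pi * of_int m)"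
    if xy: "(x, y') \<in> E" "0 < x" for x y'
  proof -
    have w': "(- x, y') \<in> D' - {(0, 0)}" using xy Er by (force simp: rf_def)
    show "\<sigma>2' (- x, y') = \<tau>2' (- x, y') + ln (norm (x, y'))"
      using \<sigma>2'[OF w'] Re_Ln_eq_ln_norm[of "- x" y'] xy(2) by (simp add: norm_Pair)
    obtain m :: int where "Im (Ln (Complex (- x) y')) = - arctan (y' / x) + pi * of_int m"
      using Im_Ln_reflected[OF xy(2)] by blast
    then show "\<exists>m::int. \<sigma>1' (- x, y') = \<tau>1' (- x, y') + \<epsilon> * (- arctan (y' / x) + pi * of_int m)"
      using \<sigma>1'[OF w'] by auto
  qed
  \<comment> \<open>The multiple of \<open>\<epsilon> * \<pi>\<close> from the reflected argument is an integer multiple of \<open>\<pi>\<close>, since \<open>\<epsilon>\<close> is an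
    integer.\<close>
  obtain e :: int where e: "\<epsilon> = of_int e" using assms(6) by (metis insertE of_int_1 of_int_minus singletonD)
  have "\<exists>n::int. (\<forall>i k. mixed_partial i k \<sigma>1 (0, 0) = mixed_partial i k (\<lambda>w. q1 w + pi * of_int n) (0, 0))
      \<and> (\<forall>i k. mixed_partial i k \<sigma>2 (0, 0) = mixed_partial i k q2 (0, 0))"
  proof (rule log_rigidity[OF E E0 sf f0 smooth_subset[OF s\<sigma>(1) ED] smooth_subset[OF s\<sigma>(2) ED] sq, where \<epsilon>=\<epsilon>])
    fix x y assume w: "(x, y) \<in> E" "(x, y + f (x, y)) \<in> E" "0 < x"
    let ?y' = "y + f (x, y)"
    have wD: "(x, y) \<in> D - {(0, 0)}" using w ED by auto
    have s2: "\<sigma>2 (x, y) = \<tau>2 (x, y) + ln (norm (x, y))"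
      using \<sigma>2[OF wD] Re_Ln_eq_ln_norm[of x y] w(3) by simp
    have s1: "\<sigma>1 (x, y) = \<tau>1 (x, y) + \<epsilon> * arctan (y / x)"
      using \<sigma>1[OF wD] Im_Ln_right_half_plane[OF w(3)] by simp
    obtain n :: int where n: "\<tau>1 (x, y) = - \<tau>1' (- x, ?y') + partial_l f (x, y) * \<tau>2' (- x, ?y') + 2 * pi * of_int n"
      "\<tau>2 (x, y) = (1 + partial_j f (x, y)) * \<tau>2' (- x, ?y')"
      using key[OF w] by blast
    have s2': "\<tau>2' (- x, ?y') = q2 (x, ?y') - ln (norm (x, ?y'))"
      using reflected(1)[OF w(2,3)] by (simp add: q2_def rf_def)
    obtain m :: int where "\<sigma>1' (- x, ?y') = \<tau>1' (- x, ?y') + \<epsilon> * (- arctan (?y' / x) + pi * of_int m)"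
      using reflected(2)[OF w(2,3)] by blast
    then have s1': "- \<tau>1' (- x, ?y') = q1 (x, ?y') - \<epsilon> * arctan (?y' / x) + \<epsilon> * (pi * of_int m)"
      by (simp add: q1_def rf_def algebra_simps)
    show "\<sigma>2 (x, y) - ln (norm (x, y)) = (1 + partial_j f (x, y)) * (q2 (x, ?y') - ln (norm (x, ?y')))"
      unfolding s2 n(2) s2' by simp
    show "\<exists>n::int. \<sigma>1 (x, y) - \<epsilon> * arctan (y / x) = q1 (x, ?y') - \<epsilon> * arctan (?y' / x)
        + partial_l f (x, y) * (q2 (x, ?y') - ln (norm (x, ?y'))) + pi * of_int n"
      unfolding s1 n(1) s1' s2' by (intro exI[of _ "2 * n + e * m"]) (simp add: e algebra_simps)
  qed blast
  then obtain n :: int where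
    n1: "\<And>i k. mixed_partial i k \<sigma>1 (0, 0) = mixed_partial i k (\<lambda>w. q1 w + pi * of_int n) (0, 0)" and
    n2: "\<And>i k. mixed_partial i k \<sigma>2 (0, 0) = mixed_partial i k q2 (0, 0)" by blast
  have m2: "mixed_partial i k \<sigma>2 (0, 0) = (- 1) ^ i * mixed_partial i k \<sigma>2' (0, 0)" for i k
    unfolding n2 q2_def rf_def using mixed_partial_reflect[OF D'(1) s\<sigma>'(2), of 0 0 i k] D'(2) by simp
  have m1: "mixed_partial i 0 \<sigma>1 (0, 0) = (- 1) ^ Suc i * mixed_partial i 0 \<sigma>1' (0, 0) + (if i = 0 then pi * of_int n else 0)" for i
  proof -
    have "mixed_partial i 0 \<sigma>1 (0, 0) = mixed_partial i 0 (\<lambda>w. pi * of_int n - \<sigma>1' (rf w)) (0, 0)"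
      unfolding n1 q1_def by (simp add: add.commute)
    also have "\<dots> = mixed_partial i 0 (\<lambda>w. pi * of_int n) (0, 0) - mixed_partial i 0 (\<lambda>w. \<sigma>1' (rf w)) (0, 0)"
      by (rule mixed_partial_diff[OF E smooth_const[OF E] smooth_compose[OF s\<sigma>'(1) srf Er E D'(1)] E0])
    also have "mixed_partial i 0 (\<lambda>w. \<sigma>1' (rf w)) (0, 0) = (- 1) ^ i * mixed_partial i 0 \<sigma>1' (0, 0)"
      unfolding rf_def using mixed_partial_reflect[OF D'(1) s\<sigma>'(1), of 0 0 i 0] D'(2) by simp
    finally show ?thesis by (simp add: mixed_partial_def partial_l_iterate_const)
  qed
  have "S i j = reflect_l S' i j" if "(i, j) \<noteq> (1, 0)" for i j
  proof (cases j)
    case (Suc k)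
    then show ?thesis by (simp add: reflect_l_def S(2) S'(2) m2)
  next
    case 0
    then show ?thesis using that by (cases i) (simp_all add: reflect_l_def S S' m1)
  qed
  moreover have "S 1 0 = reflect_l S' 1 0 + of_int n * pi"
    using S(3)[of 0] S'(3)[of 0] m1[of 0] by (simp add: reflect_l_def)
  ultimately show ?thesis unfolding eq_mod_pi_l_def by blast
qed

end
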